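(* Fix $\lambda\ge 1$ and a family of locally invariant manifolds $\mathcal{M}_\varepsilon$, $\varepsilon\in(0,\varepsilon_0)$, as described in the context. For each $\varepsilon>0$ sufficiently small, there is a heteroclinic orbit $(w_{1,\varepsilon},w_{2,\varepsilon},\varphi_{1,\varepsilon},\varphi_{2,\varepsilon})$, $x\in\mathbb{R}$, of the slow-fast system (S$_\varepsilon$) of the context, connecting the equilibrium $(0,0,\frac{\pi}{2},0)$ (as $x\to-\infty$) to the equilibrium $(0,0,0,0)$ (as $x\to+\infty$), which lies on $\mathcal{M}_\varepsilon$. More precisely, the following estimates hold: \[ w_{1,\varepsilon}=\frac{\varphi_{2,\varepsilon}^2+\left(\frac{1}{\lambda^2}+1\right)\sin^2\varphi_{1,\varepsilon}\cos^2\varphi_{1,\varepsilon}}{2\left[1+\left(\frac{1}{\lambda^2}-1\right)\cos^2\varphi_{1,\varepsilon}\right]}+\mathcal{O}(\varepsilon)\min\left\{e^{\frac{2x}{\lambda}},e^{-2x}\right\}, \] \[ w_{2,\varepsilon}=\mathcal{O}(\varepsilon)\min\left\{e^{\frac{2x}{\lambda}},e^{-2x}\right\}, \] \[ \varphi_{i,\varepsilon}=\varphi_{i,0}+\mathcal{O}(\varepsilon)\min\left\{e^{\frac{x}{\lambda}},e^{-x}\right\},\quad i=1,2, \] uniformly in $x\in\mathbb{R}$, as $\varepsilon\to0$ (i.e. each $\mathcal{O}(\varepsilon)$ is bounded in absolute value by $C\varepsilon$ with $C$ independent of $x\in\mathbb{R}$ and of small $\varepsilon>0$). Moreover, $\varphi_{2,\varepsilon}<0$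 on $\mathbb{R}$.
   Context: Throughout $\lambda\ge1$ is a fixed constant and $'=d/dx$. **The system (S$_\varepsilon$).** For $\varepsilon>0$, \[ \begin{aligned} \varepsilon w_1'&=w_2,\\ \varepsilon w_2'&=-(1-\varepsilon^2w_1)\varphi_2^2-(1-\varepsilon^2w_1)(\varepsilon^2w_1^2-2w_1)\left[1+\left(\tfrac{1}{\lambda^2}-1\right)\cos^2\varphi_1\right]\\ &\quad-(1-\varepsilon^2w_1)^3\left(\tfrac{1}{\lambda^2}+1\right)\sin^2\varphi_1\cos^2\varphi_1,\\ \varphi_1'&=\varphi_2,\\ \varphi_2'&=\frac{2\varepsilon w_2\varphi_2}{1-\varepsilon^2w_1}+\left(1-\tfrac{1}{\lambda^2}\right)(\varepsilon^2w_1^2-2w_1)\sin\varphi_1\cos\varphi_1\\ &\quad+(1-\varepsilon^2w_1)^2\left(\sin\varphi_1\cos^3\varphi_1-\tfrac{1}{\lambda^2}\cos\varphi_1\sin^3\varphi_1\right). \end{aligned} \] (It is obtained from $\lambda^2\ddot u=u^3-u+\Lambda v^2u$, $\ddot v=v^3-v+\Lambda u^2v$ via $\varepsilon=\sqrt{\Lambda-1}$, $x=\varepsilon z$, $u=R\cos\varphi$, $v=R\sin\varphi$, $R=1-\varepsilon^2w$, $w_1=w$, $w_2=\varepsilon w_1'$, $\varphi_1=\varphi$, $\varphi_2=\varphi_1'$.) **The limit functions.** $\varphi_{1,0}$ is the unique solution of \[ \varphi_1'=-\frac{1}{2\lambda}\sin(2\varphi_1)\left[1+\left(\tfrac{1}{\lambda^2}-1\right)\cos^2\varphi_1\right]^{-1/2},\quad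 \varphi_1\to\tfrac{\pi}{2}\ (x\to-\infty),\quad \varphi_1\to0\ (x\to+\infty), \] with $\varphi_{1,0}(0)=\frac{\pi}{4}$, and $\varphi_{2,0}=\varphi_{1,0}'<0$. **The manifolds $\mathcal{M}_\varepsilon$.** Let $\mathcal{K}$ be a compact subset of the $(\varphi_1,\varphi_2)$ plane which is the closure of a smooth domain containing the curve $\{(\varphi_{1,0}(x),\varphi_{2,0}(x)):x\in\mathbb{R}\}$ together with its endpoints $(\frac{\pi}{2},0)$ and $(0,0)$, and which is symmetric with respect to the lines $\varphi_1=0$ and $\varphi_2=0$. Let $m\ge1$ be a given integer. By Fenichel's theorem (applied to the normally hyperbolic critical manifold obtained from the first two equations of (S$_\varepsilon$) at $\varepsilon=0$) there are functions $h_1,h_2\in C^m(\mathcal{K}\times[0,\infty))$ and $\varepsilon_0>0$ such that for every $\varepsilon\in(0,\varepsilon_0)$ the graph \[ \mathcal{M}_\varepsilon:\quad w_1=\frac{\varphi_2^2+\left(\frac{1}{\lambda^2}+1\right)\sin^2\varphi_1\cos^2\varphi_1}{2\left[1+\left(\frac{1}{\lambda^2}-1\right)\cos^2\varphi_1\right]}+\varepsilon h_1(\varphi_1,\varphi_2,\varepsilon),\quad w_2=\varepsilon h_2(\varphi_1,\varphi_2,\varepsilon),\quad(\varphi_1,\varphi_2)\in\mathcal{K}, \] is locally invariant under (S$_\varepsilon$) (solutions starting on it can leave it only through its boundary). Both equilibria lie on it, i.e. $h_i(\frac{\pi}{2},0,\varepsilon)=h_i(0,0,\varepsilon)=0$ for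 $i=1,2$, $\varepsilon\in[0,\varepsilon_0)$, and the functions are chosen so that $h_i(-\varphi_1,-\varphi_2,\varepsilon)=h_i(\varphi_1,\varphi_2,\varepsilon)$ for $i=1,2$, $\varepsilon\in[0,\varepsilon_0)$. Such a family $\mathcal{M}_\varepsilon$ is fixed. *)

theory Defs
  imports "HOL-Analysis.Analysis"
begin

(* Derivatives are taken within S. For open S this is the usual notion; when S is the closure of
   a region with smooth or Lipschitz boundary (where derivatives within S are unique) it means
   that all derivatives up to order k exist and are continuous up to the boundary. *)
primrec Ck_on :: "nat \<Rightarrow> 'a::euclidean_space set \<Rightarrow> ('a \<Rightarrow> 'b::real_normed_vector) \<Rightarrow> bool"
where
  "Ck_on 0 S f \<longleftrightarrow> continuous_on S f"
| "Ck_on (Suc k) S f \<longleftrightarrow>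
     (\<exists>f'. (\<forall>x\<in>S. (f has_derivative f' x) (at x within S)) \<and> (\<forall>v. Ck_on k S (\<lambda>x. f' x v)))"

(* Near each boundary point the domain is a strict sublevel set of a smooth function whose
   derivative does not vanish at that point. *)
definition smooth_domain :: "'a::euclidean_space set \<Rightarrow> bool" where
  "smooth_domain D \<longleftrightarrow> open D \<and> connected D \<and> D \<noteq> {} \<and>
     (\<forall>p\<in>frontier D. \<exists>U (\<rho> :: 'a \<Rightarrow> real) \<rho>'. open U \<and> p \<in> U \<and> (\<forall>k. Ck_on k U \<rho>) \<and>
        (\<rho> has_derivative \<rho>') (at p) \<and> \<rho>' \<noteq> (\<lambda>_. 0) \<and> D \<inter> U = {q \<in> U. \<rho> q < 0})"

definition weight :: "real \<Rightarrow> real \<Rightarrow> real" where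
  "weight lam a = 1 + (1 / lam^2 - 1) * (cos a)^2"

definition solves_S ::
  "real \<Rightarrow> real \<Rightarrow> real set \<Rightarrow> (real \<Rightarrow> real) \<Rightarrow> (real \<Rightarrow> real) \<Rightarrow> (real \<Rightarrow> real) \<Rightarrow> (real \<Rightarrow> real) \<Rightarrow> bool"
where
  "solves_S lam \<epsilon> T w1 w2 p1 p2 \<longleftrightarrow> (\<forall>x\<in>T.
     1 - \<epsilon>^2 * w1 x \<noteq> 0 \<and>
     (w1 has_real_derivative w2 x / \<epsilon>) (at x within T) \<and>
     (w2 has_real_derivative
        (- (1 - \<epsilon>^2 * w1 x) * (p2 x)^2
         - (1 - \<epsilon>^2 * w1 x) * (\<epsilon>^2 * (w1 x)^2 - 2 * w1 x) * weight lam (p1 x)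
         - (1 - \<epsilon>^2 * w1 x)^3 * (1 / lam^2 + 1) * (sin (p1 x))^2 * (cos (p1 x))^2) / \<epsilon>)
       (at x within T) \<and>
     (p1 has_real_derivative p2 x) (at x within T) \<and>
     (p2 has_real_derivative
        2 * \<epsilon> * w2 x * p2 x / (1 - \<epsilon>^2 * w1 x)
        + (1 - 1 / lam^2) * (\<epsilon>^2 * (w1 x)^2 - 2 * w1 x) * sin (p1 x) * cos (p1 x)
        + (1 - \<epsilon>^2 * w1 x)^2
          * (sin (p1 x) * (cos (p1 x))^3 - 1 / lam^2 * cos (p1 x) * (sin (p1 x))^3))
       (at x within T))"

definition limit_profile :: "real \<Rightarrow> (real \<Rightarrow> real) \<Rightarrow> bool" where
  "limit_profile lam p \<longleftrightarrow>
     (\<forall>x. (p has_real_derivative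
            - (1 / (2 * lam)) * sin (2 * p x) * (1 / sqrt (weight lam (p x)))) (at x)) \<and>
     (p \<longlongrightarrow> pi / 2) at_bot \<and> (p \<longlongrightarrow> 0) at_top \<and> p 0 = pi / 4"

(* The endpoints are the limits of the curve at -\<infinity> and +\<infinity>. Curve and endpoints lie in the open
   domain D, hence in the interior of K. *)
definition admissible_region :: "(real \<Rightarrow> real) \<Rightarrow> (real \<times> real) set \<Rightarrow> bool" where
  "admissible_region p K \<longleftrightarrow> compact K \<and>
     (\<exists>D. smooth_domain D \<and> K = closure D \<and>
        (\<forall>x. (p x, deriv p x) \<in> D) \<and> (pi / 2, 0) \<in> D \<and> (0, 0) \<in> D) \<and>
     (\<forall>a b. (a, b) \<in> K \<longrightarrow> (- a, b) \<in> K \<and> (a, - b) \<in> K)"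

definition w_crit :: "real \<Rightarrow> real \<Rightarrow> real \<Rightarrow> real" where
  "w_crit lam a b = (b^2 + (1 / lam^2 + 1) * (sin a)^2 * (cos a)^2) / (2 * weight lam a)"

definition slow_graph ::
  "real \<Rightarrow> (real \<Rightarrow> real \<Rightarrow> real \<Rightarrow> real) \<Rightarrow> (real \<Rightarrow> real \<Rightarrow> real \<Rightarrow> real) \<Rightarrow> (real \<times> real) set \<Rightarrow> real
   \<Rightarrow> (real \<times> real \<times> real \<times> real) set"
where
  "slow_graph lam h1 h2 A \<epsilon> =
     {(w_crit lam a b + \<epsilon> * h1 a b \<epsilon>, \<epsilon> * h2 a b \<epsilon>, a, b) | a b. (a, b) \<in> A}"

(* Any solution segment starting on M at time s (running forwards if s < t, backwards if t < s)
   either stays on M or stays on M until it hits the boundary B. *)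
definition locally_invariant ::
  "real \<Rightarrow> real \<Rightarrow> (real \<times> real \<times> real \<times> real) set \<Rightarrow> (real \<times> real \<times> real \<times> real) set \<Rightarrow> bool"
where
  "locally_invariant lam \<epsilon> M B \<longleftrightarrow>
     (\<forall>w1 w2 p1 p2 s t. solves_S lam \<epsilon> (closed_segment s t) w1 w2 p1 p2 \<longrightarrow>
        (w1 s, w2 s, p1 s, p2 s) \<in> M \<longrightarrow>
        (\<forall>x\<in>closed_segment s t. (w1 x, w2 x, p1 x, p2 x) \<in> M) \<or>
        (\<exists>r\<in>closed_segment s t. (w1 r, w2 r, p1 r, p2 r) \<in> B \<and>
           (\<forall>x\<in>closed_segment s r. (w1 x, w2 x, p1 x, p2 x) \<in> M)))"

definition slow_manifold_family ::
  "real \<Rightarrow> (real \<times> real) set \<Rightarrow> nat \<Rightarrow> (real \<Rightarrow> real \<Rightarrow> real \<Rightarrow> real) \<Rightarrow> (real \<Rightarrow> real \<Rightarrow> real \<Rightarrow> real)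
   \<Rightarrow> real \<Rightarrow> bool"
where
  "slow_manifold_family lam K m h1 h2 \<epsilon>0 \<longleftrightarrow> \<epsilon>0 > 0 \<and>
     (\<forall>h\<in>{h1, h2}.
        Ck_on m {(a, b, \<epsilon>) | a b \<epsilon>. (a, b) \<in> K \<and> 0 \<le> \<epsilon>} (\<lambda>(a, b, \<epsilon>). h a b \<epsilon>) \<and>
        (\<forall>\<epsilon>\<in>{0..<\<epsilon>0}. h (pi / 2) 0 \<epsilon> = 0 \<and> h 0 0 \<epsilon> = 0 \<and>
           (\<forall>a b. (a, b) \<in> K \<longrightarrow> h (- a) (- b) \<epsilon> = h a b \<epsilon>))) \<and>
     (\<forall>\<epsilon>\<in>{0<..<\<epsilon>0}. locally_invariant lam \<epsilon>
        (slow_graph lam h1 h2 K \<epsilon>) (slow_graph lam h1 h2 (frontier K) \<epsilon>))"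

end

theory Submission
  imports Defs
begin

text \<open>
  In polar form \<open>u = R cos \<phi>\<close>, \<open>v = R sin \<phi>\<close>, the system is Hamiltonian. On the invariant graph the
  zero energy level is, up to \<open>O(\<epsilon>\<^sup>2)\<close>, the curve \<open>(lam\<^sup>2 sin\<^sup>2 \<phi> + cos\<^sup>2 \<phi>) b\<^sup>2 = sin\<^sup>2 \<phi> cos\<^sup>2 \<phi>\<close> of the
  limit profile; the relative error is small up to the equilibria because \<open>h1\<close> and \<open>h2\<close> are \<open>C\<^sup>1\<close> and
  vanish there. Hence a solution on the graph with zero energy and \<open>\<phi>1 = pi/4\<close> at time \<open>0\<close> stays for
  all times in a thin tube around the limit curve, and in particular on the graph.

  The rates are recovered in a second step. Along this orbit the two fast equations form a
  hyperbolic linear system forced by terms of size \<open>\<epsilon> sin\<^sup>2 \<phi>1 cos\<^sup>2 \<phi>1\<close>, so the bounded pair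
  \<open>(w1 - w_crit, w2)\<close> has that size. With this, energy conservation gives
  \<open>\<phi>1' = - sin \<phi>1 cos \<phi>1 (1 + O(\<epsilon>\<^sup>2 sin\<^sup>2 \<phi>1 cos\<^sup>2 \<phi>1)) / sqrt (lam\<^sup>2 sin\<^sup>2 \<phi>1 + cos\<^sup>2 \<phi>1)\<close>. The error is
  integrable in time, so \<open>\<phi>1\<close> is the limit profile at a time shifted by \<open>O(\<epsilon>\<^sup>2)\<close>.
\<close>

text \<open>Since the graph is only locally invariant, the orbit must be kept away from the boundary
  of \<open>K\<close>. Energy does this: it vanishes at both equilibria, and zero energy confines
  \<open>b\<close> for each angle \<open>a\<close>. No transversality argument is needed; the
  intermediate value theorem picks the initial slope at \<open>pi/4\<close>. The comparison must be
  relative to \<open>(sin a * cos a)^2\<close>, because near the equilibria an absolute error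
  O(\<epsilon>) exceeds the limit slope itself.

  The graph alone gives too little decay. With \<open>h1\<close>, \<open>h2\<close> merely
  \<open>C^1\<close>, it yields \<open>w1 - w_crit\<close> of order \<epsilon> times the distance to
  the equilibrium, so \<open>exp(-x)\<close> instead of \<open>exp(-2x)\<close>, and a relative
  slope error O(\<epsilon>^2) that does not decay and would perturb the exponents. Both defects are
  repaired by using boundedness of the orbit on the whole line, in both time directions, in the fast
  equations. No rate has to be known beforehand: the time shift is controlled by the total variation
  of the monotone angle, and the rates are then read off an explicit antiderivative.\<close>

section \<open>Global solutions of Lipschitz equations\<close>

lemma antiderivative_UNIV:
  fixes g :: "real \<Rightarrow> 'a::euclidean_space"
  assumes "continuous_on UNIV g"
  shows "\<exists>G. G 0 = 0 \<and> (\<forall>x. (G has_vector_derivative g x) (at x))"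
proof -
  define G where "G = (\<lambda>x. LBINT y=0..ereal x. g y)"
  have "G 0 = 0" by (simp add: G_def flip: zero_ereal_def)
  moreover have "(G has_vector_derivative g x) (at x)" for x :: real
  proof -
    let ?r = "\<bar>x\<bar> + 1"
    have "(G has_vector_derivative g x) (at x within {-?r..?r})"
      using interval_integral_FTC2[of "-?r" 0 ?r g x] continuous_on_subset[OF assms]
      unfolding G_def by (auto simp: zero_ereal_def)
    moreover have "at x within {-?r..?r} = at x"
      by (rule at_within_Icc_at) auto
    ultimately show ?thesis by simp
  qed
  ultimately show ?thesis by (intro exI[of _ G]) simp
qed

text \<open>Integration from 0 gains the factor \<open>1 / k\<close> in the norm weighted by
  \<open>exp (- k * \<bar>x\<bar>)\<close>. This gain is what makes the Picard operator contract on
  the whole line at once.\<close>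

lemma exp_weighted_bound:
  fixes G :: "real \<Rightarrow> 'a::euclidean_space"
  assumes k: "k > 0" and G0: "G 0 = 0"
    and d: "\<And>x. (G has_vector_derivative g x) (at x)"
    and b: "\<And>x. norm (g x) \<le> c * exp (k * \<bar>x\<bar>)"
  shows "norm (G x) \<le> c / k * exp (k * \<bar>x\<bar>)"
proof -
  have pos: "norm (F x) \<le> c / k * exp (k * x)"
    if "x \<ge> 0" "F 0 = 0" "\<And>x. (F has_vector_derivative f x) (at x)" 
      "\<And>x. x \<ge> 0 \<Longrightarrow> norm (f x) \<le> c * exp (k * x)" for x and F f :: "real \<Rightarrow> 'a"
  proof (cases "x = 0")
    case True
    have "0 \<le> c" using order_trans[OF norm_ge_zero that(4)[of 0]] by simp
    then show ?thesis using True that k by simp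
  next
    case False
    then have x: "0 < x" using that by simp
    have "norm (F x - F 0) \<le> c / k * exp (k * x) - c / k * exp (k * 0)"
    proof (rule differentiable_bound_general[OF x, where f' = f and \<phi>' = "\<lambda>t. c * exp (k * t)"])
      show "continuous_on {0..x} F"
        using that(3) by (meson continuous_at_imp_continuous_on has_vector_derivative_continuous)
      show "continuous_on {0..x} (\<lambda>x. c / k * exp (k * x))" by (intro continuous_intros)
      show "((\<lambda>x. c / k * exp (k * x)) has_vector_derivative c * exp (k * t)) (at t)" for t
        unfolding has_real_derivative_iff_has_vector_derivative[symmetric]
        using k by (auto intro!: derivative_eq_intros)
    qed (use that in auto)
    moreover have "0 \<le> c / k" using order_trans[OF norm_ge_zero that(4)[of 0]] k by simp
    ultimately show ?thesis using that(2) by simp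
  qed
  show ?thesis
  proof (cases "x \<ge> 0")
    case True
    have "norm (G x) \<le> c / k * exp (k * x)"
    proof (rule pos[OF True G0 d])
      show "norm (g t) \<le> c * exp (k * t)" if "t \<ge> 0" for t using b[of t] that by simp
    qed
    then show ?thesis using True by simp
  next
    case False
    have "norm (G (- (- x))) \<le> c / k * exp (k * (- x))"
    proof (rule pos[where F = "\<lambda>t. G (- t)" and f = "\<lambda>t. - g (- t)"])
      show "((\<lambda>t. G (- t)) has_vector_derivative - g (- t)) (at t)" for t
      proof -
        have "(uminus has_vector_derivative - 1) (at t)"
          by (auto intro!: derivative_eq_intros)
        from vector_diff_chain_at[OF this d[of "- t"]] show ?thesis by (simp add: o_def)
      qed
      show "norm (- g (- t)) \<le> c * exp (k * t)" if "t \<ge> 0" for t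
        using b[of "- t"] that by simp
    qed (use False G0 in auto)
    then show ?thesis using False by simp
  qed
qed

text \<open>Bielecki's weighted norm: the unknown is
  \<open>Y t = exp (- k * \<bar>t\<bar>) X t\<close> among the bounded continuous functions. With
  \<open>k = L + 1\<close> the Picard operator has contraction constant \<open>L / k < 1\<close>, so
  a single use of Banach's theorem gives the solution for all times, without continuation.\<close>

lemma picard_lindelof_global:
  fixes F :: "'a::euclidean_space \<Rightarrow> 'a"
  assumes F: "L-lipschitz_on UNIV F"
  shows "\<exists>X. X 0 = X0 \<and> (\<forall>t. (X has_vector_derivative F (X t)) (at t))"
proof -
  define k where "k = L + 1"
  have L: "L \<ge> 0" and k: "k > 0" "L / k < 1"
    using lipschitz_on_nonneg[OF F] by (auto simp: k_def)
  have lip: "norm (F x - F y) \<le> L * norm (x - y)" for x y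
    using lipschitz_onD[OF F, of x y] by (simp add: dist_norm)
  have Fcont: "continuous_on S F" for S
    using lipschitz_on_continuous_on[OF F] continuous_on_subset by blast
  define e where "e = (\<lambda>t::real. exp (k * \<bar>t\<bar>))"
  have e_pos: "e t > 0" for t by (simp add: e_def)
  have e_cont: "continuous_on UNIV e" unfolding e_def by (intro continuous_intros)
  define f where "f = (\<lambda>(Y::real \<Rightarrow>\<^sub>C 'a) t. F (e t *\<^sub>R apply_bcontfun Y t))"
  have f_cont: "continuous_on UNIV (f Y)" for Y
    unfolding f_def 
    by (intro continuous_on_compose2[OF Fcont[of UNIV]] continuous_intros e_cont) auto
  define I where "I = (\<lambda>Y. SOME G. G 0 = 0 \<and> (\<forall>x. (G has_vector_derivative f Y x) (at x)))"
  have I: "I Y 0 = 0" "(I Y has_vector_derivative f Y x) (at x)" for Y x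
    using someI_ex[OF antiderivative_UNIV[OF f_cont[of Y]]] unfolding I_def by auto
  define T where "T = (\<lambda>Y t. (1 / e t) *\<^sub>R (X0 + I Y t))"
  have T_bcont: "T Y \<in> bcontfun" for Y
  proof -
    have "continuous_on UNIV (I Y)"
      using I(2) by (meson continuous_at_imp_continuous_on has_vector_derivative_continuous)
    then have "continuous_on UNIV (T Y)" unfolding T_def
      by (intro continuous_intros e_cont) (use e_pos in \<open>auto simp: less_imp_neq[symmetric]\<close>)
    moreover have "norm (T Y t) \<le> norm X0 + (norm (F 0) + L * norm Y) / k" for t
    proof -
      have "norm (f Y t) \<le> (norm (F 0) + L * norm Y) * exp (k * \<bar>t\<bar>)" for t
      proof -
        have "norm (f Y t) \<le> norm (F 0) + L * norm (e t *\<^sub>R apply_bcontfun Y t)"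
          unfolding f_def using lip[of "e t *\<^sub>R apply_bcontfun Y t" 0] norm_triangle_sub[of "F (e t *\<^sub>R apply_bcontfun Y t)" "F 0"] by simp
        also have "\<dots> \<le> norm (F 0) + L * (e t * norm Y)"
          using L e_pos[of t] norm_bounded[of Y t] by (auto intro!: mult_left_mono)
        also have "\<dots> \<le> norm (F 0) * e t + L * (e t * norm Y)"
          using mult_left_mono[of 1 "e t" "norm (F 0)"] k(1) by (auto simp: e_def)
        finally show ?thesis by (simp add: e_def algebra_simps)
      qed
      from exp_weighted_bound[OF k(1) I(1) I(2) this, of t]
      have "norm (I Y t) \<le> (norm (F 0) + L * norm Y) / k * e t" by (simp add: e_def)
      then have "norm (X0 + I Y t) \<le> norm X0 * e t + (norm (F 0) + L * norm Y) / k * e t"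
        using norm_triangle_ineq[of X0 "I Y t"] mult_left_mono[of 1 "e t" "norm X0"] k(1) by (auto simp: e_def)
      then have "norm (X0 + I Y t) / e t \<le> norm X0 + (norm (F 0) + L * norm Y) / k"
        using e_pos[of t] by (simp add: pos_divide_le_eq distrib_right)
      then show ?thesis using e_pos[of t] unfolding T_def by simp
    qed
    ultimately show ?thesis by (intro bcontfun_normI)
  qed
  define \<Phi> where "\<Phi> = (\<lambda>Y. Bcontfun (T Y))"
  have \<Phi>: "apply_bcontfun (\<Phi> Y) = T Y" for Y
    unfolding \<Phi>_def by (rule Bcontfun_inverse[OF T_bcont])
  have "dist (\<Phi> Y) (\<Phi> Z) \<le> L / k * dist Y Z" for Y Z
  proof (rule dist_bound)
    fix t
    have "norm (f Y t - f Z t) \<le> (L * dist Y Z) * exp (k * \<bar>t\<bar>)" for t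
    proof -
      have "norm (f Y t - f Z t) \<le> L * norm (e t *\<^sub>R (apply_bcontfun Y t - apply_bcontfun Z t))"
        unfolding f_def using lip[of "e t *\<^sub>R apply_bcontfun Y t" "e t *\<^sub>R apply_bcontfun Z t"]
        by (simp add: scaleR_diff_right)
      also have "\<dots> \<le> L * (e t * dist Y Z)"
        using L e_pos[of t] dist_bounded[of Y t Z] by (auto intro!: mult_left_mono simp: dist_norm)
      finally show ?thesis by (simp add: e_def algebra_simps)
    qed
    note lip_f = this
    have dI: "((\<lambda>t. I Y t - I Z t) has_vector_derivative f Y t - f Z t) (at t)" for t
      by (intro derivative_intros I)
    have "norm (I Y t - I Z t) \<le> L * dist Y Z / k * e t"
      unfolding e_def by (rule exp_weighted_bound[OF k(1) _ dI lip_f]) (simp add: I(1))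
    show "dist (apply_bcontfun (\<Phi> Y) t) (apply_bcontfun (\<Phi> Z) t) \<le> L / k * dist Y Z"
    proof -
      have "dist (T Y t) (T Z t) = norm ((1 / e t) *\<^sub>R (I Y t - I Z t))"
        unfolding T_def dist_norm by (rule arg_cong[where f = norm]) (simp add: scaleR_diff_right scaleR_add_right)
      also have "\<dots> = norm (I Y t - I Z t) / e t" using e_pos[of t] by simp
      also have "\<dots> \<le> L * dist Y Z / k"
        using \<open>norm (I Y t - I Z t) \<le> _\<close> e_pos[of t] by (simp only: pos_divide_le_eq)
      finally show ?thesis unfolding \<Phi> by simp
    qed
  qed
  then have "\<exists>!Y. \<Phi> Y = Y"
    using banach_fix_type[of "L / k" \<Phi>] k L by simp
  then obtain Y where Y: "\<Phi> Y = Y" by auto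
  define X where "X = (\<lambda>t. X0 + I Y t)"
  have YX: "e t *\<^sub>R apply_bcontfun Y t = X t" for t
    using \<Phi>[of Y] Y e_pos[of t] by (simp add: T_def X_def)
  have "(X has_vector_derivative F (X t)) (at t)" for t
  proof -
    have "(X has_vector_derivative 0 + f Y t) (at t)"
      unfolding X_def by (intro has_vector_derivative_add has_vector_derivative_const I(2))
    then show ?thesis by (simp add: f_def YX)
  qed
  moreover have "X 0 = X0" by (simp add: X_def I(1))
  ultimately show ?thesis by (intro exI[of _ X]) simp
qed

section \<open>Arithmetic of bounded Lipschitz functions, and truncation\<close>

definition bdd_lipschitz :: "('a::metric_space \<Rightarrow> real) \<Rightarrow> bool" where
  "bdd_lipschitz f \<longleftrightarrow> (\<exists>B L. (\<forall>x. \<bar>f x\<bar> \<le> B) \<and> (\<forall>x y. \<bar>f x - f y\<bar> \<le> L * dist x y))"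

lemma bdd_lipschitzE:
  assumes "bdd_lipschitz f"
  obtains B L where "B \<ge> 0" "L \<ge> 0" "\<And>x. \<bar>f x\<bar> \<le> B" "\<And>x y. \<bar>f x - f y\<bar> \<le> L * dist x y"
proof -
  obtain B L where BL: "\<And>x. \<bar>f x\<bar> \<le> B" "\<And>x y. \<bar>f x - f y\<bar> \<le> L * dist x y"
    using assms unfolding bdd_lipschitz_def by blast
  have "\<bar>f x - f y\<bar> \<le> \<bar>L\<bar> * dist x y" for x y
    by (rule order_trans[OF BL(2) mult_right_mono]) auto
  moreover have "B \<ge> 0" using order_trans[OF abs_ge_zero BL(1)] .
  ultimately show thesis using that[of B "\<bar>L\<bar>"] BL(1) by auto
qed

lemma bdd_lipschitz_const: "bdd_lipschitz (\<lambda>_. c)"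
  unfolding bdd_lipschitz_def by (rule exI[of _ "\<bar>c\<bar>"], rule exI[of _ 0]) auto

lemma bdd_lipschitz_add:
  assumes "bdd_lipschitz f" "bdd_lipschitz g" shows "bdd_lipschitz (\<lambda>x. f x + g x)"
proof -
  obtain B L where f: "B \<ge> 0" "L \<ge> 0" "\<And>x. \<bar>f x\<bar> \<le> B" "\<And>x y. \<bar>f x - f y\<bar> \<le> L * dist x y"
    by (rule bdd_lipschitzE[OF assms(1)]) (rule that)
  obtain B' L' where g: "B' \<ge> 0" "L' \<ge> 0" "\<And>x. \<bar>g x\<bar> \<le> B'" "\<And>x y. \<bar>g x - g y\<bar> \<le> L' * dist x y"
    by (rule bdd_lipschitzE[OF assms(2)]) (rule that)
  show ?thesis unfolding bdd_lipschitz_def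
  proof (rule exI[of _ "B + B'"], rule exI[of _ "L + L'"], intro conjI allI)
    show "\<bar>f x + g x\<bar> \<le> B + B'" for x using f(3)[of x] g(3)[of x] by linarith
    show "\<bar>f x + g x - (f y + g y)\<bar> \<le> (L + L') * dist x y" for x y
      using f(4)[of x y] g(4)[of x y] unfolding distrib_right by linarith
  qed
qed

text \<open>The product is the reason for carrying a sup bound along with the Lipschitz constant:
  Lipschitz functions are closed under multiplication only if they are bounded.\<close>

lemma bdd_lipschitz_mult:
  assumes "bdd_lipschitz f" "bdd_lipschitz g" shows "bdd_lipschitz (\<lambda>x. f x * g x)"
proof -
  obtain B L where f: "B \<ge> 0" "L \<ge> 0" "\<And>x. \<bar>f x\<bar> \<le> B" "\<And>x y. \<bar>f x - f y\<bar> \<le> L * dist x y"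
    by (rule bdd_lipschitzE[OF assms(1)]) (rule that)
  obtain B' L' where g: "B' \<ge> 0" "L' \<ge> 0" "\<And>x. \<bar>g x\<bar> \<le> B'" "\<And>x y. \<bar>g x - g y\<bar> \<le> L' * dist x y"
    by (rule bdd_lipschitzE[OF assms(2)]) (rule that)
  show ?thesis unfolding bdd_lipschitz_def
  proof (rule exI[of _ "B * B'"], rule exI[of _ "B * L' + L * B'"], intro conjI allI)
    show "\<bar>f x * g x\<bar> \<le> B * B'" for x
      unfolding abs_mult by (intro mult_mono f g abs_ge_zero)
    show "\<bar>f x * g x - f y * g y\<bar> \<le> (B * L' + L * B') * dist x y" for x y
    proof -
      have "\<bar>f x * g x - f y * g y\<bar> \<le> \<bar>f x * (g x - g y)\<bar> + \<bar>(f x - f y) * g y\<bar>"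
        using abs_triangle_ineq[of "f x * (g x - g y)" "(f x - f y) * g y"]
        by (simp add: algebra_simps)
      also have "\<dots> \<le> B * (L' * dist x y) + (L * dist x y) * B'"
        unfolding abs_mult by (intro add_mono mult_mono f g abs_ge_zero mult_nonneg_nonneg zero_le_dist)
      finally show ?thesis by (simp add: algebra_simps)
    qed
  qed
qed

lemma bdd_lipschitz_uminus: "bdd_lipschitz f \<Longrightarrow> bdd_lipschitz (\<lambda>x. - f x)"
  using bdd_lipschitz_mult[OF bdd_lipschitz_const[of "-1"]] by simp

lemma bdd_lipschitz_diff: "bdd_lipschitz f \<Longrightarrow> bdd_lipschitz g \<Longrightarrow> bdd_lipschitz (\<lambda>x. f x - g x)"
  using bdd_lipschitz_add[OF _ bdd_lipschitz_uminus] by fastforce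

lemma bdd_lipschitz_power: "bdd_lipschitz f \<Longrightarrow> bdd_lipschitz (\<lambda>x. f x ^ n)"
  by (induction n) (auto intro: bdd_lipschitz_const bdd_lipschitz_mult)

lemma bdd_lipschitz_divide:
  assumes "bdd_lipschitz f" "bdd_lipschitz g" and c: "c > 0" "\<And>x. g x \<ge> c"
  shows "bdd_lipschitz (\<lambda>x. f x / g x)"
proof -
  obtain B L where g: "B \<ge> 0" "L \<ge> 0" "\<And>x. \<bar>g x\<bar> \<le> B" "\<And>x y. \<bar>g x - g y\<bar> \<le> L * dist x y"
    by (rule bdd_lipschitzE[OF assms(2)]) (rule that)
  have "bdd_lipschitz (\<lambda>x. 1 / g x)" unfolding bdd_lipschitz_def
  proof (rule exI[of _ "1 / c"], rule exI[of _ "L / (c * c)"], intro conjI allI)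
    show "\<bar>1 / g x\<bar> \<le> 1 / c" for x using c(1) c(2)[of x] by (simp add: frac_le)
    show "\<bar>1 / g x - 1 / g y\<bar> \<le> L / (c * c) * dist x y" for x y
    proof -
      have pos: "g x > 0" "g y > 0" using c(1) c(2)[of x] c(2)[of y] by linarith+
      then have "1 / g x - 1 / g y = (g y - g x) / (g x * g y)" by (simp add: field_simps)
      then have "\<bar>1 / g x - 1 / g y\<bar> = \<bar>g x - g y\<bar> / (g x * g y)"
        using pos by (simp add: abs_minus_commute abs_mult)
      also have "\<dots> \<le> (L * dist x y) / (c * c)"
        using pos c(1) c(2)[of x] c(2)[of y] g(2) g(4)[of x y] by (intro frac_le mult_mono) auto
      finally show ?thesis by simp
    qed
  qed
  from bdd_lipschitz_mult[OF assms(1) this] show ?thesis by simp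
qed

lemma bdd_lipschitz_compose:
  fixes h :: "real \<Rightarrow> real"
  assumes h: "\<And>x. \<bar>h x\<bar> \<le> B" "\<And>x y. \<bar>h x - h y\<bar> \<le> \<bar>x - y\<bar>"
    and f: "\<And>x y. \<bar>f x - f y\<bar> \<le> dist x y"
  shows "bdd_lipschitz (\<lambda>x. h (f x))"
  unfolding bdd_lipschitz_def
proof (intro exI conjI allI)
  show "\<bar>h (f x)\<bar> \<le> B" for x by (rule h)
  show "\<bar>h (f x) - h (f y)\<bar> \<le> 1 * dist x y" for x y using order_trans[OF h(2) f] by simp
qed

lemma abs_sin_diff_le: "\<bar>sin x - sin y\<bar> \<le> \<bar>x - y\<bar>" for x y :: real
proof -
  have "norm (sin x - sin y) \<le> 1 * norm (x - y)"
    by (rule field_differentiable_bound[where S = UNIV and f' = cos])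
       (auto intro!: derivative_eq_intros)
  then show ?thesis by simp
qed

lemma abs_cos_diff_le: "\<bar>cos x - cos y\<bar> \<le> \<bar>x - y\<bar>" for x y :: real
  using abs_sin_diff_le[of "x + pi/2" "y + pi/2"] by (simp add: sin_add)

definition clamp1 :: "real \<Rightarrow> real \<Rightarrow> real" where
  "clamp1 M x = max (- M) (min M x)"

lemma clamp1_eq: "\<bar>x\<bar> \<le> M \<Longrightarrow> clamp1 M x = x"
  and abs_clamp1_le: "0 \<le> M \<Longrightarrow> \<bar>clamp1 M x\<bar> \<le> M"
  and abs_clamp1_diff_le: "\<bar>clamp1 M x - clamp1 M y\<bar> \<le> \<bar>x - y\<bar>"
  by (auto simp: clamp1_def max_def min_def)

lemma lipschitz_on_PairI:
  fixes f :: "'a::metric_space \<Rightarrow> 'b::metric_space" and g :: "'a \<Rightarrow> 'c::metric_space"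
  assumes "L-lipschitz_on S f" "M-lipschitz_on S g"
  shows "(L + M)-lipschitz_on S (\<lambda>x. (f x, g x))"
proof (rule lipschitz_onI)
  show "0 \<le> L + M" using assms lipschitz_on_nonneg by (metis add_nonneg_nonneg)
  fix x y assume "x \<in> S" "y \<in> S"
  then have "dist (f x) (f y) \<le> L * dist x y" "dist (g x) (g y) \<le> M * dist x y"
    using assms lipschitz_onD by blast+
  then show "dist (f x, g x) (f y, g y) \<le> (L + M) * dist x y"
    unfolding dist_Pair_Pair distrib_right
    by (smt (verit) sqrt_sum_squares_le_sum zero_le_dist)
qed

lemma bdd_lipschitz_imp_lipschitz:
  assumes "bdd_lipschitz f" obtains L where "L-lipschitz_on UNIV f"
  using bdd_lipschitzE[OF assms] by (metis dist_real_def lipschitz_onI)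

lemma abs_fst_diff_le: "\<bar>fst x - fst y\<bar> \<le> dist x y" for x y :: "real \<times> 'a::metric_space"
  using dist_fst_le[of x y] by (simp add: dist_real_def)

lemma abs_snd_diff_le: "\<bar>snd x - snd y\<bar> \<le> dist x y" for x y :: "'a::metric_space \<times> real"
  using dist_snd_le[of x y] by (simp add: dist_real_def)

text \<open>Truncating \<open>w1\<close>, \<open>w2\<close>, \<open>p2\<close> makes the vector field globally Lipschitz, so solutions exist for all
  times; they solve the original system as long as the truncation is inactive.\<close>

lemma truncated_solution_exists:
  fixes lam \<epsilon> M :: real
  assumes M: "M > 0" "\<epsilon>\<^sup>2 * M \<le> 1/2"
  shows "\<exists>w1 w2 p1 p2. (w1 0, w2 0, p1 0, p2 0) = X0 \<and>
    continuous_on UNIV w1 \<and> continuous_on UNIV w2 \<and> continuous_on UNIV p1 \<and> continuous_on UNIV p2 \<and>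
    (\<forall>T. (\<forall>t\<in>T. \<bar>w1 t\<bar> \<le> M \<and> \<bar>w2 t\<bar> \<le> M \<and> \<bar>p2 t\<bar> \<le> M) \<longrightarrow> solves_S lam \<epsilon> T w1 w2 p1 p2)"
proof -
  define v1 where "v1 = (\<lambda>X::real\<times>real\<times>real\<times>real. clamp1 M (fst X))"
  define v2 where "v2 = (\<lambda>X::real\<times>real\<times>real\<times>real. clamp1 M (fst (snd X)))"
  define s where "s = (\<lambda>X::real\<times>real\<times>real\<times>real. sin (fst (snd (snd X))))"
  define c where "c = (\<lambda>X::real\<times>real\<times>real\<times>real. cos (fst (snd (snd X))))"
  define q where "q = (\<lambda>X::real\<times>real\<times>real\<times>real. clamp1 M (snd (snd (snd X))))"
  define f1 where "f1 = (\<lambda>X. v2 X / \<epsilon>)"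
  define f2 where "f2 = (\<lambda>X. (- (1 - \<epsilon>^2 * v1 X) * (q X)^2
         - (1 - \<epsilon>^2 * v1 X) * (\<epsilon>^2 * (v1 X)^2 - 2 * v1 X) * (1 + (1 / lam^2 - 1) * (c X)^2)
         - (1 - \<epsilon>^2 * v1 X)^3 * (1 / lam^2 + 1) * (s X)^2 * (c X)^2) / \<epsilon>)"
  define f4 where "f4 = (\<lambda>X. 2 * \<epsilon> * v2 X * q X / (1 - \<epsilon>^2 * v1 X)
        + (1 - 1 / lam^2) * (\<epsilon>^2 * (v1 X)^2 - 2 * v1 X) * s X * c X
        + (1 - \<epsilon>^2 * v1 X)^2
          * (s X * (c X)^3 - 1 / lam^2 * c X * (s X)^3))"
  \<comment> \<open>The angle needs no truncation, because it enters the field only through its sine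
    and cosine.\<close>
  define F where "F = (\<lambda>X. (f1 X, f2 X, q X, f4 X))"
  have d: "\<bar>fst (snd x) - fst (snd y)\<bar> \<le> dist x y" 
    "\<bar>fst (snd (snd x)) - fst (snd (snd y))\<bar> \<le> dist x y" 
    "\<bar>snd (snd (snd x)) - snd (snd (snd y))\<bar> \<le> dist x y" for x y :: "real\<times>real\<times>real\<times>real"
    using abs_fst_diff_le[of "snd x" "snd y"] abs_fst_diff_le[of "snd (snd x)" "snd (snd y)"]
      abs_snd_diff_le[of "snd (snd x)" "snd (snd y)"]
      dist_snd_le[of x y] dist_snd_le[of "snd x" "snd y"] by linarith+
  have "bdd_lipschitz v1" unfolding v1_def
    by (rule bdd_lipschitz_compose[where h = "clamp1 M" and f = fst and B = M]) 
       (use M(1) in \<open>auto intro: abs_clamp1_le abs_clamp1_diff_le abs_fst_diff_le\<close>)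
  moreover have "bdd_lipschitz v2" unfolding v2_def
    by (rule bdd_lipschitz_compose[where h = "clamp1 M" and f = "\<lambda>X. fst (snd X)" and B = M]) 
       (use M(1) in \<open>auto intro: abs_clamp1_le abs_clamp1_diff_le d\<close>)
  moreover have "bdd_lipschitz s" unfolding s_def
    by (rule bdd_lipschitz_compose[where h = sin and f = "\<lambda>X. fst (snd (snd X))" and B = 1]) 
       (auto intro: abs_sin_diff_le d)
  moreover have "bdd_lipschitz c" unfolding c_def
    by (rule bdd_lipschitz_compose[where h = cos and f = "\<lambda>X. fst (snd (snd X))" and B = 1]) 
       (auto intro: abs_cos_diff_le d)
  moreover have "bdd_lipschitz q" unfolding q_def
    by (rule bdd_lipschitz_compose[where h = "clamp1 M" and f = "\<lambda>X. snd (snd (snd X))" and B = M]) 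
       (use M(1) in \<open>auto intro: abs_clamp1_le abs_clamp1_diff_le d\<close>)
  ultimately have basic: "bdd_lipschitz v1" "bdd_lipschitz v2" "bdd_lipschitz s" "bdd_lipschitz c" "bdd_lipschitz q"
    by simp_all
  \<comment> \<open>Truncating \<open>w1\<close> at \<open>M\<close> with
    \<open>\<epsilon>\<^sup>2 * M \<le> 1/2\<close> keeps the radius away from 0, so the quotient in
    \<open>f4\<close> stays Lipschitz.\<close>
  have denom: "1 - \<epsilon>^2 * v1 X \<ge> 1/2" for X
  proof -
    have "\<epsilon>\<^sup>2 * v1 X \<le> \<epsilon>\<^sup>2 * M" unfolding v1_def
      using abs_clamp1_le[of M "fst X"] M(1) by (intro mult_left_mono) auto
    then show ?thesis using M(2) by linarith
  qed
  note bl = bdd_lipschitz_add bdd_lipschitz_diff bdd_lipschitz_mult bdd_lipschitz_uminus 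
    bdd_lipschitz_power bdd_lipschitz_const basic
  have quot: "bdd_lipschitz (\<lambda>X. f X / e)" if "bdd_lipschitz f" for e :: real and f :: "real\<times>real\<times>real\<times>real \<Rightarrow> real"
    using bdd_lipschitz_mult[OF bdd_lipschitz_const[of "1/e"] that] by simp
  have "bdd_lipschitz f1" "bdd_lipschitz f2"
    unfolding f1_def f2_def by (intro quot bl)+
  moreover have "bdd_lipschitz f4"
    unfolding f4_def
    by (intro bdd_lipschitz_add bdd_lipschitz_divide[where c = "1/2"] bl denom) simp
  ultimately obtain L1 L2 L4 where "L1-lipschitz_on UNIV f1" "L2-lipschitz_on UNIV f2" "L4-lipschitz_on UNIV f4"
    by (auto elim!: bdd_lipschitz_imp_lipschitz)
  moreover obtain L3 where "L3-lipschitz_on UNIV q" using bdd_lipschitz_imp_lipschitz[OF basic(5)] .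
  ultimately have "(L1 + (L2 + (L3 + L4)))-lipschitz_on UNIV F"
    unfolding F_def by (intro lipschitz_on_PairI)
  from picard_lindelof_global[OF this, of X0] obtain X where
    X: "X 0 = X0" "\<And>t. (X has_vector_derivative F (X t)) (at t)" by blast
  define w1 w2 p1 p2 where w: "w1 = (\<lambda>t. fst (X t))" "w2 = (\<lambda>t. fst (snd (X t)))"
    "p1 = (\<lambda>t. fst (snd (snd (X t))))" "p2 = (\<lambda>t. snd (snd (snd (X t))))"
  have cont: "continuous_on UNIV X"
    using X(2) by (meson continuous_at_imp_continuous_on has_vector_derivative_continuous)
  have D: "(w1 has_real_derivative f1 (X t)) (at t)" "(w2 has_real_derivative f2 (X t)) (at t)"
     "(p1 has_real_derivative q (X t)) (at t)" "(p2 has_real_derivative f4 (X t)) (at t)" for t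
    using bounded_linear.has_vector_derivative[OF bounded_linear_fst X(2)[of t]]
      bounded_linear.has_vector_derivative[OF bounded_linear_compose[OF bounded_linear_fst bounded_linear_snd] X(2)[of t]]
      bounded_linear.has_vector_derivative[OF bounded_linear_compose[OF bounded_linear_fst bounded_linear_compose[OF bounded_linear_snd bounded_linear_snd]] X(2)[of t]]
      bounded_linear.has_vector_derivative[OF bounded_linear_compose[OF bounded_linear_snd bounded_linear_compose[OF bounded_linear_snd bounded_linear_snd]] X(2)[of t]]
    by (simp_all add: w F_def has_real_derivative_iff_has_vector_derivative)
  have "solves_S lam \<epsilon> T w1 w2 p1 p2" if "\<forall>t\<in>T. \<bar>w1 t\<bar> \<le> M \<and> \<bar>w2 t\<bar> \<le> M \<and> \<bar>p2 t\<bar> \<le> M" for T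
    unfolding solves_S_def
  proof
    fix x assume "x \<in> T"
    with that have "\<bar>w1 x\<bar> \<le> M" "\<bar>w2 x\<bar> \<le> M" "\<bar>p2 x\<bar> \<le> M" by auto
    then have e: "v1 (X x) = w1 x" "v2 (X x) = w2 x" "q (X x) = p2 x" 
      "s (X x) = sin (p1 x)" "c (X x) = cos (p1 x)"
      by (simp_all add: v1_def v2_def q_def s_def c_def w clamp1_eq)
    show "1 - \<epsilon>^2 * w1 x \<noteq> 0 \<and>
     (w1 has_real_derivative w2 x / \<epsilon>) (at x within T) \<and>
     (w2 has_real_derivative
        (- (1 - \<epsilon>^2 * w1 x) * (p2 x)^2
         - (1 - \<epsilon>^2 * w1 x) * (\<epsilon>^2 * (w1 x)^2 - 2 * w1 x) * weight lam (p1 x)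
         - (1 - \<epsilon>^2 * w1 x)^3 * (1 / lam^2 + 1) * (sin (p1 x))^2 * (cos (p1 x))^2) / \<epsilon>)
       (at x within T) \<and>
     (p1 has_real_derivative p2 x) (at x within T) \<and>
     (p2 has_real_derivative
        2 * \<epsilon> * w2 x * p2 x / (1 - \<epsilon>^2 * w1 x)
        + (1 - 1 / lam^2) * (\<epsilon>^2 * (w1 x)^2 - 2 * w1 x) * sin (p1 x) * cos (p1 x)
        + (1 - \<epsilon>^2 * w1 x)^2
          * (sin (p1 x) * (cos (p1 x))^3 - 1 / lam^2 * cos (p1 x) * (sin (p1 x))^3))
       (at x within T)"
      using D[of x] denom[of "X x"] unfolding f1_def f2_def f4_def e weight_def
      by (auto intro: has_field_derivative_at_within)
  qed
  moreover have "(w1 0, w2 0, p1 0, p2 0) = X0" by (simp add: w X)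
  moreover have "continuous_on UNIV w1" "continuous_on UNIV w2" "continuous_on UNIV p1" "continuous_on UNIV p2"
    unfolding w by (intro continuous_intros cont)+
  ultimately show ?thesis by blast
qed

section \<open>Conservation of energy\<close>

text \<open>Twice the Hamiltonian \<open>(lam\<^sup>2 u'\<^sup>2 + v'\<^sup>2)/2 - u\<^sup>2 v\<^sup>2/2 - (1 - R\<^sup>2)\<^sup>2/(4 \<epsilon>\<^sup>2)\<close> of the system for
  \<open>u = R cos p1\<close>, \<open>v = R sin p1\<close>, \<open>R = 1 - \<epsilon>\<^sup>2 w1\<close>.\<close>

definition energy :: "real \<Rightarrow> real \<Rightarrow> real \<Rightarrow> real \<Rightarrow> real \<Rightarrow> real \<Rightarrow> real" where
  "energy lam \<epsilon> w1 w2 a b =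
     lam^2 * (\<epsilon> * w2 * cos a + (1 - \<epsilon>^2 * w1) * sin a * b)^2
     + ((1 - \<epsilon>^2 * w1) * cos a * b - \<epsilon> * w2 * sin a)^2
     - (1 - \<epsilon>^2 * w1)^4 * (sin a * cos a)^2 - \<epsilon>^2 / 2 * (2 * w1 - \<epsilon>^2 * w1^2)^2"

text \<open>These are the Cartesian equations \<open>u'' = - i * u * (k - v^2)\<close> and
  \<open>v'' = v * (u^2 - k)\<close> in polar form, with \<open>i = 1 / lam^2\<close>,
  \<open>e = - R'\<close> and, in the application, \<open>k = (1 - R^2) / \<epsilon>^2\<close>. The
  left sides are the derivatives of \<open>- u'\<close> and \<open>v'\<close> written in terms of
  \<open>R\<close>, the angle and its velocity \<open>b\<close>.\<close>

lemma polar_velocity_identities: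
  fixes s c :: real
  assumes sc: "s^2 + c^2 = 1"
  shows "(- R * b^2 + R * k * (1 + (i - 1) * c^2) - R^3 * (i + 1) * s^2 * c^2) * c - e * s * b
      + ((- e) * s + R * c * b) * b + R * s * ((- (1 - i) * k * s * c
        + R^2 * (s * c^3 - i * c * s^3))) + 2 * e * b * s
      = - i * (R * c * (R^2 * s^2 - k))"
    and "((- e) * c - R * s * b) * b + R * c * ((- (1 - i) * k * s * c
        + R^2 * (s * c^3 - i * c * s^3))) + 2 * e * b * c
      - (- R * b^2 + R * k * (1 + (i - 1) * c^2) - R^3 * (i + 1) * s^2 * c^2) * s - e * c * b
      = R * s * (R^2 * c^2 - k)"
  using sc by algebra+

lemma energy_derivative_zero:
  assumes S: "solves_S lam \<epsilon> T w1 w2 p1 p2" and x: "x \<in> T" and pos: "\<epsilon> \<noteq> 0" "lam \<noteq> 0"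
  shows "((\<lambda>x. energy lam \<epsilon> (w1 x) (w2 x) (p1 x) (p2 x)) has_real_derivative 0) (at x within T)"
proof -
  define R k i where "R = 1 - \<epsilon>^2 * w1 x" "k = 2 * w1 x - \<epsilon>^2 * (w1 x)^2" "i = 1 / lam^2"
  define s c where "s = sin (p1 x)" "c = cos (p1 x)"
  define a b e where "a = p1 x" "b = p2 x" "e = \<epsilon> * w2 x"
  note defs = \<open>R = _\<close> \<open>k = _\<close> \<open>i = _\<close> \<open>s = _\<close> \<open>c = _\<close> \<open>a = _\<close> \<open>b = _\<close> \<open>e = _\<close>
  define b' where "b' = - (1 - i) * k * s * c + R^2 * (s * c^3 - i * c * s^3)"
  define f where "f = - R * b^2 + R * k * (1 + (i - 1) * c^2) - R^3 * (i + 1) * s^2 * c^2"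
  have R0: "R \<noteq> 0" and w1: "(w1 has_real_derivative w2 x / \<epsilon>) (at x within T)"
    and w2: "(w2 has_real_derivative f / \<epsilon>) (at x within T)"
    and p1: "(p1 has_real_derivative b) (at x within T)"
    and p2: "(p2 has_real_derivative 2 * e * b / R + b') (at x within T)"
    using S x unfolding solves_S_def f_def b'_def defs weight_def
    by (auto simp: algebra_simps)
  have sc: "s^2 + c^2 = 1" unfolding defs by simp
  \<comment> \<open>\<open>P\<close> is \<open>- u'\<close> and \<open>Q\<close> is
    \<open>v'\<close>; the energy is simple in these and its derivative then follows from the
    Cartesian equations.\<close>
  define P where "P = (\<lambda>x. \<epsilon> * w2 x * cos (p1 x) + (1 - \<epsilon>^2 * w1 x) * sin (p1 x) * p2 x)"
  define Q where "Q = (\<lambda>x. (1 - \<epsilon>^2 * w1 x) * cos (p1 x) * p2 x - \<epsilon> * w2 x * sin (p1 x))"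
  have dR: "((\<lambda>x. 1 - \<epsilon>^2 * w1 x) has_real_derivative - e) (at x within T)"
    using pos by (auto intro!: derivative_eq_intros w1 simp: defs power2_eq_square)
  have dw2: "((\<lambda>x. \<epsilon> * w2 x) has_real_derivative f) (at x within T)"
    using pos by (auto intro!: derivative_eq_intros w2)
  have ds: "((\<lambda>x. sin (p1 x)) has_real_derivative c * b) (at x within T)"
    and dc: "((\<lambda>x. cos (p1 x)) has_real_derivative - s * b) (at x within T)"
    by (auto intro!: derivative_eq_intros p1 simp: defs)
  \<comment> \<open>The quotient by \<open>R\<close> in the equation for \<open>p2\<close>
    disappears, since \<open>p2\<close> enters \<open>P\<close> and \<open>Q\<close> only with the
    factor \<open>R\<close>.\<close>
  have cancel: "(2 * e * b / R + b') * (R * y) = 2 * e * b * y + R * y * b'" for y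
    using R0 by (simp add: distrib_right)
  have P: "(P has_real_derivative - i * (R * c * (R^2 * s^2 - k))) (at x within T)"
    unfolding P_def
  proof (rule DERIV_cong)
    show "((\<lambda>x. \<epsilon> * w2 x * cos (p1 x) + (1 - \<epsilon>^2 * w1 x) * sin (p1 x) * p2 x) has_real_derivative
       (f * c + (- s * b) * e + ((- e * s + c * b * R) * b + (2 * e * b / R + b') * (R * s)))) (at x within T)"
      by (rule derivative_eq_intros DERIV_mult dR dw2 ds dc p2 refl | simp add: defs)+
    show "f * c + (- s * b) * e + ((- e * s + c * b * R) * b + (2 * e * b / R + b') * (R * s)) = - i * (R * c * (R^2 * s^2 - k))"
      using polar_velocity_identities(1)[OF sc, of R b k i e]
      unfolding f_def[symmetric] b'_def[symmetric] cancel by (simp add: algebra_simps)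
  qed
  have Q: "(Q has_real_derivative R * s * (R^2 * c^2 - k)) (at x within T)"
    unfolding Q_def
  proof (rule DERIV_cong)
    show "((\<lambda>x. (1 - \<epsilon>^2 * w1 x) * cos (p1 x) * p2 x - \<epsilon> * w2 x * sin (p1 x)) has_real_derivative
       ((- e * c + (- s * b) * R) * b + (2 * e * b / R + b') * (R * c)) - (f * s + (c * b) * e)) (at x within T)"
      by (rule derivative_eq_intros DERIV_mult dR dw2 ds dc p2 refl | simp add: defs)+
    show "((- e * c + (- s * b) * R) * b + (2 * e * b / R + b') * (R * c)) - (f * s + (c * b) * e)
       = R * s * (R^2 * c^2 - k)"
      using polar_velocity_identities(2)[OF sc, of e R b i k]
      unfolding f_def[symmetric] b'_def[symmetric] cancel by (simp add: algebra_simps)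
  qed
  have Px: "P x = e * c + R * s * b" and Qx: "Q x = R * c * b - e * s"
    by (simp_all add: P_def Q_def defs)
  have dk: "((\<lambda>x. 2 * w1 x - \<epsilon>^2 * (w1 x)^2) has_real_derivative 2 * R * w2 x / \<epsilon>) (at x within T)"
    using pos by (auto intro!: derivative_eq_intros w1 simp: defs field_simps power2_eq_square)
  have dk2: "((\<lambda>x. \<epsilon>^2 / 2 * (2 * w1 x - \<epsilon>^2 * (w1 x)^2)^2) has_real_derivative
      \<epsilon>^2 / 2 * (2 * k * (2 * R * w2 x / \<epsilon>))) (at x within T)"
    by (rule DERIV_cong[OF DERIV_cmult[OF DERIV_power[OF dk, of 2]]]) (simp flip: defs(2))
  have "((\<lambda>x. lam^2 * (P x)^2 + (Q x)^2 - (1 - \<epsilon>^2 * w1 x)^4 * (sin (p1 x) * cos (p1 x))^2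
       - \<epsilon>^2 / 2 * (2 * w1 x - \<epsilon>^2 * (w1 x)^2)^2) has_real_derivative
     lam^2 * (2 * P x * (- i * (R * c * (R^2 * s^2 - k)))) + 2 * Q x * (R * s * (R^2 * c^2 - k))
     - (4 * R^3 * (- e) * (s * c)^2 + R^4 * (2 * (s * c) * (c * b * c - s * b * s)))
     - \<epsilon>^2 / 2 * (2 * k * (2 * R * w2 x / \<epsilon>))) (at x within T)"
    by (rule P Q dR ds dc dk2 derivative_eq_intros refl | simp add: defs)+
  moreover have "lam^2 * (2 * P x * (- i * (R * c * (R^2 * s^2 - k)))) + 2 * Q x * (R * s * (R^2 * c^2 - k))
     - (4 * R^3 * (- e) * (s * c)^2 + R^4 * (2 * (s * c) * (c * b * c - s * b * s)))
     - \<epsilon>^2 / 2 * (2 * k * (2 * R * w2 x / \<epsilon>)) = 0"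
  proof -
    have "lam^2 * i = 1" using pos by (simp add: \<open>i = _\<close>)
    then have 1: "lam^2 * (2 * P x * (- i * (R * c * (R^2 * s^2 - k)))) = - 2 * P x * (R * c * (R^2 * s^2 - k))"
      by algebra
    have 2: "\<epsilon>^2 / 2 * (2 * k * (2 * R * w2 x / \<epsilon>)) = 2 * k * R * e"
      using pos by (simp add: defs(8) power2_eq_square)
    show ?thesis unfolding 1 2 unfolding Px Qx using sc by algebra
  qed
  ultimately show ?thesis unfolding energy_def P_def Q_def by simp
qed

lemma energy_conserved:
  assumes S: "solves_S lam \<epsilon> T w1 w2 p1 p2" and T: "convex T" "x \<in> T" "y \<in> T" and pos: "\<epsilon> \<noteq> 0" "lam \<noteq> 0"
  shows "energy lam \<epsilon> (w1 x) (w2 x) (p1 x) (p2 x) = energy lam \<epsilon> (w1 y) (w2 y) (p1 y) (p2 y)"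
proof -
  obtain C where "\<forall>x\<in>T. energy lam \<epsilon> (w1 x) (w2 x) (p1 x) (p2 x) = C"
    using has_field_derivative_zero_constant[OF T(1) energy_derivative_zero[OF S _ pos]] by blast
  then show ?thesis using T by simp
qed

text \<open>Setting \<open>R = 1\<close> and \<open>w2 = 0\<close> leaves the planar expression;
  \<open>R^2 - 1\<close>, \<open>\<epsilon> * w2\<close> and the last term of the energy are all
  O(\<epsilon>^2). The bound keeps \<open>W\<close> free because it is used twice: with
  \<open>W\<close> linear in the distance to the equilibria, where the error becomes quadratic, and
  with \<open>W\<close> quadratic, where it becomes quartic. The constant 11 rounds up
  \<open>3/2 + 9\<close>, the largest coefficient, which belongs to
  \<open>(sin a * cos a)^2\<close>.\<close>

lemma energy_estimate:
  fixes lam \<epsilon> :: real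
  assumes lam: "lam \<ge> 1" and \<epsilon>: "0 < \<epsilon>" "\<epsilon> \<le> 1" and w1: "\<bar>w1\<bar> \<le> W" and w2: "\<bar>w2\<bar> \<le> \<epsilon> * W"
    and W: "\<epsilon>^2 * W \<le> 1/2"
  shows "\<bar>energy lam \<epsilon> w1 w2 a b - ((lam^2 * (sin a)^2 + (cos a)^2) * b^2 - (sin a * cos a)^2)\<bar>
    \<le> 11 * lam^2 * \<epsilon>^2 * (W * ((sin a * cos a)^2 + b^2) + W^2)"
proof -
  define s c R k where "s = sin a" "c = cos a" "R = 1 - \<epsilon>^2 * w1" "k = 2 * w1 - \<epsilon>^2 * w1^2"
  note defs = \<open>s = _\<close> \<open>c = _\<close> \<open>R = _\<close> \<open>k = _\<close>
  define g where "g = s * c"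
  have W0: "W \<ge> 0" using w1 by linarith
  have l1: "1 \<le> lam^2" using lam by simp
  have s1: "s^2 \<le> 1" "c^2 \<le> 1" "s^2 + c^2 = 1" "0 \<le> s^2" "0 \<le> c^2"
    unfolding defs by (simp_all add: abs_square_le_1)
  have \<delta>: "\<bar>\<epsilon>^2 * w1\<bar> \<le> \<epsilon>^2 * W" using w1 by (simp add: abs_mult mult_left_mono)
  have R: "\<bar>R\<bar> \<le> 3/2" "\<bar>R + 1\<bar> \<le> 5/2" "R \<ge> 1/2" using \<delta> W unfolding defs by linarith+
  have R2: "\<bar>R^2 - 1\<bar> \<le> 5/2 * (\<epsilon>^2 * W)"
  proof -
    have "R^2 - 1 = (R + 1) * (- (\<epsilon>^2 * w1))" unfolding defs by (simp add: power2_eq_square algebra_simps)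
    then have "\<bar>R^2 - 1\<bar> = \<bar>R + 1\<bar> * \<bar>\<epsilon>^2 * w1\<bar>" by (simp add: abs_mult)
    also have "\<dots> \<le> 5/2 * (\<epsilon>^2 * W)" using R \<delta> by (intro mult_mono) auto
    finally show ?thesis .
  qed
  have R4: "\<bar>R^4 - 1\<bar> \<le> 9 * (\<epsilon>^2 * W)"
  proof -
    have "R^4 - 1 = (R^2 + 1) * (R^2 - 1)" by (simp add: power2_eq_square power4_eq_xxxx algebra_simps)
    then have "\<bar>R^4 - 1\<bar> = (R^2 + 1) * \<bar>R^2 - 1\<bar>" by (simp add: abs_mult)
    also have "\<dots> \<le> (13/4) * (5/2 * (\<epsilon>^2 * W))"
      using R R2 power_mono[OF R(1), of 2] by (intro mult_mono) (auto simp: power2_eq_square)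
    also have "\<dots> \<le> 9 * (\<epsilon>^2 * W)" using W0 by simp
    finally show ?thesis .
  qed
  have k: "\<bar>k\<bar> \<le> 5/2 * W"
  proof -
    have "k = (R + 1) * w1" unfolding defs by (simp add: power2_eq_square algebra_simps)
    then have "\<bar>k\<bar> = \<bar>R + 1\<bar> * \<bar>w1\<bar>" by (simp add: abs_mult)
    also have "\<dots> \<le> 5/2 * W" using R w1 by (intro mult_mono) auto
    finally show ?thesis .
  qed
  let ?q = "lam^2 * s^2 + c^2"
  have q: "0 \<le> ?q" "?q \<le> lam^2"
  proof -
    show "0 \<le> ?q" using s1 by simp
    have "c^2 \<le> lam^2 * c^2" using l1 s1 mult_right_mono[of 1 "lam^2" "c^2"] by simp
    then have "?q \<le> lam^2 * (s^2 + c^2)" by (simp add: distrib_left)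
    then show "?q \<le> lam^2" using s1 by simp
  qed
  have q': "0 \<le> lam^2 * c^2 + s^2" "lam^2 * c^2 + s^2 \<le> lam^2"
  proof -
    show "0 \<le> lam^2 * c^2 + s^2" using s1 by simp
    have "s^2 \<le> lam^2 * s^2" using l1 s1 mult_right_mono[of 1 "lam^2" "s^2"] by simp
    then have "lam^2 * c^2 + s^2 \<le> lam^2 * (s^2 + c^2)" by (simp add: distrib_left)
    then show "lam^2 * c^2 + s^2 \<le> lam^2" using s1 by simp
  qed
  \<comment> \<open>Expansion about \<open>R = 1\<close>, \<open>w2 = 0\<close>. The mixed terms of
    the two squares have opposite signs and leave the factor \<open>lam^2 - 1\<close>.\<close>
  have dec: "energy lam \<epsilon> w1 w2 a b - (?q * b^2 - g^2) =
     ?q * b^2 * (R^2 - 1) + 2 * (lam^2 - 1) * (g * b) * R * (\<epsilon> * w2)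
      + (lam^2 * c^2 + s^2) * (\<epsilon> * w2)^2 - (R^4 - 1) * g^2 - \<epsilon>^2 / 2 * k^2"
    unfolding energy_def defs[symmetric] g_def by (simp add: power2_eq_square algebra_simps)
  have \<epsilon>w: "\<bar>\<epsilon> * w2\<bar> \<le> \<epsilon>^2 * W" using w2 \<epsilon> by (simp add: abs_mult power2_eq_square mult.assoc)
  have t1: "\<bar>?q * b^2 * (R^2 - 1)\<bar> \<le> 5/2 * (lam^2 * \<epsilon>^2 * (W * b^2))"
  proof -
    have "\<bar>?q * b^2 * (R^2 - 1)\<bar> = ?q * b^2 * \<bar>R^2 - 1\<bar>" using q by (simp add: abs_mult)
    also have "\<dots> \<le> lam^2 * b^2 * (5/2 * (\<epsilon>^2 * W))" using q R2 by (intro mult_mono) auto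
    finally show ?thesis by (simp add: algebra_simps)
  qed
  have t2: "\<bar>2 * (lam^2 - 1) * (g * b) * R * (\<epsilon> * w2)\<bar> \<le> 3/2 * (lam^2 * \<epsilon>^2 * (W * (g^2 + b^2)))"
  proof -
    have gb: "\<bar>g * b\<bar> \<le> (g^2 + b^2) / 2"
      using sum_squares_bound[of "\<bar>g\<bar>" "\<bar>b\<bar>"] by (simp add: abs_mult)
    have "\<bar>2 * (lam^2 - 1) * (g * b) * R * (\<epsilon> * w2)\<bar> = 2 * (lam^2 - 1) * \<bar>g * b\<bar> * \<bar>R\<bar> * \<bar>\<epsilon> * w2\<bar>"
      using l1 by (simp add: abs_mult)
    also have "\<dots> \<le> 2 * lam^2 * ((g^2 + b^2)/2) * (3/2) * (\<epsilon>^2 * W)"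
      using l1 gb R \<epsilon>w by (intro mult_mono mult_nonneg_nonneg) auto
    finally show ?thesis by (simp add: algebra_simps)
  qed
  have t3: "\<bar>(lam^2 * c^2 + s^2) * (\<epsilon> * w2)^2\<bar> \<le> lam^2 * \<epsilon>^2 * W^2"
  proof -
    have e2: "\<epsilon>^2 \<le> 1" using \<epsilon> by (simp add: power_le_one)
    have "(\<epsilon> * w2)^2 \<le> (\<epsilon>^2 * W)^2" using power_mono[OF \<epsilon>w, of 2] by simp
    also have "\<dots> = \<epsilon>^2 * (\<epsilon>^2 * W^2)" by (simp add: power2_eq_square algebra_simps)
    also have "\<dots> \<le> \<epsilon>^2 * (1 * W^2)" using e2 by (intro mult_left_mono mult_right_mono) auto
    finally have "(lam^2 * c^2 + s^2) * (\<epsilon> * w2)^2 \<le> lam^2 * (\<epsilon>^2 * W^2)"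
      using q' by (intro mult_mono) auto
    then show ?thesis using q' by (simp add: mult.assoc)
  qed
  have t4: "\<bar>(R^4 - 1) * g^2\<bar> \<le> 9 * (lam^2 * \<epsilon>^2 * (W * g^2))"
  proof -
    have "\<bar>(R^4 - 1) * g^2\<bar> = 1 * (\<bar>R^4 - 1\<bar> * g^2)" by (simp add: abs_mult)
    also have "\<dots> \<le> lam^2 * (9 * (\<epsilon>^2 * W) * g^2)" using l1 R4 by (intro mult_mono) auto
    finally show ?thesis by (simp add: algebra_simps)
  qed
  have t5: "\<bar>\<epsilon>^2 / 2 * k^2\<bar> \<le> 4 * (lam^2 * \<epsilon>^2 * W^2)"
  proof -
    have "k^2 \<le> (5/2 * W)^2" using power_mono[OF k, of 2] by simp
    then have "1 * (\<epsilon>^2 / 2 * k^2) \<le> lam^2 * (\<epsilon>^2 / 2 * (25/4 * W^2))"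
      using l1 by (intro mult_mono mult_left_mono) (auto simp: power2_eq_square)
    then have "\<bar>\<epsilon>^2 / 2 * k^2\<bar> \<le> 25/8 * (lam^2 * \<epsilon>^2 * W^2)" by (simp add: algebra_simps)
    also have "\<dots> \<le> 4 * (lam^2 * \<epsilon>^2 * W^2)" by (intro mult_right_mono) auto
    finally show ?thesis .
  qed
  have nn: "0 \<le> lam^2 * \<epsilon>^2 * (W * b^2)" "0 \<le> lam^2 * \<epsilon>^2 * (W * g^2)" "0 \<le> lam^2 * \<epsilon>^2 * W^2"
    using W0 by simp_all
  have tri: "\<bar>A + B + C - D - E\<bar> \<le> \<bar>A\<bar> + \<bar>B\<bar> + \<bar>C\<bar> + \<bar>D\<bar> + \<bar>E\<bar>" for A B C D E :: real
    by linarith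
  have "\<bar>energy lam \<epsilon> w1 w2 a b - (?q * b^2 - g^2)\<bar> \<le> 11 * (lam^2 * \<epsilon>^2 * (W * g^2)) 
     + 11 * (lam^2 * \<epsilon>^2 * (W * b^2)) + 11 * (lam^2 * \<epsilon>^2 * W^2)"
    unfolding dec
    by (rule order_trans[OF tri order_trans[OF add_mono[OF add_mono[OF add_mono[OF add_mono[OF t1 t2] t3] t4] t5]]])
       (simp only: distrib_left, use nn in linarith)
  then show ?thesis unfolding g_def defs by (simp add: algebra_simps)
qed

section \<open>Hyperbolic fast dynamics\<close>

lemma has_real_derivative_nonneg_imp_mono:
  fixes f f' :: "real \<Rightarrow> real"
  assumes "\<And>x. a \<le> x \<Longrightarrow> x \<le> b \<Longrightarrow> (f has_real_derivative f' x) (at x)" "\<And>x. a \<le> x \<Longrightarrow> x \<le> b \<Longrightarrow> 0 \<le> f' x" "a \<le> b"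
  shows "f a \<le> f b"
  by (rule DERIV_nonneg_imp_nondecreasing[OF assms(3)]) (use assms in blast)

lemma slow_growth_bound:
  fixes f f' :: "real \<Rightarrow> real"
  assumes d: "\<And>x. (f has_real_derivative f' x) (at x)" and ineq: "\<And>x. f' x \<ge> \<alpha> * f x - \<beta>"
    and growth: "\<And>x. x \<ge> x0 \<Longrightarrow> f x \<le> M * exp (k * (x - x0))"
    and \<alpha>: "0 < \<alpha>" "k < \<alpha>" and k0: "k \<ge> 0"
  shows "f x0 \<le> \<beta> / \<alpha>"
proof -
  define g where "g = (\<lambda>x. (f x - \<beta> / \<alpha>) * exp (- \<alpha> * (x - x0)))"
  have dg: "(g has_real_derivative (f' x - \<alpha> * f x + \<beta>) * exp (- \<alpha> * (x - x0))) (at x)" for x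
    unfolding g_def by (auto intro!: derivative_eq_intros d) (use \<alpha> in \<open>simp add: field_simps\<close>)
  have mono: "g x0 \<le> g x" if "x \<ge> x0" for x
    by (rule has_real_derivative_nonneg_imp_mono[OF dg _ that]) (use ineq in \<open>intro mult_nonneg_nonneg; simp add: algebra_simps\<close>)
  have le: "g x0 \<le> M * exp ((k - \<alpha>) * (x - x0)) - \<beta> / \<alpha> * exp (- \<alpha> * (x - x0))" if "x \<ge> x0" for x
  proof -
    have "g x = f x * exp (- \<alpha> * (x - x0)) - \<beta> / \<alpha> * exp (- \<alpha> * (x - x0))"
      by (simp add: g_def left_diff_distrib)
    also have "f x * exp (- \<alpha> * (x - x0)) \<le> (M * exp (k * (x - x0))) * exp (- \<alpha> * (x - x0))"
      using growth[OF that] by (intro mult_right_mono) auto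
    also have "\<dots> = M * exp ((k - \<alpha>) * (x - x0))"
      by (simp add: mult.assoc exp_add[symmetric] algebra_simps)
    finally show ?thesis using mono[OF that] by simp
  qed
  have shift: "filterlim (\<lambda>x. x - x0) at_top at_top"
    using filterlim_tendsto_add_at_top[OF tendsto_const filterlim_ident, of "-x0"] by simp
  have e: "((\<lambda>x. exp (- c * (x - x0))) \<longlongrightarrow> 0) at_top" if "c > 0" for c :: real
  proof (rule filterlim_compose[OF exp_at_bot])
    have "filterlim (\<lambda>x. c * (x - x0)) at_top at_top"
      by (rule filterlim_tendsto_pos_mult_at_top[OF tendsto_const that shift])
    then show "filterlim (\<lambda>x. - c * (x - x0)) at_bot at_top"
      by (simp add: filterlim_uminus_at_top)
  qed
  have "((\<lambda>x. M * exp (- (\<alpha> - k) * (x - x0)) - \<beta> / \<alpha> * exp (- \<alpha> * (x - x0))) \<longlongrightarrow> M * 0 - \<beta> / \<alpha> * 0) at_top"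
    by (intro tendsto_intros e) (use \<alpha> in auto)
  then have "g x0 \<le> M * 0 - \<beta> / \<alpha> * 0"
    by (rule tendsto_lowerbound[OF _ eventually_mono[OF eventually_ge_at_top[of x0]]]) (use le in simp_all)
  then show ?thesis by (simp add: g_def)
qed

text \<open>If \<open>\<sigma>\<close> varies slowly, the hyperbolic fast equations force \<open>z\<close> and \<open>y\<close> to have the size of their
  forcing: \<open>(z y + \<theta> (z\<^sup>2 + y\<^sup>2)) / \<sigma>\<^sup>4\<close> grows at rate \<open>1/\<epsilon>\<close> once it exceeds \<open>O(\<epsilon>\<^sup>2)\<close>,
  which is incompatible with boundedness of \<open>z\<close> and \<open>y\<close>.\<close>

lemma fast_dichotomy_one_sided:
  fixes z y \<sigma> \<sigma>' ez ey A :: "real \<Rightarrow> real"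
  assumes dz: "\<And>x. (z has_real_derivative (y x - ez x) / \<epsilon>) (at x)"
    and dy: "\<And>x. (y has_real_derivative (A x * z x - ey x) / \<epsilon>) (at x)"
    and ds: "\<And>x. (\<sigma> has_real_derivative \<sigma>' x) (at x)"
    and s: "\<And>x. 0 < \<sigma> x" "\<And>x. \<bar>\<sigma>' x\<bar> \<le> 2 * \<sigma> x"
    and A: "\<And>x. c \<le> A x" "\<And>x. A x \<le> 3" and c: "0 < c" "c \<le> 1"
    and e: "\<And>x. \<bar>ez x\<bar> \<le> \<epsilon> * C * ((\<sigma> x)^2 + \<bar>z x\<bar>)" "\<And>x. \<bar>ey x\<bar> \<le> \<epsilon> * C * ((\<sigma> x)^2 + \<bar>z x\<bar>)"
    and bd: "\<And>x. \<bar>z x\<bar> \<le> M" "\<And>x. \<bar>y x\<bar> \<le> M"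
    and \<epsilon>: "0 < \<epsilon>" "\<epsilon> * 64 \<le> c" "\<epsilon> * 32 * C \<le> c" and C: "C \<ge> 0"
  shows "z x0 * y x0 + c / 16 * ((z x0)^2 + (y x0)^2) \<le> 64 * C^2 / c^2 * \<epsilon>^2 * (\<sigma> x0)^4"
proof -
  \<comment> \<open>With this size the mixed term caused by \<theta> costs at most
    \<open>4 * \<theta> * n = c / 4 * n\<close>. The definite part \<theta> n is what finally
    controls \<open>z\<close> and \<open>y\<close> separately, since \<open>z * y\<close> is
    indefinite.\<close>
  define \<theta> where "\<theta> = c / 16"
  define n where "n = (\<lambda>x. (z x)^2 + (y x)^2)"
  define V where "V = (\<lambda>x. z x * y x + \<theta> * n x)"
  define V' where "V' = (\<lambda>x. ((y x - ez x) * y x + z x * (A x * z x - ey x) 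
      + \<theta> * (2 * z x * (y x - ez x) + 2 * y x * (A x * z x - ey x))) / \<epsilon>)"
  have dV: "(V has_real_derivative V' x) (at x)" for x
    unfolding V_def n_def V'_def
    by (auto intro!: derivative_eq_intros dz dy) (simp add: add_divide_distrib diff_divide_distrib algebra_simps)
  have \<theta>: "0 < \<theta>" "\<theta> \<le> 1/16" using c by (simp_all add: \<theta>_def)
  have n0: "n x \<ge> 0" for x by (simp add: n_def)
  have zy: "\<bar>z x * y x\<bar> \<le> n x / 2" for x
    using sum_squares_bound[of "\<bar>z x\<bar>" "\<bar>y x\<bar>"] by (simp add: n_def abs_mult)
  have Vn: "\<bar>V x\<bar> \<le> n x" for x
  proof -
    have "\<bar>V x\<bar> \<le> n x / 2 + \<theta> * n x"
      unfolding V_def using zy[of x] \<theta> n0[of x] abs_triangle_ineq[of "z x * y x" "\<theta> * n x"] by (simp add: abs_mult)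
    also have "\<theta> * n x \<le> 1/16 * n x" using \<theta> n0 by (intro mult_right_mono) auto
    finally show ?thesis using n0[of x] by simp
  qed
  \<comment> \<open>The derivative of \<open>z * y\<close> alone contributes
    \<open>y^2 + A * z^2 \<ge> c * n\<close>. The \<theta> terms and the forcing may each consume
    \<open>c / 4 * n\<close>, which leaves \<open>c / 2 * n\<close>.\<close>
  have main: "V' x * \<epsilon> \<ge> c / 2 * n x - 16 * C^2 / c * \<epsilon>^2 * (\<sigma> x)^4" for x
  proof -
    let ?S = "\<bar>z x\<bar> + \<bar>y x\<bar>"
    let ?E = "\<epsilon> * C * ((\<sigma> x)^2 + \<bar>z x\<bar>)"
    have EC: "0 \<le> \<epsilon> * C" using \<epsilon> C by simp
    have S2: "?S^2 \<le> 2 * n x"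
      using zy[of x] by (simp add: n_def power2_sum abs_mult)
    have "V' x * \<epsilon> = (y x)^2 + A x * (z x)^2 + 2 * \<theta> * (1 + A x) * (z x * y x)
       - (ez x * (y x + 2 * \<theta> * z x) + ey x * (z x + 2 * \<theta> * y x))"
    proof -
      have "V' x * \<epsilon> = (y x - ez x) * y x + z x * (A x * z x - ey x) 
         + \<theta> * (2 * z x * (y x - ez x) + 2 * y x * (A x * z x - ey x))"
        using \<epsilon>(1) by (simp add: V'_def)
      also have "\<dots> = (y x)^2 + A x * (z x)^2 + 2 * \<theta> * (1 + A x) * (z x * y x)
         - (ez x * (y x + 2 * \<theta> * z x) + ey x * (z x + 2 * \<theta> * y x))"
        by (simp add: power2_eq_square algebra_simps)
      finally show ?thesis .
    qed
    moreover have "(y x)^2 + A x * (z x)^2 \<ge> c * n x"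
    proof -
      have "c * (y x)^2 \<le> 1 * (y x)^2" "c * (z x)^2 \<le> A x * (z x)^2"
        using c A(1)[of x] by (intro mult_right_mono; simp)+
      then show ?thesis by (simp add: n_def distrib_left)
    qed
    moreover have "\<bar>2 * \<theta> * (1 + A x) * (z x * y x)\<bar> \<le> c / 4 * n x"
    proof -
      have "\<bar>2 * \<theta> * (1 + A x) * (z x * y x)\<bar> = 2 * \<theta> * (1 + A x) * \<bar>z x * y x\<bar>"
        using \<theta> A(1)[of x] c by (simp add: abs_mult)
      also have "\<dots> \<le> 2 * \<theta> * 4 * (n x / 2)"
        using \<theta> A(1)[of x] A(2)[of x] c zy by (intro mult_mono) auto
      finally show ?thesis by (simp add: \<theta>_def)
    qed
    moreover have "\<bar>ez x * (y x + 2 * \<theta> * z x) + ey x * (z x + 2 * \<theta> * y x)\<bar> \<le> 2 * ?E * ?S"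
    proof -
      have "2 * \<theta> * \<bar>z x\<bar> \<le> 1 * \<bar>z x\<bar>" "2 * \<theta> * \<bar>y x\<bar> \<le> 1 * \<bar>y x\<bar>"
        using \<theta> by (intro mult_right_mono; simp)+
      moreover have "\<bar>y x + 2 * \<theta> * z x\<bar> \<le> \<bar>y x\<bar> + 2 * \<theta> * \<bar>z x\<bar>" "\<bar>z x + 2 * \<theta> * y x\<bar> \<le> \<bar>z x\<bar> + 2 * \<theta> * \<bar>y x\<bar>"
        using \<theta> abs_triangle_ineq[of "y x" "2 * \<theta> * z x"] abs_triangle_ineq[of "z x" "2 * \<theta> * y x"]
        by (simp_all add: abs_mult)
      ultimately have "\<bar>y x + 2 * \<theta> * z x\<bar> \<le> ?S" "\<bar>z x + 2 * \<theta> * y x\<bar> \<le> ?S" by linarith+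
      then have "\<bar>ez x * (y x + 2 * \<theta> * z x)\<bar> \<le> ?E * ?S" "\<bar>ey x * (z x + 2 * \<theta> * y x)\<bar> \<le> ?E * ?S"
        unfolding abs_mult using e[of x] order_trans[OF abs_ge_zero e(1)[of x]] by (intro mult_mono; simp)+
      then show ?thesis by linarith
    qed
    \<comment> \<open>Half of this budget absorbs the part of the forcing proportional to
      \<open>\<bar>z\<bar>\<close>, by \<open>\<epsilon> * 32 * C \<le> c\<close>; the other half
      comes from Young's inequality applied to the part proportional to
      \<open>\<sigma>\<^sup>2\<close>.\<close>
    moreover have "2 * ?E * ?S \<le> c / 4 * n x + 16 * C^2 / c * \<epsilon>^2 * (\<sigma> x)^4"
    proof -
      have "\<bar>z x\<bar> * ?S \<le> ?S * ?S" by (intro mult_right_mono) auto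
      then have "\<bar>z x\<bar> * ?S \<le> 2 * n x" using S2 by (simp add: power2_eq_square)
      then have "2 * (\<epsilon> * C) * (\<bar>z x\<bar> * ?S) \<le> 2 * (\<epsilon> * C) * (2 * n x)"
        using EC by (intro mult_left_mono) auto
      also have "\<dots> = (\<epsilon> * 32 * C) * (n x / 8)" by simp
      also have "\<dots> \<le> c * (n x / 8)" using \<epsilon> n0 by (intro mult_right_mono) auto
      finally have 1: "2 * (\<epsilon> * C) * (\<bar>z x\<bar> * ?S) \<le> c * (n x / 8)" .
      have amgm: "2 * X * S * c \<le> S^2 * c^2 / 16 + 16 * X^2" for X S
        using zero_le_power2[of "S * c / 4 - 4 * X"] by (simp add: power2_eq_square algebra_simps)
      have "2 * (\<epsilon> * C * (\<sigma> x)^2) * ?S * c \<le> ?S^2 * c^2 / 16 + 16 * (\<epsilon> * C * (\<sigma> x)^2)^2"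
        by (rule amgm)
      then have "2 * (\<epsilon> * C * (\<sigma> x)^2) * ?S \<le> ?S^2 * c / 16 + 16 * (\<epsilon> * C * (\<sigma> x)^2)^2 / c"
        using c by (simp add: field_simps power2_eq_square)
      also have "?S^2 * c / 16 \<le> 2 * n x * c / 16" using S2 c by (intro divide_right_mono mult_right_mono) auto
      finally have 2: "2 * (\<epsilon> * C * (\<sigma> x)^2) * ?S \<le> c * (n x / 8) + 16 * C^2 / c * \<epsilon>^2 * (\<sigma> x)^4"
        by (simp add: power_mult_distrib mult_ac)
      have "2 * ?E * ?S = 2 * (\<epsilon> * C * (\<sigma> x)^2) * ?S + 2 * (\<epsilon> * C) * (\<bar>z x\<bar> * ?S)"
        by (simp add: algebra_simps)
      then show ?thesis using 1 2 by linarith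
    qed
    ultimately show ?thesis by linarith
  qed
  \<comment> \<open>Division by \<open>\<sigma>\<^sup>4\<close> makes the forcing constant. It
    changes the growth rate by at most 8, since
    \<open>\<bar>\<sigma>'\<bar> \<le> 2 * \<sigma>\<close>, and
    \<open>\<epsilon> * 64 \<le> c\<close> makes 8 at most
    \<open>c / (8 * \<epsilon>)\<close>.\<close>
  define f where "f = (\<lambda>x. V x / (\<sigma> x)^4)"
  define f' where "f' = (\<lambda>x. V' x / (\<sigma> x)^4 - 4 * (\<sigma>' x / \<sigma> x) * f x)"
  have df: "(f has_real_derivative f' x) (at x)" for x
  proof -
    have "(f has_real_derivative (V' x * (\<sigma> x)^4 - V x * (4 * (\<sigma> x)^3 * \<sigma>' x)) / ((\<sigma> x)^4 * (\<sigma> x)^4)) (at x)"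
      unfolding f_def using s(1)[of x] by (auto intro!: derivative_eq_intros dV ds)
    moreover have "(V' x * (\<sigma> x)^4 - V x * (4 * (\<sigma> x)^3 * \<sigma>' x)) / ((\<sigma> x)^4 * (\<sigma> x)^4) = f' x"
      using s(1)[of x] by (simp add: f'_def f_def field_simps power4_eq_xxxx power3_eq_cube)
    ultimately show ?thesis by simp
  qed
  have ineq: "f' x \<ge> c / (4 * \<epsilon>) * f x - 16 * C^2 / c * \<epsilon>" for x
  proof -
    define N where "N = n x / (\<sigma> x)^4"
    have s4: "(\<sigma> x)^4 > 0" using s(1)[of x] by simp
    have N: "\<bar>f x\<bar> \<le> N" "0 \<le> N" using Vn[of x] s4 n0[of x] by (simp_all add: f_def N_def divide_right_mono)
    have "V' x \<ge> (c / 2 * n x - 16 * C^2 / c * \<epsilon>^2 * (\<sigma> x)^4) / \<epsilon>"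
      using main[of x] \<epsilon>(1) by (simp add: pos_divide_le_eq)
    then have "V' x / (\<sigma> x)^4 \<ge> (c / 2 * n x - 16 * C^2 / c * \<epsilon>^2 * (\<sigma> x)^4) / \<epsilon> / (\<sigma> x)^4"
      using s4 by (intro divide_right_mono) auto
    also have "(c / 2 * n x - 16 * C^2 / c * \<epsilon>^2 * (\<sigma> x)^4) / \<epsilon> / (\<sigma> x)^4 = c / (2 * \<epsilon>) * N - 16 * C^2 / c * \<epsilon>"
      using s(1)[of x] \<epsilon>(1) by (simp add: N_def field_simps power2_eq_square)
    finally have 1: "V' x / (\<sigma> x)^4 \<ge> c / (2 * \<epsilon>) * N - 16 * C^2 / c * \<epsilon>" .
    have "\<bar>4 * (\<sigma>' x / \<sigma> x) * f x\<bar> \<le> 8 * N"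
    proof -
      have "\<bar>\<sigma>' x / \<sigma> x\<bar> \<le> 2" using s(1)[of x] s(2)[of x] by (simp add: abs_divide pos_divide_le_eq)
      then have "4 * \<bar>\<sigma>' x / \<sigma> x\<bar> * \<bar>f x\<bar> \<le> 4 * 2 * N" using N by (intro mult_mono) auto
      then show ?thesis by (simp add: abs_mult)
    qed
    moreover have "8 * N \<le> c / (8 * \<epsilon>) * N"
      using \<epsilon> N by (intro mult_right_mono) (auto simp: pos_le_divide_eq)
    moreover have "c / (4 * \<epsilon>) * f x \<le> c / (4 * \<epsilon>) * N"
      using c \<epsilon> N by (intro mult_left_mono) auto
    moreover have "c / (2 * \<epsilon>) * N = 4 * (c / (8 * \<epsilon>) * N)" "c / (4 * \<epsilon>) * N = 2 * (c / (8 * \<epsilon>) * N)" by simp_all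
    moreover have "0 \<le> c / (8 * \<epsilon>) * N" using c \<epsilon> N by simp
    ultimately show ?thesis using 1 unfolding f'_def by linarith
  qed
  \<comment> \<open>\<open>f\<close> need not be bounded, because \<sigma> may tend to 0. But
    \<sigma> decays at most like \<open>exp (- 2 * x)\<close>, so \<open>f\<close> grows at most at
    rate 8, which is below \<open>c / (4 * \<epsilon>)\<close>.\<close>
  have lower: "\<sigma> x \<ge> \<sigma> x0 * exp (- 2 * (x - x0))" if "x \<ge> x0" for x
  proof -
    have "\<sigma> x0 * exp (2 * (x0 - x0)) \<le> \<sigma> x * exp (2 * (x - x0))"
    proof (rule has_real_derivative_nonneg_imp_mono[OF _ _ that])
      show "((\<lambda>x. \<sigma> x * exp (2 * (x - x0))) has_real_derivative (\<sigma>' x + 2 * \<sigma> x) * exp (2 * (x - x0))) (at x)" for x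
        by (auto intro!: derivative_eq_intros ds simp: algebra_simps)
      show "0 \<le> (\<sigma>' x + 2 * \<sigma> x) * exp (2 * (x - x0))" for x
        using s(2)[of x] by (intro mult_nonneg_nonneg) auto
    qed
    then have "\<sigma> x0 * exp (- 2 * (x - x0)) \<le> \<sigma> x * exp (2 * (x - x0)) * exp (- 2 * (x - x0))"
      by (intro mult_right_mono) auto
    also have "\<dots> = \<sigma> x" by (simp add: mult.assoc exp_add[symmetric])
    finally show ?thesis .
  qed
  have growth: "f x \<le> (2 * M^2 / (\<sigma> x0)^4) * exp (8 * (x - x0))" if "x \<ge> x0" for x
  proof -
    have sx: "0 < \<sigma> x0 * exp (- 2 * (x - x0))" using s(1)[of x0] by simp
    have "n x \<le> M^2 + M^2"
      unfolding n_def using power_mono[OF bd(1)[of x], of 2] power_mono[OF bd(2)[of x], of 2] by simp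
    then have "V x \<le> 2 * M^2" using Vn[of x] by linarith
    then have "f x \<le> 2 * M^2 / (\<sigma> x0 * exp (- 2 * (x - x0)))^4"
      unfolding f_def using lower[OF that] sx by (intro frac_le power_mono) auto
    also have "(\<sigma> x0 * exp (- 2 * (x - x0)))^4 = (\<sigma> x0)^4 * exp (- (8 * (x - x0)))"
      by (simp add: power_mult_distrib exp_of_nat_mult[symmetric])
    finally show ?thesis by (simp only: exp_minus) (simp add: divide_inverse mult_ac)
  qed
  have "f x0 \<le> (16 * C^2 / c * \<epsilon>) / (c / (4 * \<epsilon>))"
  proof (rule slow_growth_bound[OF df ineq growth])
    show "0 < c / (4 * \<epsilon>)" "8 < c / (4 * \<epsilon>)" using c \<epsilon> by (simp_all add: pos_less_divide_eq)
  qed auto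
  also have "\<dots> = 64 * C^2 / c^2 * \<epsilon>^2" using c \<epsilon> by (simp add: field_simps power2_eq_square)
  finally show ?thesis using s(1)[of x0] by (simp add: f_def V_def n_def \<theta>_def pos_divide_le_eq)
qed

text \<open>Reversing time and the sign of \<open>y\<close> preserves the form of the system but
  flips the sign of \<open>z * y\<close>. Adding the one-sided estimates for both time directions
  cancels this indefinite term and leaves a bound for \<open>z^2 + y^2\<close>.\<close>

lemma fast_dichotomy:
  fixes z y \<sigma> \<sigma>' ez ey A :: "real \<Rightarrow> real"
  assumes dz: "\<And>x. (z has_real_derivative (y x - ez x) / \<epsilon>) (at x)"
    and dy: "\<And>x. (y has_real_derivative (A x * z x - ey x) / \<epsilon>) (at x)"
    and ds: "\<And>x. (\<sigma> has_real_derivative \<sigma>' x) (at x)"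
    and s: "\<And>x. 0 < \<sigma> x" "\<And>x. \<bar>\<sigma>' x\<bar> \<le> 2 * \<sigma> x"
    and A: "\<And>x. c \<le> A x" "\<And>x. A x \<le> 3" and c: "0 < c" "c \<le> 1"
    and e: "\<And>x. \<bar>ez x\<bar> \<le> \<epsilon> * C * ((\<sigma> x)^2 + \<bar>z x\<bar>)" "\<And>x. \<bar>ey x\<bar> \<le> \<epsilon> * C * ((\<sigma> x)^2 + \<bar>z x\<bar>)"
    and bd: "\<And>x. \<bar>z x\<bar> \<le> M" "\<And>x. \<bar>y x\<bar> \<le> M"
    and \<epsilon>: "0 < \<epsilon>" "\<epsilon> * 64 \<le> c" "\<epsilon> * 32 * C \<le> c" and C: "C \<ge> 0"
  shows "\<bar>z x\<bar> \<le> 32 * C / c^2 * \<epsilon> * (\<sigma> x)^2 \<and> \<bar>y x\<bar> \<le> 32 * C / c^2 * \<epsilon> * (\<sigma> x)^2"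
proof -
  have 1: "z x * y x + c / 16 * ((z x)^2 + (y x)^2) \<le> 64 * C^2 / c^2 * \<epsilon>^2 * (\<sigma> x)^4"
    by (rule fast_dichotomy_one_sided[OF dz dy ds s A c e bd \<epsilon> C])
  have flip: "((\<lambda>x. g (- x)) has_real_derivative - g') (at t)" 
    if "(g has_real_derivative g') (at (- t))" for g :: "real \<Rightarrow> real" and g' t
  proof -
    have "(uminus has_real_derivative - 1) (at t)" by (auto intro!: derivative_eq_intros)
    from DERIV_chain2[OF that this] show ?thesis by simp
  qed
  have "z (- (- x)) * - y (- (- x)) + c / 16 * ((z (- (- x)))^2 + (- y (- (- x)))^2)
     \<le> 64 * C^2 / c^2 * \<epsilon>^2 * (\<sigma> (- (- x)))^4"
  proof (rule fast_dichotomy_one_sided[where z = "\<lambda>x. z (- x)" and y = "\<lambda>x. - y (- x)" and \<sigma> = "\<lambda>x. \<sigma> (- x)"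
        and ez = "\<lambda>x. - ez (- x)" and ey = "\<lambda>x. ey (- x)" and A = "\<lambda>x. A (- x)" and \<sigma>' = "\<lambda>x. - \<sigma>' (- x)"])
    show "((\<lambda>x. z (- x)) has_real_derivative (- y (- t) - - ez (- t)) / \<epsilon>) (at t)" for t
      using flip[OF dz] by (simp add: diff_divide_distrib)
    show "((\<lambda>x. - y (- x)) has_real_derivative (A (- t) * z (- t) - ey (- t)) / \<epsilon>) (at t)" for t
      using DERIV_minus[OF flip[OF dy]] by simp
    show "((\<lambda>x. \<sigma> (- x)) has_real_derivative - \<sigma>' (- t)) (at t)" for t
      by (rule flip[OF ds])
  qed (use s A c e bd \<epsilon> C in auto)
  then have 2: "- (z x * y x) + c / 16 * ((z x)^2 + (y x)^2) \<le> 64 * C^2 / c^2 * \<epsilon>^2 * (\<sigma> x)^4" by simp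
  have "c / 16 * ((z x)^2 + (y x)^2) \<le> 64 * C^2 / c^2 * \<epsilon>^2 * (\<sigma> x)^4" using 1 2 by linarith
  then have "(z x)^2 + (y x)^2 \<le> (64 * C^2 / c^2 * \<epsilon>^2 * (\<sigma> x)^4) * 16 / c"
    using c by (simp add: pos_le_divide_eq mult_ac)
  also have "\<dots> = (32 * C * \<epsilon> * (\<sigma> x)^2)^2 / c^3"
    by (simp add: power_mult_distrib power2_eq_square power3_eq_cube power4_eq_xxxx)
  \<comment> \<open>Passing from \<open>c^3\<close> to \<open>c^4\<close>, possible as
    \<open>c \<le> 1\<close>, makes the bound a perfect square.\<close>
  also have "\<dots> \<le> (32 * C * \<epsilon> * (\<sigma> x)^2)^2 / c^4"
    using c by (intro divide_left_mono) (auto simp: power4_eq_xxxx power3_eq_cube mult_le_one)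
  also have "\<dots> = (32 * C / c^2 * \<epsilon> * (\<sigma> x)^2)^2" by (simp add: power_divide power_mult_distrib)
  finally have *: "(z x)^2 + (y x)^2 \<le> (32 * C / c^2 * \<epsilon> * (\<sigma> x)^2)^2" .
  have nn: "0 \<le> 32 * C / c^2 * \<epsilon> * (\<sigma> x)^2" using c C \<epsilon> by simp
  have "\<bar>z x\<bar>^2 \<le> (32 * C / c^2 * \<epsilon> * (\<sigma> x)^2)^2" "\<bar>y x\<bar>^2 \<le> (32 * C / c^2 * \<epsilon> * (\<sigma> x)^2)^2"
    using * zero_le_power2[of "z x"] zero_le_power2[of "y x"] unfolding power2_abs by linarith+
  then show ?thesis using power2_le_imp_le[OF _ nn] by blast
qed

section \<open>The limit profile\<close>

lemma nonneg_derivative_within_imp_le: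
  fixes f f' :: "real \<Rightarrow> real"
  assumes "a \<le> b" "{a..b} \<subseteq> T" "\<And>x. x \<in> T \<Longrightarrow> (f has_real_derivative f' x) (at x within T)" "\<And>x. x \<in> T \<Longrightarrow> 0 \<le> f' x"
  shows "f a \<le> f b"
proof -
  have "\<exists>x\<in>{a..b}. f b - f a = f' x * (b - a)"
  proof (rule mvt_very_simple[OF assms(1)])
    show "(f has_derivative (*) (f' x)) (at x within {a..b})" if "a \<le> x" "x \<le> b" for x
      using assms(2) that has_derivative_subset[OF assms(3)[unfolded has_field_derivative_def, of x] assms(2)] by auto
  qed
  then obtain x where "x \<in> {a..b}" "f b - f a = f' x * (b - a)" by blast
  then have "0 \<le> f b - f a" using assms(1,2,4) by auto
  then show ?thesis by simp
qed

text \<open>Along \<open>T\<close>, \<open>f^2 * exp (2 * k * x)\<close> is nondecreasing and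
  \<open>f^2 * exp (- 2 * k * x)\<close> is nonincreasing, so a nonzero value cannot be lost in
  either direction of time.\<close>

lemma gronwall_nonzero:
  fixes f f' :: "real \<Rightarrow> real"
  assumes T: "convex T" "a \<in> T" "x \<in> T"
    and d: "\<And>x. x \<in> T \<Longrightarrow> (f has_real_derivative f' x) (at x within T)"
    and b: "\<And>x. x \<in> T \<Longrightarrow> \<bar>f' x\<bar> \<le> k * \<bar>f x\<bar>" and nz: "f a \<noteq> 0"
  shows "f x \<noteq> 0"
proof -
  have seg: "{u..v} \<subseteq> T" if "u \<in> T" "v \<in> T" for u v
    using connected_contains_Icc[OF convex_connected[OF T(1)] that] .
  have ff: "2 * f y * f' y \<le> 2 * k * (f y)^2 \<and> - (2 * f y * f' y) \<le> 2 * k * (f y)^2" if "y \<in> T" for y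
  proof -
    have "\<bar>f y * f' y\<bar> \<le> \<bar>f y\<bar> * (k * \<bar>f y\<bar>)"
      unfolding abs_mult using b[OF that] by (intro mult_left_mono) auto
    also have "\<dots> = k * (f y)^2" by (simp add: power2_eq_square)
    finally show ?thesis by linarith
  qed
  have mono: "(f u)^2 * exp (c * u) \<le> (f v)^2 * exp (c * v)" 
    if "u \<le> v" "u \<in> T" "v \<in> T" "c = 2 * k" for u v c
  proof (rule nonneg_derivative_within_imp_le[OF that(1) seg[OF that(2,3)]])
    show "((\<lambda>x. (f x)^2 * exp (c * x)) has_real_derivative (2 * f y * f' y + c * (f y)^2) * exp (c * y)) (at y within T)" if "y \<in> T" for y
      by (auto intro!: derivative_eq_intros d that simp: algebra_simps)
    show "0 \<le> (2 * f y * f' y + c * (f y)^2) * exp (c * y)" if "y \<in> T" for y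
      using ff[OF that] \<open>c = 2 * k\<close> by simp
  qed
  have mono': "- ((f u)^2 * exp (c * u)) \<le> - ((f v)^2 * exp (c * v))" 
    if "u \<le> v" "u \<in> T" "v \<in> T" "c = - 2 * k" for u v c
  proof (rule nonneg_derivative_within_imp_le[OF that(1) seg[OF that(2,3)]])
    show "((\<lambda>x. - ((f x)^2 * exp (c * x))) has_real_derivative - (2 * f y * f' y + c * (f y)^2) * exp (c * y)) (at y within T)" if "y \<in> T" for y
      by (auto intro!: derivative_eq_intros d that simp: algebra_simps)
    show "0 \<le> - (2 * f y * f' y + c * (f y)^2) * exp (c * y)" if "y \<in> T" for y
      using ff[OF that] \<open>c = - 2 * k\<close> by (intro mult_nonneg_nonneg) auto
  qed
  show ?thesis
  proof (cases "a \<le> x")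
    case True
    have "0 < (f a)^2 * exp (2 * k * a)" using nz by simp
    also have "\<dots> \<le> (f x)^2 * exp (2 * k * x)" by (rule mono[OF True T(2,3) refl])
    finally show ?thesis by auto
  next
    case False
    then have "0 < (f a)^2 * exp (- 2 * k * a)" "x \<le> a" using nz by simp_all
    moreover from this have "(f a)^2 * exp (- 2 * k * a) \<le> (f x)^2 * exp (- 2 * k * x)"
      using mono'[OF _ T(3,2) refl] by simp
    ultimately have "0 < (f x)^2 * exp (- 2 * k * x)" by linarith
    then show ?thesis by auto
  qed
qed

text \<open>The square root of the coefficient of \<open>b^2\<close> in the zero-energy curve; it
  equals \<open>lam * sqrt (weight lam a)\<close>.\<close>

definition mroot :: "real \<Rightarrow> real \<Rightarrow> real" where
  "mroot lam a = sqrt (lam^2 * (sin a)^2 + (cos a)^2)"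

text \<open>An antiderivative of \<open>mroot / (sin cos)\<close>: the limit profile satisfies
  \<open>travel_time lam (p x) = travel_time lam (pi/4) - x\<close>.\<close>

definition travel_time :: "real \<Rightarrow> real \<Rightarrow> real" where
  "travel_time lam a = ln (sin a) - ln (1 + mroot lam a) - lam * ln (cos a) + lam * ln (lam + mroot lam a)"

context
  fixes lam :: real assumes lam: "lam \<ge> 1"
begin

lemma mroot_square: "(mroot lam a)^2 = lam^2 * (sin a)^2 + (cos a)^2"
  by (simp add: mroot_def)

lemma mroot_square_bounds: "1 \<le> lam^2 * (sin a)^2 + (cos a)^2" "lam^2 * (sin a)^2 + (cos a)^2 \<le> lam^2"
proof -
  have l: "1 \<le> lam^2" using lam by simp
  have "1 * (sin a)^2 \<le> lam^2 * (sin a)^2" "1 * (cos a)^2 \<le> lam^2 * (cos a)^2"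
    using l by (intro mult_right_mono; simp)+
  moreover have "(sin a)^2 + (cos a)^2 = 1" "lam^2 * (sin a)^2 + lam^2 * (cos a)^2 = lam^2"
    by (simp_all flip: distrib_left)
  ultimately show "1 \<le> lam^2 * (sin a)^2 + (cos a)^2" "lam^2 * (sin a)^2 + (cos a)^2 \<le> lam^2"
    by linarith+
qed

lemma mroot_ge_1: "1 \<le> mroot lam a" and mroot_le: "mroot lam a \<le> lam" and mroot_pos: "0 < mroot lam a"
proof -
  show "1 \<le> mroot lam a" unfolding mroot_def using mroot_square_bounds by simp
  show "mroot lam a \<le> lam" unfolding mroot_def using mroot_square_bounds lam by (intro real_le_lsqrt) auto
  show "0 < mroot lam a" using \<open>1 \<le> mroot lam a\<close> by simp
qed

lemma weight_eq: "weight lam a = (lam^2 * (sin a)^2 + (cos a)^2) / lam^2"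
proof -
  have "weight lam a * lam^2 = lam^2 + (1 - lam^2) * (cos a)^2"
    using lam by (simp add: weight_def field_simps)
  also have "\<dots> = lam^2 * (sin a)^2 + (cos a)^2" by (simp add: sin_squared_eq algebra_simps)
  finally show ?thesis using lam by (simp add: field_simps)
qed

lemma weight_bounds: "1 / lam^2 \<le> weight lam a" "weight lam a \<le> 1"
  unfolding weight_eq using mroot_square_bounds[of a] lam by (simp_all add: divide_right_mono)

lemma sqrt_weight: "sqrt (weight lam a) = mroot lam a / lam"
  unfolding weight_eq mroot_def using lam by (simp add: real_sqrt_divide)

lemma mroot_has_derivative:
  "(mroot lam has_real_derivative (lam^2 - 1) * sin a * cos a / mroot lam a) (at a)"
proof -
  have pos: "0 < lam^2 * (sin a)^2 + (cos a)^2" using mroot_square_bounds(1)[of a] by linarith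
  have "((\<lambda>a. lam^2 * (sin a)^2 + (cos a)^2) has_real_derivative 2 * ((lam^2 - 1) * sin a * cos a)) (at a)"
    by (rule DERIV_cong[OF DERIV_add[OF DERIV_cmult[OF DERIV_power[OF DERIV_sin]] DERIV_power[OF DERIV_cos]]])
       (simp add: left_diff_distrib)
  from DERIV_chain2[OF DERIV_real_sqrt[OF pos] this]
  have "(mroot lam has_real_derivative inverse (mroot lam a) / 2 * (2 * ((lam^2 - 1) * sin a * cos a))) (at a)"
    by (simp only: mroot_def[abs_def])
  moreover have "inverse D / 2 * (2 * y) = y / D" for D y :: real by (simp add: field_simps)
  ultimately show ?thesis by (rule DERIV_cong)
qed

lemma travel_time_has_derivative:
  assumes a: "0 < a" "a < pi / 2"
  shows "(travel_time lam has_real_derivative mroot lam a / (sin a * cos a)) (at a)"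
proof -
  have s: "sin a > 0" "cos a > 0" using a by (auto intro: sin_gt_zero2 cos_gt_zero)
  define D where "D = mroot lam a"
  define d where "d = (lam^2 - 1) * sin a * cos a / D"
  have D: "D \<ge> 1" "D^2 = lam^2 * (sin a)^2 + (cos a)^2" using mroot_ge_1 mroot_square by (auto simp: D_def)
  have dD: "(mroot lam has_real_derivative d) (at a)"
    using mroot_has_derivative[of a] by (simp add: d_def D_def)
  have "(travel_time lam has_real_derivative 
     cos a / sin a - d / (1 + D) - lam * (- sin a / cos a) + lam * (d / (lam + D))) (at a)"
    unfolding travel_time_def[abs_def]
    using s D lam
    by (auto intro!: derivative_eq_intros dD simp: D_def[symmetric] mult.commute)
  moreover have "cos a / sin a - d / (1 + D) - lam * (- sin a / cos a) + lam * (d / (lam + D)) = D / (sin a * cos a)"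
  proof -
    have sc: "(sin a)^2 + (cos a)^2 = 1" by simp
    have nz: "sin a \<noteq> 0" "cos a \<noteq> 0" "D \<noteq> 0" "1 + D \<noteq> 0" "lam + D \<noteq> 0" using s D lam by auto
    \<comment> \<open>The logarithms containing \<open>mroot\<close> must supply the difference
      between \<open>D / (sin a * cos a)\<close> and the derivative of
      \<open>ln sin - lam * ln cos\<close>.\<close>
    have "lam * (d / (lam + D)) - d / (1 + D) = (lam^2 - 1) * (lam - 1) * (sin a * cos a) / ((lam + D) * (1 + D))"
    proof -
      have "lam * (d / (lam + D)) - d / (1 + D) = d * (D * (lam - 1)) / ((lam + D) * (1 + D))"
        using nz by (simp add: divide_simps) (simp add: algebra_simps)
      then show ?thesis using nz by (simp add: d_def mult_ac)
    qed
    also have "\<dots> = (D - (cos a)^2 - lam * (sin a)^2) / (sin a * cos a)"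
    proof -
      have "(lam^2 - 1) * (lam - 1) * (sin a * cos a) * (sin a * cos a) = (D - (cos a)^2 - lam * (sin a)^2) * ((lam + D) * (1 + D))"
        using D(2) sc by algebra
      then show ?thesis using nz by (simp add: frac_eq_eq)
    qed
    also have "\<dots> = D / (sin a * cos a) - cos a / sin a - lam * (sin a / cos a)"
      using nz by (simp add: diff_divide_distrib power2_eq_square)
    finally show ?thesis by simp
  qed
  ultimately show ?thesis by (simp add: D_def)
qed

text \<open>All terms of \<open>travel_time\<close> other than \<open>ln (sin a)\<close> together
  are at least \<open>- ln (1 + lam)\<close>. As \<open>travel_time\<close> falls at unit speed
  along the profile, this yields the rate \<open>exp (- x)\<close> at the right end.\<close>

lemma sin_le_exp_travel_time:
  assumes a: "0 < a" "a < pi / 2"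
  shows "sin a \<le> (1 + lam) * exp (travel_time lam a)"
proof -
  have s: "sin a > 0" "cos a > 0" using a by (auto intro: sin_gt_zero2 cos_gt_zero)
  have "ln (cos a) \<le> 0" "0 \<le> ln (lam + mroot lam a)" "ln (1 + mroot lam a) \<le> ln (1 + lam)"
    using s lam mroot_ge_1[of a] mroot_le[of a] by simp_all
  then have "lam * ln (cos a) \<le> 0" "0 \<le> lam * ln (lam + mroot lam a)"
    using lam by (simp_all add: mult_nonneg_nonpos)
  then have "ln (sin a) \<le> travel_time lam a + ln (1 + lam)"
    using \<open>ln (1 + mroot lam a) \<le> _\<close> unfolding travel_time_def by linarith
  then have "exp (ln (sin a)) \<le> exp (travel_time lam a + ln (1 + lam))" by simp
  then show ?thesis using s lam by (simp add: exp_add mult.commute)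
qed

text \<open>Here \<open>- lam * ln (cos a)\<close> is the dominant term; its coefficient
  \<open>lam\<close> is the origin of the rate \<open>exp (x / lam)\<close> at the left end.\<close>

lemma cos_le_exp_travel_time:
  assumes a: "0 < a" "a < pi / 2"
  shows "cos a \<le> 2 * lam * exp (- travel_time lam a / lam)"
proof -
  have s: "sin a > 0" "cos a > 0" using a by (auto intro: sin_gt_zero2 cos_gt_zero)
  have "ln (sin a) \<le> 0" "0 \<le> ln (1 + mroot lam a)" "ln (lam + mroot lam a) \<le> ln (2 * lam)"
    using s lam mroot_ge_1[of a] mroot_le[of a] by simp_all
  then have "lam * ln (lam + mroot lam a) \<le> lam * ln (2 * lam)" using lam by (intro mult_left_mono) auto
  then have "lam * ln (cos a) \<le> lam * ln (2 * lam) - travel_time lam a"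
    using \<open>ln (sin a) \<le> 0\<close> \<open>0 \<le> ln (1 + mroot lam a)\<close> unfolding travel_time_def by linarith
  then have "ln (cos a) \<le> ln (2 * lam) + - travel_time lam a / lam" using lam by (simp add: field_simps)
  then have "exp (ln (cos a)) \<le> exp (ln (2 * lam) + - travel_time lam a / lam)" by simp
  then show ?thesis using s lam unfolding exp_add by simp
qed

text \<open>By the mean value theorem, since the derivative of \<open>travel_time\<close> is at
  least \<open>1 / (sin x * cos x)\<close> and blows up at both ends. A time shift thus costs an
  angle difference that decays with the same weight as the profile.\<close>

lemma diff_le_travel_time_diff:
  assumes a: "0 < a" "a < pi / 2" and b: "0 < b" "b < pi / 2"
    and S: "sin a \<le> S" "sin b \<le> S" and C: "cos a \<le> C" "cos b \<le> C"
  shows "\<bar>a - b\<bar> \<le> \<bar>travel_time lam a - travel_time lam b\<bar> * min S C"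
proof -
  have *: "\<bar>a - b\<bar> \<le> \<bar>travel_time lam a - travel_time lam b\<bar> * min S C"
    if "a < b" "0 < a" "b < pi / 2" "sin b \<le> S" "cos a \<le> C" for a b
  proof -
    have d: "(travel_time lam has_real_derivative mroot lam x / (sin x * cos x)) (at x)" if "a \<le> x" "x \<le> b" for x
      using \<open>0 < a\<close> \<open>b < pi / 2\<close> that by (intro travel_time_has_derivative) auto
    obtain x where x: "a < x" "x < b" 
      and eq: "travel_time lam b - travel_time lam a = (b - a) * (mroot lam x / (sin x * cos x))"
      using MVT2[OF \<open>a < b\<close> d] by blast
    have s: "sin x > 0" "cos x > 0" using x that by (auto intro: sin_gt_zero2 cos_gt_zero)
    have "sin x \<le> sin b" by (rule sin_monotone_2pi_le) (use x that in auto)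
    moreover have "cos x \<le> cos a" by (rule cos_monotone_0_pi_le) (use x that in auto)
    ultimately have SC: "sin x \<le> S" "cos x \<le> C" using that by auto
    have "sin x * cos x \<le> sin x * 1" "sin x * cos x \<le> 1 * cos x"
      using s by (intro mult_left_mono mult_right_mono; simp)+
    then have le: "sin x * cos x \<le> min S C" using SC by simp
    have "(b - a) * 1 \<le> (b - a) * mroot lam x" using mroot_ge_1[of x] that by (intro mult_left_mono) auto
    also have "\<dots> = (travel_time lam b - travel_time lam a) * (sin x * cos x)"
      unfolding eq using s by simp
    also have "\<dots> \<le> \<bar>travel_time lam a - travel_time lam b\<bar> * (sin x * cos x)"
      using s by (intro mult_right_mono) auto
    also have "\<dots> \<le> \<bar>travel_time lam a - travel_time lam b\<bar> * min S C"
      using le by (intro mult_left_mono) auto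
    finally show ?thesis using that by simp
  qed
  show ?thesis
  proof (cases a b rule: linorder_cases)
    case less then show ?thesis using * assms by blast
  next
    case greater then show ?thesis using *[of b a] assms by (simp add: abs_minus_commute)
  next
    case equal then show ?thesis by simp
  qed
qed

text \<open>The negative root \<open>b\<close> of the zero-energy equation, and the right-hand side
  of the profile equation after the double angle and \<open>sqrt (weight lam a)\<close> are
  rewritten.\<close>

definition limit_slope :: "real \<Rightarrow> real" where "limit_slope a = - (sin a * cos a) / mroot lam a"

lemma limit_slope_lipschitz: "\<bar>limit_slope a - limit_slope b\<bar> \<le> (1 + lam^2) * \<bar>a - b\<bar>"
proof -
  have "norm (limit_slope a - limit_slope b) \<le> (1 + lam^2) * norm (a - b)"
  proof (rule field_differentiable_bound[where S = UNIV])
    fix x :: real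
    let ?D = "mroot lam x"
    have quot: "(- (c * c + (- s) * s) * D - - (s * c) * (l * s * c / D)) / (D * D)
       = - ((c^2 - s^2) / D) + l * (s * c)^2 / D^3" if "D \<noteq> 0" for s c D l :: real
      using that by (simp add: divide_simps power2_eq_square power3_eq_cube) (simp add: algebra_simps)
    have "(limit_slope has_field_derivative 
         (- (cos x * cos x + (- sin x) * sin x) * ?D - - (sin x * cos x) * ((lam^2 - 1) * sin x * cos x / ?D)) / (?D * ?D)) (at x)"
      unfolding limit_slope_def[abs_def]
    proof (rule DERIV_divide[OF DERIV_minus mroot_has_derivative])
      show "((\<lambda>x. sin x * cos x) has_real_derivative cos x * cos x + - sin x * sin x) (at x)"
        by (rule DERIV_mult[OF DERIV_sin DERIV_cos])
    qed (use mroot_pos[of x] in simp)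
    then show "(limit_slope has_field_derivative - (((cos x)^2 - (sin x)^2) / ?D) + (lam^2 - 1) * (sin x * cos x)^2 / ?D^3) (at x within UNIV)"
      using quot[of ?D "cos x" "sin x" "lam^2 - 1"] mroot_pos[of x] by simp
    have D: "1 \<le> ?D" "1 \<le> ?D^3" using mroot_ge_1[of x] by simp_all
    have l: "0 \<le> lam^2 - 1" using lam by simp
    have sc: "\<bar>(cos x)^2 - (sin x)^2\<bar> \<le> 1"
      using abs_cos_le_one[of "2 * x"] by (simp add: cos_double)
    have "(sin x * cos x)^2 \<le> 1"
      by (simp add: abs_mult mult_le_one abs_square_le_1)
    have "\<bar>((cos x)^2 - (sin x)^2) / ?D\<bar> \<le> 1 / 1"
      unfolding abs_divide using D sc by (intro frac_le) auto
    moreover have "\<bar>(lam^2 - 1) * (sin x * cos x)^2 / ?D^3\<bar> \<le> ((lam^2 - 1) * 1) / 1"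
      unfolding abs_divide using D l \<open>(sin x * cos x)^2 \<le> 1\<close>
      by (intro frac_le) (auto simp: abs_mult mult_left_le)
    moreover have "\<bar>- A + B\<bar> \<le> 1 + lam^2" if "\<bar>A\<bar> \<le> 1 / 1" "\<bar>B\<bar> \<le> ((lam^2 - 1) * 1) / 1" for A B
      using that by auto
    ultimately show "norm (- (((cos x)^2 - (sin x)^2) / ?D) + (lam^2 - 1) * (sin x * cos x)^2 / ?D^3) \<le> 1 + lam^2"
      unfolding real_norm_def by blast
  qed auto
  then show ?thesis by simp
qed

lemma limit_profile_derivative:
  assumes p: "limit_profile lam p"
  shows "(p has_real_derivative limit_slope (p x)) (at x)"
proof -
  have "(p has_real_derivative - (1 / (2 * lam)) * sin (2 * p x) * (1 / sqrt (weight lam (p x)))) (at x)"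
    using p by (simp add: limit_profile_def)
  then show ?thesis
    by (rule DERIV_cong) (use lam mroot_pos[of "p x"] in \<open>simp add: sqrt_weight sin_double limit_slope_def\<close>)
qed

text \<open>The derivative of \<open>sin (2 * p)\<close> is bounded by
  \<open>\<bar>sin (2 * p)\<bar>\<close>, so it never vanishes and the profile cannot cross 0 or
  \<open>pi / 2\<close>.\<close>

lemma limit_profile_range:
  assumes p: "limit_profile lam p"
  shows "0 < p x" "p x < pi / 2"
proof -
  have cont: "isCont p y" for y using limit_profile_derivative[OF p] DERIV_isCont by blast
  have p0: "p 0 = pi / 4" using p by (simp add: limit_profile_def)
  have nz: "sin (2 * p y) \<noteq> 0" for y
  proof (rule gronwall_nonzero[where f = "\<lambda>y. sin (2 * p y)" and T = UNIV and a = 0 and k = 1])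
    show "((\<lambda>y. sin (2 * p y)) has_real_derivative cos (2 * p y) * (2 * limit_slope (p y))) (at y within UNIV)" for y
      by (auto intro!: derivative_eq_intros limit_profile_derivative[OF p])
    show "\<bar>cos (2 * p y) * (2 * limit_slope (p y))\<bar> \<le> 1 * \<bar>sin (2 * p y)\<bar>" for y
    proof -
      have "2 * limit_slope (p y) = - sin (2 * p y) / mroot lam (p y)" by (simp add: limit_slope_def sin_double)
      then have "\<bar>2 * limit_slope (p y)\<bar> \<le> \<bar>sin (2 * p y)\<bar> / 1"
        using mroot_ge_1[of "p y"] by (simp only: abs_divide abs_minus) (intro frac_le; simp)
      then have "\<bar>cos (2 * p y)\<bar> * \<bar>2 * limit_slope (p y)\<bar> \<le> 1 * \<bar>sin (2 * p y)\<bar>" by (intro mult_mono) auto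
      then show ?thesis by (simp only: abs_mult)
    qed
  qed (simp_all add: p0)
  have ivt: "\<exists>z. p z = v" if "p u \<le> v" "v \<le> p w" for u v w
  proof (cases "u \<le> w")
    case True then show ?thesis using IVT[OF that True] cont by auto
  next
    case False then show ?thesis using IVT2[of p u v w] that cont by auto
  qed
  show "0 < p x"
  proof (rule ccontr)
    assume "\<not> 0 < p x"
    then obtain z where "p z = 0" using ivt[of x 0 0] p0 by auto
    then show False using nz[of z] by simp
  qed
  show "p x < pi / 2"
  proof (rule ccontr)
    assume "\<not> p x < pi / 2"
    then obtain z where "p z = pi / 2" using ivt[of 0 "pi / 2" x] p0 by auto
    then have "2 * p z = pi" by simp
    then have "sin (2 * p z) = 0" by (simp only: sin_pi)
    then show False using nz[of z] by contradiction
  qed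
qed

text \<open>For the exact profile \<open>travel_time lam (p x) + x\<close> is constant. For \<phi>
  the derivative of this quantity is at most \<delta> times
  \<open>(sin \<phi> * cos \<phi>)^2\<close>, which is bounded by a multiple of
  \<open>- \<psi>\<close>; its integral is therefore controlled by the total variation of \<phi>,
  without any decay rate being known. So \<phi> lags the profile by at most
  \<open>4 * lam * \<delta>\<close>, and this lag is converted into weighted differences of angle
  and slope.\<close>

lemma profile_comparison:
  fixes \<phi> \<psi> :: "real \<Rightarrow> real"
  defines "C1 \<equiv> (1 + lam) * exp (travel_time lam (pi/4) + 2 * lam) + 2 * lam * exp (2 - travel_time lam (pi/4) / lam)"
  assumes p: "limit_profile lam p" 
    and d: "\<And>x. (\<phi> has_real_derivative \<psi> x) (at x)" and range: "\<And>x. 0 < \<phi> x" "\<And>x. \<phi> x < pi / 2" and "\<phi> 0 = pi / 4"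
    and \<delta>: "0 \<le> \<delta>" "\<delta> \<le> 1/2"
    and approx: "\<And>x. \<bar>mroot lam (\<phi> x) * \<psi> x + sin (\<phi> x) * cos (\<phi> x)\<bar> \<le> \<delta> * (sin (\<phi> x) * cos (\<phi> x))^3"
  shows "sin (\<phi> x) * cos (\<phi> x) \<le> C1 * min (exp (x / lam)) (exp (- x))"
    and "\<bar>\<phi> x - p x\<bar> \<le> 4 * lam * C1 * \<delta> * min (exp (x / lam)) (exp (- x))"
    and "\<bar>\<psi> x - deriv p x\<bar> \<le> C1 * (1 + (1 + lam^2) * 4 * lam) * \<delta> * min (exp (x / lam)) (exp (- x))"
proof -
  define T where "T = travel_time lam (pi/4)"
  define \<sigma> where "\<sigma> = (\<lambda>x. sin (\<phi> x) * cos (\<phi> x))"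
  have s: "sin (\<phi> x) > 0" "cos (\<phi> x) > 0" for x using range[of x] by (auto intro: sin_gt_zero2 cos_gt_zero)
  have \<sigma>: "0 < \<sigma> x" "\<sigma> x \<le> sin (\<phi> x)" "\<sigma> x \<le> cos (\<phi> x)" "\<sigma> x \<le> 1" for x
    unfolding \<sigma>_def using s[of x] by (auto simp: mult_le_one)
  have \<sigma>2: "(\<sigma> x)^2 \<le> \<sigma> x" for x using \<sigma>[of x] by (simp add: power2_eq_square)
  define u where "u = (\<lambda>x. travel_time lam (\<phi> x) + x)"
  define u' where "u' = (\<lambda>x. mroot lam (\<phi> x) * \<psi> x / \<sigma> x + 1)"
  have du: "(u has_real_derivative u' x) (at x)" for x
    using DERIV_add[OF DERIV_chain2[OF travel_time_has_derivative[OF range] d[of x]] DERIV_ident]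
    unfolding u_def u'_def \<sigma>_def by simp
  have u'_le: "\<bar>u' x\<bar> \<le> \<delta> * (\<sigma> x)^2" for x
  proof -
    have "u' x = (mroot lam (\<phi> x) * \<psi> x + \<sigma> x) / \<sigma> x" using \<sigma>(1)[of x] by (simp add: u'_def field_simps)
    then have "\<bar>u' x\<bar> = \<bar>mroot lam (\<phi> x) * \<psi> x + \<sigma> x\<bar> / \<sigma> x" using \<sigma>(1)[of x] by simp
    also have "\<dots> \<le> \<delta> * (\<sigma> x)^3 / \<sigma> x" using approx[of x] \<sigma>(1)[of x] by (intro divide_right_mono) (auto simp: \<sigma>_def)
    finally show ?thesis using \<sigma>(1)[of x] by (simp add: power3_eq_cube power2_eq_square)
  qed
  \<comment> \<open>As \<open>\<delta> \<le> 1/2\<close>, the error takes away at most half of the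
    slope. In particular \<phi> is strictly decreasing.\<close>
  have \<psi>_le: "\<sigma> x \<le> - (2 * lam) * \<psi> x" for x
  proof -
    have "\<delta> * (\<sigma> x)^3 \<le> 1/2 * \<sigma> x"
      using \<delta> \<sigma>(1)[of x] \<sigma>(4)[of x] by (intro mult_mono) (auto simp: power3_eq_cube mult_le_one)
    then have "mroot lam (\<phi> x) * \<psi> x \<le> - \<sigma> x / 2" using approx[of x] by (simp add: \<sigma>_def)
    then have "- \<psi> x \<ge> \<sigma> x / 2 / mroot lam (\<phi> x)" using mroot_pos[of "\<phi> x"] by (simp add: field_simps)
    moreover have "\<sigma> x / 2 / mroot lam (\<phi> x) \<ge> \<sigma> x / 2 / lam"
      using mroot_le[of "\<phi> x"] mroot_pos[of "\<phi> x"] \<sigma>(1)[of x] by (intro divide_left_mono) auto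
    ultimately have "- \<psi> x \<ge> \<sigma> x / 2 / lam" by linarith
    then show ?thesis using lam by (simp add: field_simps)
  qed
  have u'_le2: "\<bar>u' x\<bar> \<le> - (2 * lam * \<delta>) * \<psi> x" for x
  proof -
    have "\<bar>u' x\<bar> \<le> \<delta> * \<sigma> x" using u'_le[of x] mult_left_mono[OF \<sigma>2[of x] \<delta>(1)] by linarith
    also have "\<dots> \<le> \<delta> * (- (2 * lam) * \<psi> x)" using \<psi>_le \<delta> by (intro mult_left_mono) auto
    finally show ?thesis by (simp add: mult_ac)
  qed
  \<comment> \<open>Both \<open>u - ?k * \<phi>\<close> and \<open>- u - ?k * \<phi>\<close> are
    nondecreasing, so \<open>u\<close> changes by at most \<open>?k\<close> times the change of
    \<phi>. That change is generously bounded by 2, because \<phi> stays in an interval of length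
    \<open>pi / 2\<close>.\<close>
  have r: "\<bar>travel_time lam (\<phi> x) - (T - x)\<bar> \<le> 4 * lam * \<delta>" for x
  proof -
    let ?k = "2 * lam * \<delta>"
    have k0: "0 \<le> ?k" using lam \<delta> by simp
    have 1: "u b - u a \<le> ?k * (\<phi> a - \<phi> b)" if "a \<le> b" for a b
    proof -
      have "- u a - ?k * \<phi> a \<le> - u b - ?k * \<phi> b"
      proof (rule nonneg_derivative_within_imp_le[OF that subset_UNIV, where f = "\<lambda>x. - u x - ?k * \<phi> x"])
        show "((\<lambda>x. - u x - ?k * \<phi> x) has_real_derivative - u' y - ?k * \<psi> y) (at y within UNIV)" for y
          by (auto intro!: derivative_eq_intros du d)
        show "0 \<le> - u' y - ?k * \<psi> y" for y using u'_le2[of y] by (simp add: mult_ac)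
      qed
      then show ?thesis by (simp add: right_diff_distrib)
    qed
    have 2: "u a - u b \<le> ?k * (\<phi> a - \<phi> b)" if "a \<le> b" for a b
    proof -
      have "u a - ?k * \<phi> a \<le> u b - ?k * \<phi> b"
      proof (rule nonneg_derivative_within_imp_le[OF that subset_UNIV, where f = "\<lambda>x. u x - ?k * \<phi> x"])
        show "((\<lambda>x. u x - ?k * \<phi> x) has_real_derivative u' y - ?k * \<psi> y) (at y within UNIV)" for y
          by (auto intro!: derivative_eq_intros du d)
        show "0 \<le> u' y - ?k * \<psi> y" for y using u'_le2[of y] by (simp add: mult_ac)
      qed
      then show ?thesis by (simp add: right_diff_distrib)
    qed
    have "\<bar>u x - u 0\<bar> \<le> ?k * \<bar>\<phi> x - \<phi> 0\<bar>"
    proof (cases "0 \<le> x")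
      case True
      have "?k * (\<phi> 0 - \<phi> x) \<le> ?k * \<bar>\<phi> x - \<phi> 0\<bar>" using k0 by (intro mult_left_mono) auto
      then show ?thesis using 1[OF True] 2[OF True] by linarith
    next
      case False
      then have F: "x \<le> 0" by simp
      have "?k * (\<phi> x - \<phi> 0) \<le> ?k * \<bar>\<phi> x - \<phi> 0\<bar>" using k0 by (intro mult_left_mono) auto
      then show ?thesis using 1[OF F] 2[OF F] by linarith
    qed
    also have "\<dots> \<le> ?k * 2"
      using range[of x] \<open>\<phi> 0 = _\<close> pi_less_4 k0 by (intro mult_left_mono) auto
    finally show ?thesis using \<open>\<phi> 0 = _\<close> by (simp add: u_def T_def)
  qed
  \<comment> \<open>The largest possible lag, \<open>2 * lam\<close>, is the one built into the
    exponents of \<open>C1\<close>: \<open>T + 2 * lam\<close> for the sine, and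
    \<open>2 - T / lam\<close> after division by \<open>lam\<close> for the cosine.\<close>
  have r': "4 * lam * \<delta> \<le> 2 * lam" using lam \<delta> by simp
  have C1: "(1 + lam) * exp (T + 2 * lam) \<le> C1" "2 * lam * exp (2 - T / lam) \<le> C1" "0 < C1"
    unfolding C1_def T_def using lam by (auto intro!: add_pos_pos)
  have rate: "sin a \<le> C1 * exp (- x) \<and> cos a \<le> C1 * exp (x / lam)"
    if "0 < a" "a < pi / 2" "\<bar>travel_time lam a - (T - x)\<bar> \<le> 2 * lam" for a x
  proof
    have "sin a \<le> (1 + lam) * exp (travel_time lam a)" by (rule sin_le_exp_travel_time[OF that(1,2)])
    also have "\<dots> \<le> (1 + lam) * exp (T + 2 * lam + - x)" using that lam by (intro mult_left_mono) auto
    also have "\<dots> = ((1 + lam) * exp (T + 2 * lam)) * exp (- x)" by (simp only: exp_add mult.assoc)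
    also have "\<dots> \<le> C1 * exp (- x)" using C1 by (intro mult_right_mono) auto
    finally show "sin a \<le> C1 * exp (- x)" .
    have "- travel_time lam a / lam \<le> (2 * lam - T + x) / lam" using that lam by (intro divide_right_mono) auto
    also have "\<dots> = 2 - T / lam + x / lam" using lam by (simp add: field_simps)
    finally have "2 * lam * exp (- travel_time lam a / lam) \<le> 2 * lam * exp (2 - T / lam + x / lam)"
      using lam by (intro mult_left_mono) auto
    also have "\<dots> = (2 * lam * exp (2 - T / lam)) * exp (x / lam)" by (simp only: exp_add mult.assoc)
    also have "\<dots> \<le> C1 * exp (x / lam)" using C1 by (intro mult_right_mono) auto
    finally show "cos a \<le> C1 * exp (x / lam)" using cos_le_exp_travel_time[OF that(1,2)] by linarith
  qed
  have p0: "p 0 = pi / 4" using p by (simp add: limit_profile_def)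
  note pr = limit_profile_range[OF p] and dp = limit_profile_derivative[OF p]
  have tp: "travel_time lam (p x) = T - x" for x
  proof -
    have "((\<lambda>x. travel_time lam (p x) + x) has_real_derivative 0) (at x)" for x
    proof -
      have nz: "0 < sin (p x)" "0 < cos (p x)" 
        using pr[of x] by (auto intro: sin_gt_zero2 cos_gt_zero)
      have "mroot lam (p x) / (sin (p x) * cos (p x)) * limit_slope (p x) + 1 = 0"
        using nz mroot_pos[of "p x"] by (simp add: limit_slope_def)
      then show ?thesis
        using DERIV_add[OF DERIV_chain2[OF travel_time_has_derivative[OF pr] dp[of x]] DERIV_ident] by simp
    qed
    then have "travel_time lam (p x) + x = travel_time lam (p 0) + 0" by (intro DERIV_isconst_all) auto
    then show ?thesis by (simp add: p0 T_def)
  qed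
  define m where "m = min (exp (x / lam)) (exp (- x))"
  have mC: "min (C1 * exp (- x)) (C1 * exp (x / lam)) = C1 * m"
    using C1 by (auto simp: m_def min_def)
  have r1: "sin (\<phi> x) \<le> C1 * exp (- x)" "cos (\<phi> x) \<le> C1 * exp (x / lam)"
    using rate[OF range[of x] order_trans[OF r r']] by blast+
  have r2: "sin (p x) \<le> C1 * exp (- x)" "cos (p x) \<le> C1 * exp (x / lam)"
    using rate[OF pr[of x], of x] tp[of x] lam by simp_all
  have sm: "\<sigma> x \<le> C1 * m"
    unfolding mC[symmetric] using r1 \<sigma>[of x] by simp
  then show "sin (\<phi> x) * cos (\<phi> x) \<le> C1 * min (exp (x / lam)) (exp (- x))" by (simp add: \<sigma>_def m_def)
  have "\<bar>\<phi> x - p x\<bar> \<le> \<bar>travel_time lam (\<phi> x) - travel_time lam (p x)\<bar> * min (C1 * exp (- x)) (C1 * exp (x / lam))"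
    by (rule diff_le_travel_time_diff[OF range pr]) (use r1 r2 in auto)
  also have "\<dots> \<le> 4 * lam * \<delta> * (C1 * m)"
    unfolding mC tp using r[of x] C1 by (intro mult_right_mono) (auto simp: m_def)
  finally have d1: "\<bar>\<phi> x - p x\<bar> \<le> 4 * lam * C1 * \<delta> * m" by (simp add: mult_ac)
  then show "\<bar>\<phi> x - p x\<bar> \<le> 4 * lam * C1 * \<delta> * min (exp (x / lam)) (exp (- x))" by (simp add: m_def)
  have "\<bar>\<psi> x - limit_slope (\<phi> x)\<bar> \<le> \<delta> * (C1 * m)"
  proof -
    have "\<psi> x - limit_slope (\<phi> x) = (mroot lam (\<phi> x) * \<psi> x + \<sigma> x) / mroot lam (\<phi> x)"
      using mroot_pos[of "\<phi> x"] by (simp add: limit_slope_def \<sigma>_def field_simps)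
    then have "\<bar>\<psi> x - limit_slope (\<phi> x)\<bar> = \<bar>mroot lam (\<phi> x) * \<psi> x + \<sigma> x\<bar> / mroot lam (\<phi> x)"
      using mroot_pos[of "\<phi> x"] by simp
    also have "\<dots> \<le> (\<delta> * (\<sigma> x)^3) / 1"
      using approx[of x] mroot_ge_1[of "\<phi> x"] \<delta> \<sigma>(1)[of x] by (intro frac_le) (auto simp: \<sigma>_def)
    also have "(\<sigma> x)^3 \<le> \<sigma> x" using \<sigma>[of x] by (simp add: power3_eq_cube mult_le_one)
    then have "(\<delta> * (\<sigma> x)^3) / 1 \<le> \<delta> * (C1 * m)" using sm \<delta> by (simp add: mult_left_mono)
    finally show ?thesis .
  qed
  moreover have "\<bar>limit_slope (\<phi> x) - limit_slope (p x)\<bar> \<le> (1 + lam^2) * (4 * lam * C1 * \<delta> * m)"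
    using order_trans[OF limit_slope_lipschitz mult_left_mono[OF d1]] by simp
  moreover have "deriv p x = limit_slope (p x)" using dp by (rule DERIV_imp_deriv)
  ultimately have "\<bar>\<psi> x - deriv p x\<bar> \<le> \<delta> * (C1 * m) + (1 + lam^2) * (4 * lam * C1 * \<delta> * m)"
    by linarith
  then show "\<bar>\<psi> x - deriv p x\<bar> \<le> C1 * (1 + (1 + lam^2) * 4 * lam) * \<delta> * min (exp (x / lam)) (exp (- x))"
    unfolding m_def[symmetric] by (simp add: algebra_simps)
qed

end

section \<open>Attraction to the critical manifold\<close>

lemma w_crit_bounds:
  assumes lam: "lam \<ge> 1"
  shows "0 \<le> w_crit lam a b" "w_crit lam a b \<le> lam^2 * (b^2 + (sin a * cos a)^2)"
proof -
  define q where "q = weight lam a"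
  have l: "1 \<le> lam^2" using lam by simp
  have q: "1 / lam^2 \<le> q" "0 < q" using weight_bounds[OF lam, of a] lam unfolding q_def
    by (auto intro: less_le_trans[of 0 "1 / lam^2"])
  have "1 / lam^2 \<le> 1 / 1" using l by (intro frac_le) auto
  then have k: "0 \<le> 1 / lam^2 + 1" "1 / lam^2 + 1 \<le> 2" by simp_all
  have w: "w_crit lam a b = (b^2 + (1 / lam^2 + 1) * (sin a * cos a)^2) / (2 * q)"
    by (simp add: w_crit_def q_def power_mult_distrib mult_ac)
  show "0 \<le> w_crit lam a b" unfolding w using q k by (intro divide_nonneg_nonneg add_nonneg_nonneg mult_nonneg_nonneg) auto
  have "(1 / lam^2 + 1) * (sin a * cos a)^2 \<le> 2 * (sin a * cos a)^2" using k by (intro mult_right_mono) auto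
  then have "b^2 + (1 / lam^2 + 1) * (sin a * cos a)^2 \<le> 2 * (b^2 + (sin a * cos a)^2)"
    using zero_le_power2[of b] unfolding distrib_left by linarith
  then have "w_crit lam a b \<le> 2 * (b^2 + (sin a * cos a)^2) / (2 * (1 / lam^2))"
    unfolding w using q l lam by (intro frac_le) auto
  also have "\<dots> = lam^2 * (b^2 + (sin a * cos a)^2)" using lam by (simp add: field_simps)
  finally show "w_crit lam a b \<le> lam^2 * (b^2 + (sin a * cos a)^2)" .
qed

lemma abs_cos_sq_minus_sin_sq_le: "0 \<le> i \<Longrightarrow> i \<le> 1 \<Longrightarrow> \<bar>(cos a)^2 - i * (sin a)^2\<bar> \<le> (1::real)"
proof -
  assume i: "0 \<le> i" "i \<le> 1"
  have "i * (sin a)^2 \<le> 1 * (sin a)^2" using i by (intro mult_right_mono) auto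
  moreover have "0 \<le> i * (sin a)^2" "0 \<le> (cos a)^2" using i by auto
  ultimately show ?thesis using sin_cos_squared_add[of a] by linarith
qed

text \<open>The deviation \<open>z = w1 - w_crit\<close> and \<open>w2\<close> form a hyperbolic
  system with rates of order \<open>1 / \<epsilon>\<close>. Its forcing is the slow drift of
  \<open>w_crit\<close> along the orbit plus an O(\<epsilon>^2) remainder, so
  \<open>fast_dichotomy\<close> applies with \<sigma> equal to the sine times the cosine of the
  angle. The constant \<open>C\<close> dominates both forcing bounds,
  \<open>22 * lam^4 * (M + 1)\<close> for the drift and \<open>15/2 * lam^2 * (M + 5)\<close> for
  the remainder.\<close>

lemma solution_near_slow_manifold:
  fixes lam \<epsilon> M :: real
  defines "C \<equiv> 50 * lam^4 * (M + 1)"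
  assumes lam: "lam \<ge> 1" and M: "M \<ge> 0" and \<epsilon>: "0 < \<epsilon>" "32 * C * lam^2 * \<epsilon> \<le> 1"
    and S: "solves_S lam \<epsilon> UNIV w1 w2 p1 p2"
    and w: "\<And>x. \<bar>w1 x\<bar> \<le> M" "\<And>x. \<bar>w2 x\<bar> \<le> M"
    and p: "\<And>x. 0 < sin (p1 x) * cos (p1 x)" "\<And>x. \<bar>p2 x\<bar> \<le> 2 * (sin (p1 x) * cos (p1 x))"
  shows "\<bar>w1 x - w_crit lam (p1 x) (p2 x)\<bar> \<le> 32 * C * lam^4 * \<epsilon> * (sin (p1 x) * cos (p1 x))^2 \<and>
         \<bar>w2 x\<bar> \<le> 32 * C * lam^4 * \<epsilon> * (sin (p1 x) * cos (p1 x))^2"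
proof -
  have l1: "1 \<le> lam^2" "1 \<le> lam^4" using lam by simp_all
  have l24: "lam^2 \<le> lam^4" using lam by (intro power_increasing) auto
  have C_eq: "C = (50 * (M + 1)) * lam^4" by (simp add: C_def algebra_simps)
  have "(50 * (M + 1)) * 1 \<le> (50 * (M + 1)) * lam^4" using l1 M by (intro mult_left_mono) auto
  then have C: "50 * (M + 1) \<le> C" by (simp add: C_eq)
  have "0 < 50 * (M + 1)" using M by simp
  then have C0: "0 < C" using C by (rule less_le_trans)
  have \<epsilon>C: "32 * C * \<epsilon> \<le> 1"
  proof -
    have "32 * C * \<epsilon> * 1 \<le> 32 * C * \<epsilon> * lam^2" using C0 \<epsilon>(1) l1 by (intro mult_left_mono) auto
    then show ?thesis using \<epsilon>(2) by (simp add: mult_ac)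
  qed
  have \<epsilon>M: "\<epsilon> * (M + 1) \<le> 1 / 1600"
  proof -
    have "\<epsilon> * (50 * (M + 1)) \<le> \<epsilon> * C" using C \<epsilon>(1) by (intro mult_left_mono) auto
    then show ?thesis using \<epsilon>C by (simp add: algebra_simps)
  qed
  have "\<epsilon> * 1 \<le> \<epsilon> * (M + 1)" using M \<epsilon>(1) by (intro mult_left_mono) auto
  then have \<epsilon>1: "\<epsilon> \<le> 1/1600" using \<epsilon>M by simp
  have \<epsilon>2: "\<epsilon>^2 \<le> \<epsilon>" using \<epsilon>1 \<epsilon>(1) by (simp add: power2_eq_square mult_left_le)
  have \<epsilon>2M: "\<epsilon>^2 * M \<le> 1/2"
    using mult_right_mono[OF \<epsilon>2 M] \<epsilon>M \<epsilon>(1) by (simp add: algebra_simps)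
  define i where "i = 1 / lam^2"
  have i: "0 < i" "i \<le> 1" using l1 lam by (simp_all add: i_def)
  define \<sigma> where "\<sigma> = (\<lambda>x. sin (p1 x) * cos (p1 x))"
  define R where "R = (\<lambda>x. 1 - \<epsilon>^2 * w1 x)"
  define q where "q = (\<lambda>x. weight lam (p1 x))"
  define k where "k = (\<lambda>x. 2 * w1 x - \<epsilon>^2 * (w1 x)^2)"
  define f where "f = (\<lambda>x. - R x * (p2 x)^2 + R x * k x * q x - (R x)^3 * (i + 1) * (\<sigma> x)^2)"
  define b' where "b' = (\<lambda>x. 2 * \<epsilon> * w2 x * p2 x / R x - (1 - i) * k x * \<sigma> x
       + (R x)^2 * (\<sigma> x * ((cos (p1 x))^2 - i * (sin (p1 x))^2)))"
  define N where "N = (\<lambda>x. (p2 x)^2 + (i + 1) * (\<sigma> x)^2)"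
  define \<sigma>' where "\<sigma>' = (\<lambda>x. ((cos (p1 x))^2 - (sin (p1 x))^2) * p2 x)"
  define N' where "N' = (\<lambda>x. 2 * p2 x * b' x + (i + 1) * (2 * \<sigma> x * \<sigma>' x))"
  define q' where "q' = (\<lambda>x. - 2 * (i - 1) * \<sigma> x * p2 x)"
  define g where "g = (\<lambda>x. N' x / (2 * q x) - N x * q' x / (2 * (q x)^2))"
  define z where "z = (\<lambda>x. w1 x - w_crit lam (p1 x) (p2 x))"
  have R: "1/2 \<le> R x" "R x \<le> 3/2" for x
  proof -
    have "\<bar>\<epsilon>^2 * w1 x\<bar> \<le> \<epsilon>^2 * M" using w(1)[of x] by (simp add: abs_mult mult_left_mono)
    then show "1/2 \<le> R x" "R x \<le> 3/2" using \<epsilon>2M unfolding R_def by linarith+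
  qed
  have q: "i \<le> q x" "q x \<le> 1" "0 < q x" for x
    using weight_bounds[OF lam, of "p1 x"] i unfolding q_def by (auto simp: i_def[symmetric])
  have \<sigma>: "0 < \<sigma> x" "\<sigma> x \<le> 1" "\<bar>p2 x\<bar> \<le> 2 * \<sigma> x" "(\<sigma> x)^2 \<le> 1" for x
  proof -
    show a: "0 < \<sigma> x" "\<bar>p2 x\<bar> \<le> 2 * \<sigma> x" using p by (simp_all add: \<sigma>_def)
    have "\<bar>sin (p1 x)\<bar> * \<bar>cos (p1 x)\<bar> \<le> 1 * 1" by (intro mult_mono) auto
    then show b: "\<sigma> x \<le> 1" unfolding \<sigma>_def abs_mult[symmetric] by linarith
    show "(\<sigma> x)^2 \<le> 1" using a b by (simp add: power_le_one)
  qed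
  have b2: "(p2 x)^2 \<le> 4 * (\<sigma> x)^2" for x
    using power_mono[OF \<sigma>(3)[of x], of 2] by (simp add: power_mult_distrib)
  have w1': "(w1 has_real_derivative w2 x / \<epsilon>) (at x)" and w2': "(w2 has_real_derivative f x / \<epsilon>) (at x)"
    and p1': "(p1 has_real_derivative p2 x) (at x)" and p2': "(p2 has_real_derivative b' x) (at x)" for x
  proof -
    have s: "(sin (p1 x))^2 * (cos (p1 x))^2 = (\<sigma> x)^2" by (simp add: \<sigma>_def power_mult_distrib)
    show "(w1 has_real_derivative w2 x / \<epsilon>) (at x)" "(p1 has_real_derivative p2 x) (at x)"
      using S unfolding solves_S_def by auto
    have "(w2 has_real_derivative
        (- (1 - \<epsilon>^2 * w1 x) * (p2 x)^2
         - (1 - \<epsilon>^2 * w1 x) * (\<epsilon>^2 * (w1 x)^2 - 2 * w1 x) * weight lam (p1 x)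
         - (1 - \<epsilon>^2 * w1 x)^3 * (1 / lam^2 + 1) * (sin (p1 x))^2 * (cos (p1 x))^2) / \<epsilon>) (at x)"
      using S unfolding solves_S_def by auto
    then show "(w2 has_real_derivative f x / \<epsilon>) (at x)"
      by (rule DERIV_cong) (simp add: f_def R_def k_def q_def i_def s[symmetric] algebra_simps)
    have "(p2 has_real_derivative
        2 * \<epsilon> * w2 x * p2 x / (1 - \<epsilon>^2 * w1 x)
        + (1 - 1 / lam^2) * (\<epsilon>^2 * (w1 x)^2 - 2 * w1 x) * sin (p1 x) * cos (p1 x)
        + (1 - \<epsilon>^2 * w1 x)^2
          * (sin (p1 x) * (cos (p1 x))^3 - 1 / lam^2 * cos (p1 x) * (sin (p1 x))^3)) (at x)"
      using S unfolding solves_S_def by auto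
    then show "(p2 has_real_derivative b' x) (at x)"
      by (rule DERIV_cong) (simp add: b'_def R_def k_def i_def \<sigma>_def power2_eq_square power3_eq_cube algebra_simps)
  qed
  have d\<sigma>: "(\<sigma> has_real_derivative \<sigma>' x) (at x)" for x
    unfolding \<sigma>_def \<sigma>'_def by (auto intro!: derivative_eq_intros p1' simp: power2_eq_square algebra_simps)
  have dN: "(N has_real_derivative N' x) (at x)" for x
    unfolding N_def N'_def by (auto intro!: derivative_eq_intros p2' d\<sigma>)
  have dq: "(q has_real_derivative q' x) (at x)" for x
    unfolding q_def q'_def weight_def i_def[symmetric] \<sigma>_def by (auto intro!: derivative_eq_intros p1' simp: algebra_simps)
  have wc: "w_crit lam (p1 x) (p2 x) = N x / (2 * q x)" for x
    by (simp add: w_crit_def N_def q_def i_def \<sigma>_def power_mult_distrib add.commute mult_ac)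
  have z: "z = (\<lambda>x. w1 x - N x / (2 * q x))" by (simp add: z_def wc)
  have dz: "(z has_real_derivative (w2 x - \<epsilon> * g x) / \<epsilon>) (at x)" for x
  proof -
    have "((\<lambda>x. N x / (2 * q x)) has_real_derivative (N' x * (2 * q x) - N x * (2 * q' x)) / ((2 * q x) * (2 * q x))) (at x)"
      by (rule DERIV_divide[OF dN DERIV_cmult[OF dq]]) (use q(3)[of x] in simp)
    moreover have "(N' x * (2 * q x) - N x * (2 * q' x)) / ((2 * q x) * (2 * q x)) = g x"
      using q(3)[of x] by (simp add: g_def field_simps power2_eq_square)
    ultimately have "(z has_real_derivative w2 x / \<epsilon> - g x) (at x)"
      unfolding z using DERIV_diff[OF w1'[of x]] by force
    then show ?thesis by (rule DERIV_cong) (use \<epsilon>(1) in \<open>simp add: diff_divide_distrib\<close>)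
  qed
  \<comment> \<open>At \<open>\<epsilon> = 0\<close> the right-hand side \<open>f\<close> is exactly
    \<open>2 * q * z\<close>, so \<open>ey\<close> contains only the corrections from
    \<open>R \<noteq> 1\<close>, which carry the factor \<open>\<epsilon>\<^sup>2\<close>.\<close>
  define ey where "ey = (\<lambda>x. 2 * R x * q x * z x - f x)"
  have kw: "\<bar>k x\<bar> \<le> 5/2 * \<bar>w1 x\<bar>" for x
  proof -
    have "k x = (1 + R x) * w1 x" by (simp add: k_def R_def power2_eq_square algebra_simps)
    then have "\<bar>k x\<bar> = \<bar>1 + R x\<bar> * \<bar>w1 x\<bar>" by (simp add: abs_mult)
    also have "\<dots> \<le> 5/2 * \<bar>w1 x\<bar>" using R[of x] by (intro mult_right_mono) auto
    finally show ?thesis .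
  qed
  \<comment> \<open>\<open>w1\<close> is not known to be of size \<open>\<sigma>\<^sup>2\<close> at
    this point, only up to \<open>z\<close> itself. This is why \<open>fast_dichotomy\<close> admits
    \<open>\<bar>z\<bar>\<close> in the forcing.\<close>
  have wz: "\<bar>w1 x\<bar> \<le> 5 * lam^2 * ((\<sigma> x)^2 + \<bar>z x\<bar>)" for x
  proof -
    have "w_crit lam (p1 x) (p2 x) \<le> lam^2 * ((p2 x)^2 + (\<sigma> x)^2)" "0 \<le> w_crit lam (p1 x) (p2 x)"
      using w_crit_bounds[OF lam] by (simp_all add: \<sigma>_def)
    moreover have "lam^2 * ((p2 x)^2 + (\<sigma> x)^2) \<le> lam^2 * (5 * (\<sigma> x)^2)"
      using b2[of x] by (intro mult_left_mono) auto
    moreover have "1 * \<bar>z x\<bar> \<le> 5 * lam^2 * \<bar>z x\<bar>" using l1 by (intro mult_right_mono) auto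
    moreover have "\<bar>w1 x\<bar> \<le> \<bar>z x\<bar> + \<bar>w_crit lam (p1 x) (p2 x)\<bar>" by (simp add: z_def)
    ultimately have "\<bar>w1 x\<bar> \<le> 5 * lam^2 * \<bar>z x\<bar> + lam^2 * (5 * (\<sigma> x)^2)" by linarith
    then show ?thesis by (simp add: algebra_simps)
  qed
  have ey: "\<bar>ey x\<bar> \<le> \<epsilon> * C * ((\<sigma> x)^2 + \<bar>z x\<bar>)" for x
  proof -
    have k\<epsilon>: "1 - (R x)^2 = \<epsilon>^2 * k x" by (simp add: R_def k_def power2_eq_square algebra_simps)
    have qz: "2 * q x * z x = 2 * q x * w1 x - N x" using q(3)[of x] by (simp add: z field_simps)
    have "ey x = R x * (2 * q x * w1 x - N x) - f x" by (simp add: ey_def qz[symmetric])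
    also have "\<dots> = \<epsilon>^2 * (R x * (w1 x)^2 * q x) - R x * (1 - (R x)^2) * ((i + 1) * (\<sigma> x)^2)"
      by (simp add: f_def N_def k_def power2_eq_square power3_eq_cube algebra_simps)
    also have "\<dots> = \<epsilon>^2 * (R x * ((w1 x)^2 * q x - k x * ((i + 1) * (\<sigma> x)^2)))"
      unfolding k\<epsilon> by (simp add: algebra_simps)
    finally have "\<bar>ey x\<bar> = \<epsilon>^2 * (R x * \<bar>(w1 x)^2 * q x - k x * ((i + 1) * (\<sigma> x)^2)\<bar>)"
      using R[of x] by (simp add: abs_mult)
    also have "\<dots> \<le> \<epsilon> * (3/2 * ((M + 5) * \<bar>w1 x\<bar>))"
    proof -
      have "\<bar>(w1 x)^2 * q x\<bar> \<le> (M * \<bar>w1 x\<bar>) * 1"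
        unfolding abs_mult power2_eq_square using w(1)[of x] q[of x] M by (intro mult_mono) auto
      moreover have "\<bar>k x * ((i + 1) * (\<sigma> x)^2)\<bar> \<le> (5/2 * \<bar>w1 x\<bar>) * (2 * 1)"
      proof -
        have "(i + 1) * (\<sigma> x)^2 \<le> 2 * 1" using i \<sigma>(4)[of x] by (intro mult_mono) auto
        moreover have "0 \<le> (i + 1) * (\<sigma> x)^2" using i by simp
        ultimately show ?thesis unfolding abs_mult[of "k x"] using kw[of x] by (intro mult_mono) auto
      qed
      ultimately have "\<bar>(w1 x)^2 * q x - k x * ((i + 1) * (\<sigma> x)^2)\<bar> \<le> (M + 5) * \<bar>w1 x\<bar>"
        by (simp add: algebra_simps)
      then show ?thesis using R[of x] \<epsilon>2 \<epsilon>(1) M by (intro mult_mono mult_nonneg_nonneg) auto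
    qed
    also have "\<dots> \<le> \<epsilon> * (3/2 * ((M + 5) * (5 * lam^2 * ((\<sigma> x)^2 + \<bar>z x\<bar>))))"
      using wz[of x] \<epsilon>(1) M by (intro mult_left_mono) auto
    also have "\<dots> = \<epsilon> * ((15/2 * (M + 5) * lam^2) * ((\<sigma> x)^2 + \<bar>z x\<bar>))" by simp
    also have "\<dots> \<le> \<epsilon> * (C * ((\<sigma> x)^2 + \<bar>z x\<bar>))"
    proof -
      have "15/2 * (M + 5) \<le> 50 * (M + 1)" using M by simp
      then have "15/2 * (M + 5) * lam^2 \<le> C" unfolding C_eq by (rule mult_mono[OF _ l24]) (use M in auto)
      then show ?thesis using \<epsilon>(1) by (intro mult_left_mono mult_right_mono) auto
    qed
    finally show ?thesis by simp
  qed
  have \<sigma>'_le: "\<bar>\<sigma>' x\<bar> \<le> 2 * \<sigma> x" for x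
  proof -
    have "\<bar>\<sigma>' x\<bar> = \<bar>(cos (p1 x))^2 - 1 * (sin (p1 x))^2\<bar> * \<bar>p2 x\<bar>" by (simp add: \<sigma>'_def abs_mult)
    also have "\<dots> \<le> 1 * (2 * \<sigma> x)" using \<sigma>[of x] abs_cos_sq_minus_sin_sq_le[of 1 "p1 x"] by (intro mult_mono) auto
    finally show ?thesis by simp
  qed
  have b'_le: "\<bar>b' x\<bar> \<le> (11 * M + 3) * \<sigma> x" for x
  proof -
    have "\<bar>2 * \<epsilon> * w2 x * p2 x / R x\<bar> \<le> 2 * 1 * M * (2 * \<sigma> x) / (1/2)"
      unfolding abs_divide abs_mult using \<epsilon>(1) \<epsilon>1 w(2)[of x] \<sigma>[of x] R[of x] M by (intro frac_le mult_mono) auto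
    moreover have "\<bar>(1 - i) * k x * \<sigma> x\<bar> \<le> 1 * (5/2 * M) * \<sigma> x"
      unfolding abs_mult using i kw[of x] w(1)[of x] \<sigma>[of x] M by (intro mult_mono) auto
    moreover have "\<bar>(R x)^2 * (\<sigma> x * ((cos (p1 x))^2 - i * (sin (p1 x))^2))\<bar> \<le> 9/4 * (\<sigma> x * 1)"
    proof -
      have "(R x)^2 \<le> (3/2)^2" using R[of x] by (intro power_mono) auto
      then show ?thesis unfolding abs_mult 
        using \<sigma>[of x] i abs_cos_sq_minus_sin_sq_le[of i "p1 x"] by (intro mult_mono) (auto simp: power2_eq_square)
    qed
    moreover have "\<bar>A - B + D\<bar> \<le> a + b + d" if "\<bar>A\<bar> \<le> a" "\<bar>B\<bar> \<le> b" "\<bar>D\<bar> \<le> d" for A B D a b d :: real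
      using that by linarith
    ultimately have "\<bar>b' x\<bar> \<le> 2 * 1 * M * (2 * \<sigma> x) / (1/2) + 1 * (5/2 * M) * \<sigma> x + 9/4 * (\<sigma> x * 1)"
      unfolding b'_def by blast
    then have "\<bar>b' x\<bar> \<le> 8 * (M * \<sigma> x) + 5/2 * (M * \<sigma> x) + 9/4 * \<sigma> x" by simp
    moreover have "0 \<le> M * \<sigma> x" using M \<sigma>(1)[of x] by simp
    ultimately show ?thesis using \<sigma>(1)[of x] by (simp add: algebra_simps)
  qed
  have g_le: "\<bar>g x\<bar> \<le> C * (\<sigma> x)^2" for x
  proof -
    have s: "0 \<le> \<sigma> x" using \<sigma>(1)[of x] by simp
    have "\<bar>p2 x * b' x\<bar> \<le> (2 * \<sigma> x) * ((11 * M + 3) * \<sigma> x)"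
      unfolding abs_mult using \<sigma>[of x] b'_le[of x] by (intro mult_mono) auto
    moreover have "\<bar>(i + 1) * (2 * \<sigma> x * \<sigma>' x)\<bar> \<le> 2 * (2 * \<sigma> x * (2 * \<sigma> x))"
      unfolding abs_mult using i s \<sigma>'_le[of x] by (intro mult_mono) auto
    ultimately have N': "\<bar>N' x\<bar> \<le> (44 * M + 20) * (\<sigma> x)^2"
      unfolding N'_def by (simp add: power2_eq_square algebra_simps)
    have "(i + 1) * (\<sigma> x)^2 \<le> 2 * (\<sigma> x)^2" using i by (intro mult_right_mono) auto
    then have N: "0 \<le> N x" "N x \<le> 6 * (\<sigma> x)^2" using b2[of x] i unfolding N_def by auto
    have q'_le: "\<bar>q' x\<bar> \<le> 4"
    proof -
      have "q' x = 2 * ((1 - i) * \<sigma> x * p2 x)" by (simp add: q'_def algebra_simps)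
      moreover have "\<bar>(1 - i) * \<sigma> x * p2 x\<bar> \<le> 1 * 1 * 2"
        unfolding abs_mult using i \<sigma>[of x] by (intro mult_mono) auto
      ultimately show ?thesis by linarith
    qed
    have "\<bar>N' x / (2 * q x)\<bar> \<le> ((44 * M + 20) * (\<sigma> x)^2) / (2 * i)"
      unfolding abs_divide using N' q[of x] i M by (intro frac_le) auto
    also have "\<dots> = lam^2 * ((22 * M + 10) * (\<sigma> x)^2)" using lam by (simp add: i_def field_simps)
    also have "\<dots> \<le> lam^4 * ((22 * M + 10) * (\<sigma> x)^2)" using l24 M by (intro mult_right_mono) auto
    finally have 1: "\<bar>N' x / (2 * q x)\<bar> \<le> lam^4 * ((22 * M + 10) * (\<sigma> x)^2)" .
    have "\<bar>N x * q' x / (2 * (q x)^2)\<bar> \<le> ((6 * (\<sigma> x)^2) * 4) / (2 * i^2)"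
      unfolding abs_divide abs_mult using N q'_le q[of x] i by (intro frac_le mult_mono) (auto intro: power_mono)
    also have "\<dots> = lam^4 * (12 * (\<sigma> x)^2)" using lam by (simp add: i_def field_simps power2_eq_square power4_eq_xxxx)
    finally have 2: "\<bar>N x * q' x / (2 * (q x)^2)\<bar> \<le> lam^4 * (12 * (\<sigma> x)^2)" .
    have "\<bar>g x\<bar> \<le> lam^4 * ((22 * M + 10) * (\<sigma> x)^2) + lam^4 * (12 * (\<sigma> x)^2)"
      using 1 2 unfolding g_def by linarith
    also have "\<dots> = lam^4 * (22 * (M + 1)) * (\<sigma> x)^2" by (simp add: algebra_simps)
    also have "\<dots> \<le> lam^4 * (50 * (M + 1)) * (\<sigma> x)^2" using M l1 by (intro mult_right_mono mult_left_mono) auto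
    finally show ?thesis by (simp add: C_eq algebra_simps)
  qed
  have ez: "\<bar>\<epsilon> * g x\<bar> \<le> \<epsilon> * C * ((\<sigma> x)^2 + \<bar>z x\<bar>)" for x
  proof -
    have "\<bar>\<epsilon> * g x\<bar> \<le> \<epsilon> * (C * (\<sigma> x)^2)" using g_le[of x] \<epsilon>(1) by (simp add: abs_mult)
    also have "\<dots> \<le> \<epsilon> * (C * ((\<sigma> x)^2 + \<bar>z x\<bar>))" using \<epsilon>(1) C0 by (intro mult_left_mono) auto
    finally show ?thesis by simp
  qed
  have dy: "(w2 has_real_derivative (2 * R x * q x * z x - ey x) / \<epsilon>) (at x)" for x
    using w2'[of x] by (simp add: ey_def)
  have A: "i \<le> 2 * R x * q x" "2 * R x * q x \<le> 3" for x
  proof -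
    have "i \<le> 1 * q x" using q by simp
    also have "\<dots> \<le> 2 * R x * q x" using R[of x] q[of x] by (intro mult_right_mono) auto
    finally show "i \<le> 2 * R x * q x" .
    have "2 * R x * q x \<le> 3 * 1" using R[of x] q[of x] by (intro mult_mono) auto
    then show "2 * R x * q x \<le> 3" by simp
  qed
  have zM: "\<bar>z x\<bar> \<le> M + 5 * lam^2" for x
  proof -
    have "w_crit lam (p1 x) (p2 x) \<le> lam^2 * ((p2 x)^2 + (\<sigma> x)^2)" "0 \<le> w_crit lam (p1 x) (p2 x)"
      using w_crit_bounds[OF lam] by (simp_all add: \<sigma>_def)
    moreover have "lam^2 * ((p2 x)^2 + (\<sigma> x)^2) \<le> lam^2 * 5"
      using b2[of x] \<sigma>(4)[of x] by (intro mult_left_mono) auto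
    ultimately show ?thesis using w(1)[of x] unfolding z_def by linarith
  qed
  have wM: "\<bar>w2 x\<bar> \<le> M + 5 * lam^2" for x using w(2)[of x] l1 by linarith
  \<comment> \<open>The hyperbolicity constant is \<open>i = 1 / lam^2\<close>, a lower bound for
    \<open>2 * R * q\<close>. It explains the \<open>lam^2\<close> in the smallness hypothesis and,
    through \<open>1 / i^2\<close>, the \<open>lam^4\<close> in the conclusion.\<close>
  have \<epsilon>i: "\<epsilon> * 32 * C \<le> i" using \<epsilon>(2) lam by (simp add: i_def pos_le_divide_eq mult_ac)
  have \<epsilon>i2: "\<epsilon> * 64 \<le> i"
  proof -
    have "\<epsilon> * 64 \<le> \<epsilon> * (32 * C)" using C M \<epsilon>(1) by (intro mult_left_mono) auto
    then show ?thesis using \<epsilon>i by linarith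
  qed
  have "\<bar>z x\<bar> \<le> 32 * C / i^2 * \<epsilon> * (\<sigma> x)^2 \<and> \<bar>w2 x\<bar> \<le> 32 * C / i^2 * \<epsilon> * (\<sigma> x)^2"
    by (rule fast_dichotomy[OF dz dy d\<sigma> \<sigma>(1) \<sigma>'_le A i ez ey zM wM \<epsilon>(1) \<epsilon>i2 \<epsilon>i less_imp_le[OF C0]])
  moreover have "32 * C / i^2 = 32 * C * lam^4" using lam by (simp add: i_def power_divide power2_eq_square power4_eq_xxxx)
  ultimately show ?thesis by (simp add: z_def \<sigma>_def)
qed

section \<open>The slow graph near the limit curve\<close>

lemma Ck_on_imp_continuous_on: "Ck_on k S f \<Longrightarrow> continuous_on S f"
  by (cases k) (auto intro: has_derivative_continuous_on)

text \<open>The mean value inequality requires a convex set, which the region need not be, hence a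
  box. Comparing with the point \<open>(a0, 0, e)\<close> at the same \<open>e\<close> leaves no
  contribution from the third variable.\<close>

lemma Ck_on_linear_bound_on_box:
  fixes h :: "real \<Rightarrow> real \<Rightarrow> real \<Rightarrow> real"
  assumes m: "m \<ge> 1" and Ck: "Ck_on m S (\<lambda>(a, b, e). h a b e)"
    and Q: "{a0 - r..a0 + r} \<times> {- r..r} \<times> {0..\<eta>} \<subseteq> S" and r: "0 \<le> r"
    and z: "\<And>e. 0 \<le> e \<Longrightarrow> e \<le> \<eta> \<Longrightarrow> h a0 0 e = 0"
  shows "\<exists>B\<ge>0. \<forall>a b e. \<bar>a - a0\<bar> \<le> r \<longrightarrow> \<bar>b\<bar> \<le> r \<longrightarrow> 0 \<le> e \<longrightarrow> e \<le> \<eta> \<longrightarrow> \<bar>h a b e\<bar> \<le> B * (\<bar>a - a0\<bar> + \<bar>b\<bar>)"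
proof -
  let ?f = "\<lambda>(a, b, e). h a b e"
  let ?Q = "{a0 - r..a0 + r} \<times> {- r..r} \<times> {0..\<eta>}"
  obtain k where "m = Suc k" using m by (cases m) auto
  with Ck obtain f' where f': "\<And>x. x \<in> S \<Longrightarrow> (?f has_derivative f' x) (at x within S)"
    and Ck': "\<And>v. Ck_on k S (\<lambda>x. f' x v)" by auto
  \<comment> \<open>\<open>Ck_on\<close> gives continuity of the derivative only in each fixed
    direction, so the operator norm is bounded through the values on the basis.\<close>
  have cQ: "continuous_on ?Q (\<lambda>x. \<Sum>v\<in>Basis. norm (f' x v))"
    by (intro continuous_intros continuous_on_subset[OF Ck_on_imp_continuous_on[OF Ck'] Q])
  have "compact ?Q" by (intro compact_Times) auto
  from compact_continuous_image[OF cQ this] 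
  have "bounded ((\<lambda>x. \<Sum>v\<in>Basis. norm (f' x v)) ` ?Q)" by (rule compact_imp_bounded)
  then obtain B where B: "\<And>x. x \<in> ?Q \<Longrightarrow> norm (\<Sum>v\<in>Basis. norm (f' x v)) \<le> B"
    unfolding bounded_iff by blast
  have on: "onorm (f' x) \<le> max B 0" if "x \<in> ?Q" for x
  proof -
    have "bounded_linear (f' x)" using f' Q that by (meson has_derivative_bounded_linear subsetD)
    then have "onorm (f' x) \<le> (\<Sum>v\<in>Basis. norm (f' x v))" by (rule onorm_componentwise)
    then show ?thesis using B[OF that] by simp
  qed
  have "\<bar>h a b e\<bar> \<le> max B 0 * (\<bar>a - a0\<bar> + \<bar>b\<bar>)" 
    if "\<bar>a - a0\<bar> \<le> r" "\<bar>b\<bar> \<le> r" "0 \<le> e" "e \<le> \<eta>" for a b e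
  proof -
    have in': "(a, b, e) \<in> ?Q" "(a0, 0, e) \<in> ?Q" using that r by (auto simp: abs_le_iff)
    have "convex ?Q" by (intro convex_Times) auto
    from differentiable_bound[OF this _ on in', of ?f]
    have "norm (?f (a, b, e) - ?f (a0, 0, e)) \<le> max B 0 * norm ((a, b, e) - (a0, 0, e))"
      using f' Q by (meson has_derivative_subset subsetD)
    moreover have "norm ((a, b, e) - (a0, 0, e)) \<le> \<bar>a - a0\<bar> + \<bar>b\<bar>"
      using norm_Pair_le[of "a - a0" "(b, 0::real)"] norm_Pair_le[of b "0::real"] by simp
    then have "max B 0 * norm ((a, b, e) - (a0, 0, e)) \<le> max B 0 * (\<bar>a - a0\<bar> + \<bar>b\<bar>)"
      by (intro mult_left_mono) auto
    ultimately show ?thesis using z[OF that(3,4)] by simp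
  qed
  then show ?thesis by (intro exI[of _ "max B 0"]) auto
qed

section \<open>Size and zeros of \<open>sin a * cos a\<close>, and linear bounds for
  \<open>h1\<close> and \<open>h2\<close>\<close>

lemma abs_le_2_sin_cos:
  fixes d :: real assumes "\<bar>d\<bar> \<le> 1/2" shows "\<bar>d\<bar> \<le> 2 * \<bar>sin d * cos d\<bar>"
proof -
  have *: "y / 2 \<le> sin y" if "0 \<le> y" "y \<le> 1" for y :: real
  proof -
    have "sin 0 - 0 / 2 \<le> sin y - y / 2"
    proof (rule DERIV_nonneg_imp_nondecreasing[OF that(1), where f = "\<lambda>y. sin y - y / 2"])
      fix x :: real assume x: "0 \<le> x" "x \<le> y"
      have "cos (pi / 3) \<le> cos x"
        by (rule cos_monotone_0_pi_le) (use x that pi_gt3 in auto)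
      then show "\<exists>d. ((\<lambda>y. sin y - y / 2) has_real_derivative d) (at x) \<and> 0 \<le> d"
        by (intro exI[of _ "cos x - 1 / 2"] conjI) (auto intro!: derivative_eq_intros simp: cos_60)
    qed
    then show ?thesis by simp
  qed
  have sc: "2 * \<bar>sin d * cos d\<bar> = sin (2 * \<bar>d\<bar>)"
  proof -
    have "2 * \<bar>sin d * cos d\<bar> = \<bar>sin (2 * d)\<bar>" by (simp add: sin_double abs_mult)
    also have "\<dots> = \<bar>sin (2 * \<bar>d\<bar>)\<bar>" by (cases "0 \<le> d") auto
    also have "\<dots> = sin (2 * \<bar>d\<bar>)" using *[of "2 * \<bar>d\<bar>"] assms by simp
    finally show ?thesis .
  qed
  show ?thesis unfolding sc using *[of "2 * \<bar>d\<bar>"] assms by simp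
qed

lemma abs_le_2_sin_cos_shift:
  fixes a :: real assumes "\<bar>a - pi / 2\<bar> \<le> 1/2" shows "\<bar>a - pi / 2\<bar> \<le> 2 * \<bar>sin a * cos a\<bar>"
  using abs_le_2_sin_cos[OF assms] by (simp add: sin_diff cos_diff abs_mult mult.commute)

lemma sin_cos_eq_0_in_strip:
  fixes a :: real assumes "- (pi / 4) \<le> a" "a \<le> 3 * pi / 4" "sin a * cos a = 0"
  shows "a = 0 \<or> a = pi / 2"
proof -
  have 1: "sin (2 * a) = 0" using assms(3) by (simp add: sin_double)
  show ?thesis
  proof (cases "0 \<le> a \<and> a \<le> pi / 2")
    case True
    then show ?thesis
      using sin_gt_zero[of "2 * a"] 1 by force
  next
    case False
    then consider "a < 0" | "pi / 2 < a" by linarith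
    then show ?thesis
    proof cases
      case 1
      have "0 < sin (- (2 * a))" by (rule sin_gt_zero) (use 1 assms in auto)
      then show ?thesis using \<open>sin (2 * a) = 0\<close> by simp
    next
      case 2
      have "0 < sin (2 * a - pi)" by (rule sin_gt_zero) (use 2 assms in auto)
      then show ?thesis using \<open>sin (2 * a) = 0\<close> by (simp add: sin_diff)
    qed
  qed
qed

text \<open>Near each equilibrium \<open>h\<close> is Lipschitz and vanishes, and the distance is
  comparable to the square root on the right; on the compact remainder that root has a positive
  minimum while \<open>h\<close> is bounded. The restriction on \<open>a\<close> excludes other
  zeros of \<open>sin a * cos a\<close> that \<open>K\<close> may contain, such as
  \<open>pi\<close>, where \<open>h\<close> is not assumed to vanish.\<close>

lemma slow_graph_function_linear_bound:
  fixes h :: "real \<Rightarrow> real \<Rightarrow> real \<Rightarrow> real"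
  assumes m: "m \<ge> 1" and K: "compact K" and D: "open D" "D \<subseteq> K" "(0, 0) \<in> D" "(pi / 2, 0) \<in> D"
    and Ck: "Ck_on m {(a, b, e) | a b e. (a, b) \<in> K \<and> 0 \<le> e} (\<lambda>(a, b, e). h a b e)"
    and z: "\<And>e. 0 \<le> e \<Longrightarrow> e \<le> \<eta> \<Longrightarrow> h 0 0 e = 0" "\<And>e. 0 \<le> e \<Longrightarrow> e \<le> \<eta> \<Longrightarrow> h (pi / 2) 0 e = 0"
  shows "\<exists>C\<ge>0. \<forall>a b e. (a, b) \<in> K \<longrightarrow> - (pi / 4) \<le> a \<longrightarrow> a \<le> 3 * pi / 4 \<longrightarrow> 0 \<le> e \<longrightarrow> e \<le> \<eta> \<longrightarrow>
     \<bar>h a b e\<bar> \<le> C * sqrt ((sin a * cos a)^2 + b^2)"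
proof -
  let ?S = "{(a, b, e) | a b e. (a, b) \<in> K \<and> 0 \<le> e}"
  let ?\<rho> = "\<lambda>a b. sqrt ((sin a * cos a)^2 + b^2)"
  have \<rho>1: "\<bar>sin a * cos a\<bar> \<le> ?\<rho> a b" and \<rho>2: "\<bar>b\<bar> \<le> ?\<rho> a b" for a b :: real
    by (rule real_sqrt_ge_abs1, rule real_sqrt_ge_abs2)
  have box: "\<exists>r>0. r \<le> 1/2 \<and> {a0 - r..a0 + r} \<times> {- r..r} \<subseteq> D" if in_D: "(a0, 0) \<in> D" for a0
  proof -
    obtain \<rho> where \<rho>: "\<rho> > 0" "ball (a0, 0) \<rho> \<subseteq> D"
      using openE[OF D(1) in_D] by blast
    define r where "r = min (1/2) (\<rho> / 3)"
    have "(a, b) \<in> D" if "a \<in> {a0 - r..a0 + r}" "b \<in> {- r..r}" for a b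
    proof -
      have "\<bar>a0 - a\<bar> \<le> r" "\<bar>0 - b\<bar> \<le> r" using that by (auto simp: abs_le_iff)
      moreover have "3 * r \<le> \<rho>" by (simp add: r_def)
      moreover have "dist (a0, 0) (a, b) \<le> \<bar>a0 - a\<bar> + \<bar>0 - b\<bar>"
        using norm_Pair_le[of "a0 - a" "0 - b"] by (simp add: dist_norm)
      ultimately have "dist (a0, 0) (a, b) < \<rho>" using \<rho>(1) by linarith
      then show ?thesis using \<rho>(2) by (meson mem_ball subsetD)
    qed
    then have "{a0 - r..a0 + r} \<times> {- r..r} \<subseteq> D" by blast
    moreover have "0 < r" "r \<le> 1/2" using \<rho>(1) by (simp_all add: r_def)
    ultimately show ?thesis by blast
  qed
  define bound where "bound a0 r C \<longleftrightarrow> (\<forall>a b e. \<bar>a - a0\<bar> \<le> r \<longrightarrow> \<bar>b\<bar> \<le> r \<longrightarrow> 0 \<le> e \<longrightarrow> e \<le> \<eta> \<longrightarrow> \<bar>h a b e\<bar> \<le> C * ?\<rho> a b)" for a0 r C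
  have near: "\<exists>r>0. \<exists>C\<ge>0. bound a0 r C"
    if a0: "(a0, 0) \<in> D" and h0: "\<And>e. 0 \<le> e \<Longrightarrow> e \<le> \<eta> \<Longrightarrow> h a0 0 e = 0"
      and sc: "\<And>a. \<bar>a - a0\<bar> \<le> 1/2 \<Longrightarrow> \<bar>a - a0\<bar> \<le> 2 * \<bar>sin a * cos a\<bar>" for a0
  proof -
    obtain r where r: "r > 0" "r \<le> 1/2" "{a0 - r..a0 + r} \<times> {- r..r} \<subseteq> D" using box[OF a0] by blast
    have "(a, b) \<in> K" if "a \<in> {a0 - r..a0 + r}" "b \<in> {- r..r}" for a b
      using r(3) D(2) that by blast
    then have "{a0 - r..a0 + r} \<times> {- r..r} \<times> {0..\<eta>} \<subseteq> ?S" by auto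
    then have "\<exists>B\<ge>0. \<forall>a b e. \<bar>a - a0\<bar> \<le> r \<longrightarrow> \<bar>b\<bar> \<le> r \<longrightarrow> 0 \<le> e \<longrightarrow> e \<le> \<eta> \<longrightarrow> \<bar>h a b e\<bar> \<le> B * (\<bar>a - a0\<bar> + \<bar>b\<bar>)"
      using r(1) h0 by (intro Ck_on_linear_bound_on_box[OF m Ck]) auto
    then obtain B where
      B: "B \<ge> 0" "\<And>a b e. \<bar>a - a0\<bar> \<le> r \<Longrightarrow> \<bar>b\<bar> \<le> r \<Longrightarrow> 0 \<le> e \<Longrightarrow> e \<le> \<eta> \<Longrightarrow> \<bar>h a b e\<bar> \<le> B * (\<bar>a - a0\<bar> + \<bar>b\<bar>)"
      by blast
    have "\<bar>h a b e\<bar> \<le> 3 * B * ?\<rho> a b" if "\<bar>a - a0\<bar> \<le> r" "\<bar>b\<bar> \<le> r" "0 \<le> e" "e \<le> \<eta>" for a b e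
    proof -
      have "\<bar>a - a0\<bar> + \<bar>b\<bar> \<le> 3 * ?\<rho> a b" using sc[of a] \<rho>1[of a b] \<rho>2[of b a] that r(2) by linarith
      then have "B * (\<bar>a - a0\<bar> + \<bar>b\<bar>) \<le> B * (3 * ?\<rho> a b)" using B(1) by (rule mult_left_mono)
      then show ?thesis using B(2)[OF that] by simp
    qed
    then have "bound a0 r (3 * B)" unfolding bound_def by simp
    moreover have "0 \<le> 3 * B" using B(1) by simp
    ultimately show ?thesis using r(1) by blast
  qed
  have "\<bar>a - 0\<bar> \<le> 2 * \<bar>sin a * cos a\<bar>" if "\<bar>a - 0\<bar> \<le> 1/2" for a :: real
    using abs_le_2_sin_cos[of a] that by simp
  from near[OF D(3) z(1) this] obtain r0 C0 where r0: "r0 > 0" "C0 \<ge> 0" "bound 0 r0 C0" by blast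
  from near[OF D(4) z(2) abs_le_2_sin_cos_shift] obtain r1 C1 where r1: "r1 > 0" "C1 \<ge> 0" "bound (pi / 2) r1 C1" by blast
  \<comment> \<open>Only open boxes are removed, so that \<open>T\<close> is compact; outside the
    two closed boxes a point of the strip is certainly in \<open>T\<close>.\<close>
  define T where "T = (K \<inter> {- (pi / 4)..3 * pi / 4} \<times> UNIV) - ({- r0<..<r0} \<times> {- r0<..<r0} \<union> {pi / 2 - r1<..<pi / 2 + r1} \<times> {- r1<..<r1})"
  have T: "compact T" unfolding T_def
    by (intro compact_diff compact_Int_closed K closed_Times open_Un open_Times) auto
  have \<rho>_cont: "continuous_on T (\<lambda>p. ?\<rho> (fst p) (snd p))" by (intro continuous_intros)
  have \<rho>_pos: "0 < ?\<rho> a b" if "(a, b) \<in> T" for a b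
  proof (rule ccontr)
    assume "\<not> 0 < ?\<rho> a b"
    then have "(sin a * cos a)^2 + b^2 \<le> 0" by simp
    then have "sin a * cos a = 0" "b = 0" by (simp_all only: sum_power2_le_zero_iff)
    moreover have "- (pi / 4) \<le> a" "a \<le> 3 * pi / 4" using that by (auto simp: T_def)
    ultimately have "a = 0 \<or> a = pi / 2" using sin_cos_eq_0_in_strip by blast
    then show False using that \<open>b = 0\<close> r0(1) r1(1) by (auto simp: T_def)
  qed
  have "\<exists>\<mu>>0. \<forall>p\<in>T. \<mu> \<le> ?\<rho> (fst p) (snd p)"
  proof (cases "T = {}")
    case True then show ?thesis by (intro exI[of _ 1]) auto
  next
    case False
    from continuous_attains_inf[OF T False \<rho>_cont] obtain p where
      p: "p \<in> T" "\<forall>y\<in>T. ?\<rho> (fst p) (snd p) \<le> ?\<rho> (fst y) (snd y)" by blast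
    have "0 < ?\<rho> (fst p) (snd p)" using \<rho>_pos[of "fst p" "snd p"] p(1) by simp
    then show ?thesis using p(2) by blast
  qed
  then obtain \<mu> where \<mu>: "\<mu> > 0" "\<And>a b. (a, b) \<in> T \<Longrightarrow> \<mu> \<le> ?\<rho> a b" by (metis fst_conv snd_conv)
  let ?KE = "(\<lambda>(p, e). (fst p, snd p, e)) ` (K \<times> {0..\<eta>})"
  have KE: "compact ?KE" unfolding case_prod_unfold
    by (intro compact_continuous_image compact_Times K continuous_intros) auto
  have "?KE \<subseteq> ?S" by auto
  then have "bounded ((\<lambda>(a, b, e). h a b e) ` ?KE)"
    by (rule compact_imp_bounded[OF compact_continuous_image[OF continuous_on_subset[OF Ck_on_imp_continuous_on[OF Ck]] KE]])
  then obtain B where B: "\<And>x. x \<in> ?KE \<Longrightarrow> norm ((\<lambda>(a, b, e). h a b e) x) \<le> B"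
    unfolding bounded_iff by blast
  have Bh: "\<bar>h a b e\<bar> \<le> B" if "(a, b) \<in> K" "0 \<le> e" "e \<le> \<eta>" for a b e
    using B[of "(a, b, e)"] that by force
  define C where "C = C0 + C1 + \<bar>B\<bar> / \<mu>"
  have C: "0 \<le> C" "C0 \<le> C" "C1 \<le> C" "\<bar>B\<bar> / \<mu> \<le> C" using r0 r1 \<mu>(1) by (auto simp: C_def)
  have "\<bar>h a b e\<bar> \<le> C * ?\<rho> a b" 
    if "(a, b) \<in> K" "- (pi / 4) \<le> a" "a \<le> 3 * pi / 4" "0 \<le> e" "e \<le> \<eta>" for a b e
  proof -
    have nn: "0 \<le> ?\<rho> a b" by simp
    have "(a, b) \<in> T" if "\<not> (\<bar>a - 0\<bar> \<le> r0 \<and> \<bar>b\<bar> \<le> r0)" "\<not> (\<bar>a - pi / 2\<bar> \<le> r1 \<and> \<bar>b\<bar> \<le> r1)"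
      using that \<open>(a, b) \<in> K\<close> \<open>- (pi / 4) \<le> a\<close> \<open>a \<le> 3 * pi / 4\<close> unfolding T_def by auto
    then consider "\<bar>a - 0\<bar> \<le> r0 \<and> \<bar>b\<bar> \<le> r0" | "\<bar>a - pi / 2\<bar> \<le> r1 \<and> \<bar>b\<bar> \<le> r1" | "(a, b) \<in> T"
      by blast
    then show ?thesis
    proof cases
      case 1
      then show ?thesis using r0(3)[unfolded bound_def, rule_format, of a b e] that mult_right_mono[OF C(2) nn] by linarith
    next
      case 2
      then show ?thesis using r1(3)[unfolded bound_def, rule_format, of a b e] that mult_right_mono[OF C(3) nn] by linarith
    next
      case 3
      have "\<bar>h a b e\<bar> \<le> \<bar>B\<bar> / \<mu> * \<mu>" using Bh[of a b e] that \<mu>(1) by simp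
      also have "\<dots> \<le> \<bar>B\<bar> / \<mu> * ?\<rho> a b" using \<mu>(2)[OF 3] \<mu>(1) by (intro mult_left_mono) auto
      finally show ?thesis using mult_right_mono[OF C(4) nn] by linarith
    qed
  qed
  then show ?thesis using C(1) by blast
qed

section \<open>The limit curve inside the region\<close>

lemma limit_profile_surj:
  assumes lam: "lam \<ge> 1" and p: "limit_profile lam p" and a: "0 < a" "a < pi / 2"
  shows "\<exists>x. p x = a"
proof -
  have lim: "(p \<longlongrightarrow> pi / 2) at_bot" "(p \<longlongrightarrow> 0) at_top" using p by (auto simp: limit_profile_def)
  obtain u where u: "\<And>x. x \<le> u \<Longrightarrow> a < p x"
    using order_tendstoD(1)[OF lim(1) a(2)] by (auto simp: eventually_at_bot_linorder)
  obtain v where v: "\<And>x. x \<ge> v \<Longrightarrow> p x < a"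
    using order_tendstoD(2)[OF lim(2) a(1)] by (auto simp: eventually_at_top_linorder)
  have cont: "isCont p y" for y using limit_profile_derivative[OF lam p] DERIV_isCont by blast
  have "p (max u v) \<le> a" "a \<le> p (min u v)" "min u v \<le> max u v"
    using u[of "min u v"] v[of "max u v"] by auto
  from IVT2[OF this] show ?thesis using cont by blast
qed

text \<open>With its endpoints the limit curve is the graph of the continuous function
  \<open>limit_slope lam\<close> over a compact interval, so it has a uniform neighbourhood inside
  \<open>D\<close>. Measuring the tube vertically matches the energy estimate, which controls
  \<open>b\<close> for given \<open>a\<close>.\<close>

lemma tube_around_limit_curve:
  assumes lam: "lam \<ge> 1" and p: "limit_profile lam p" and D: "open D" "\<And>x. (p x, deriv p x) \<in> D" 
    "(pi / 2, 0) \<in> D" "(0, 0) \<in> D"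
  shows "\<exists>\<delta>>0. \<forall>a b. 0 \<le> a \<longrightarrow> a \<le> pi / 2 \<longrightarrow> \<bar>b - limit_slope lam a\<bar> < \<delta> \<longrightarrow> (a, b) \<in> D"
proof -
  let ?\<Gamma> = "(\<lambda>a. (a, limit_slope lam a)) ` {0..pi / 2}"
  have "continuous_on UNIV (mroot lam)" unfolding mroot_def[abs_def] by (intro continuous_intros)
  then have "continuous_on {0..pi / 2} (mroot lam)" by (rule continuous_on_subset) auto
  then have "continuous_on {0..pi / 2} (limit_slope lam)"
    unfolding limit_slope_def[OF lam, abs_def] using mroot_pos[OF lam] by (intro continuous_intros) (auto simp: less_imp_neq[symmetric])
  then have "compact ?\<Gamma>" by (intro compact_continuous_image continuous_intros) auto
  moreover have "?\<Gamma> \<subseteq> D"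
  proof (clarify)
    fix a assume "a \<in> {0..pi / 2}"
    then consider "a = 0" | "a = pi / 2" | "0 < a" "a < pi / 2" by fastforce
    then show "(a, limit_slope lam a) \<in> D"
    proof cases
      case 3
      then obtain x where x: "p x = a" using limit_profile_surj[OF lam p] by blast
      then have "deriv p x = limit_slope lam a"
        using DERIV_imp_deriv[OF limit_profile_derivative[OF lam p, of x]] by simp
      then show ?thesis using D(2)[of x] x by simp
    next
      case 1 then show ?thesis using D(4) by (simp add: limit_slope_def[OF lam])
    next
      case 2
      have "limit_slope lam (pi / 2) = 0" by (simp add: limit_slope_def[OF lam])
      then show ?thesis using D(3) by (simp only: 2)
    qed
  qed
  ultimately obtain \<delta> where \<delta>: "\<delta> > 0" "(\<Union>x\<in>?\<Gamma>. ball x \<delta>) \<subseteq> D"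
    using compact_subset_open_imp_ball_epsilon_subset D(1) by blast
  have "(a, b) \<in> D" if "0 \<le> a" "a \<le> pi / 2" "\<bar>b - limit_slope lam a\<bar> < \<delta>" for a b
  proof -
    have "(a, b) \<in> ball (a, limit_slope lam a) \<delta>" using that by (simp add: dist_Pair_Pair dist_real_def abs_minus_commute)
    moreover have "(a, limit_slope lam a) \<in> ?\<Gamma>" using that by simp
    ultimately show ?thesis using \<delta>(2) by blast
  qed
  then show ?thesis using \<delta>(1) by blast
qed

section \<open>The orbit on the slow graph\<close>

text \<open>A bootstrap principle: at a first exit time the path is still in the closure of
  \<open>G\<close>, and \<open>step\<close> puts it back into \<open>G\<close>. Exit times are
  measured by the fraction \<open>r\<close> of the segment from 0 to \<open>t\<close>, so that
  negative times need no separate treatment.\<close>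

lemma never_leaves_open_set:
  fixes X :: "real \<Rightarrow> 'a::topological_space"
  assumes X: "continuous_on UNIV X" and G: "open G" "X 0 \<in> G"
    and step: "\<And>t. (\<And>s. s \<in> closed_segment 0 t \<Longrightarrow> s \<noteq> t \<Longrightarrow> X s \<in> G) \<Longrightarrow> X t \<in> closure G \<Longrightarrow> X t \<in> G"
  shows "X t \<in> G"
proof (rule ccontr)
  assume "X t \<notin> G"
  define F where "F = {r \<in> {0..1}. X (r * t) \<notin> G}"
  have cont: "continuous_on A (\<lambda>r. X (r * t))" for A
    by (rule continuous_on_compose2[OF X]) (auto intro!: continuous_intros)
  have "F = {0..1} \<inter> (\<lambda>r. X (r * t)) -` (- G)" by (auto simp: F_def)
  moreover have "closed ({0..1} \<inter> (\<lambda>r. X (r * t)) -` (- G))"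
    using G(1) by (intro continuous_closed_preimage cont) auto
  ultimately have "closed F" by simp
  have F: "1 \<in> F" "bdd_below F" using \<open>X t \<notin> G\<close> by (auto simp: F_def intro: bdd_belowI[of _ 0])
  define r where "r = Inf F"
  have rF: "r \<in> F" unfolding r_def using closed_contains_Inf[OF _ F(2) \<open>closed F\<close>] F(1) by auto
  have less: "X (s * t) \<in> G" if "0 \<le> s" "s < r" for s
  proof (rule ccontr)
    assume "X (s * t) \<notin> G"
    then have "s \<in> F" using that rF by (auto simp: F_def)
    then have "r \<le> s" unfolding r_def using F(2) by (intro cInf_lower)
    then show False using that by simp
  qed
  have r: "0 \<le> r" "X (r * t) \<notin> G" using rF by (auto simp: F_def)
  then have "r \<noteq> 0" using G(2) by auto
  then have r0: "0 < r" using r by simp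
  have "(\<lambda>s. X (s * t)) ` closure {0..<r} \<subseteq> closure G"
    by (rule image_closure_subset[OF cont closed_closure]) (use less closure_subset in force)
  then have "X (r * t) \<in> closure G" using r0 by (auto simp: closure_atLeastLessThan)
  moreover have "X s \<in> G" if s: "s \<in> closed_segment 0 (r * t)" "s \<noteq> r * t" for s
  proof -
    obtain u where u: "0 \<le> u" "u \<le> 1" "s = u * (r * t)" using s(1) by (auto simp: closed_segment_def)
    then have "u < 1" using s(2) by (cases "u = 1") auto
    then have "0 \<le> u * r" "u * r < r" using u r0 by auto
    then show ?thesis using less[of "u * r"] u(3) by (simp add: mult.assoc)
  qed
  ultimately show False using step[of "r * t"] r(2) by blast
qed

text \<open>The term \<open>\<eta> * b^2\<close> is absorbed into \<open>q * b^2\<close>, giving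
  \<open>(1 - \<eta>) * b^2 \<le> (1 + \<eta>) * s^2\<close>. With \<open>\<eta> \<le> 1/3\<close>
  the ratio is at most 2, and the error becomes relative to \<open>s^2\<close> alone.\<close>

lemma zero_energy_slope:
  fixes q b s \<eta> :: real
  assumes q: "q \<ge> 1" and est: "\<bar>q * b^2 - s^2\<bar> \<le> \<eta> * (s^2 + b^2)" and \<eta>: "0 \<le> \<eta>" "\<eta> \<le> 1/3"
  shows "b^2 \<le> 2 * s^2" "\<bar>q * b^2 - s^2\<bar> \<le> 3 * \<eta> * s^2"
proof -
  have "\<eta> * b^2 \<le> 1/3 * b^2" "\<eta> * s^2 \<le> 1/3 * s^2" "1 * b^2 \<le> q * b^2" using \<eta> q by (intro mult_right_mono; simp)+
  moreover have "q * b^2 - s^2 \<le> \<eta> * s^2 + \<eta> * b^2" using est by (simp add: distrib_left)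
  ultimately show b: "b^2 \<le> 2 * s^2" by linarith
  have "\<eta> * (s^2 + b^2) \<le> \<eta> * (3 * s^2)" using b \<eta> by (intro mult_left_mono) auto
  then show "\<bar>q * b^2 - s^2\<bar> \<le> 3 * \<eta> * s^2" using est by simp
qed

text \<open>The difference of squares factors as \<open>(D * b + s) * (D * b - s)\<close>, and for
  \<open>b \<le> 0\<close> the second factor has modulus at least \<open>s\<close>, so it can be
  divided out.\<close>

lemma zero_energy_near_slope:
  fixes D b s \<kappa> :: real
  assumes D: "D \<ge> 1" and b: "b \<le> 0" and s: "0 < s" and est: "\<bar>D^2 * b^2 - s^2\<bar> \<le> \<kappa> * s^2"
  shows "\<bar>D * b + s\<bar> \<le> \<kappa> * s"
proof -
  have "D^2 * b^2 - s^2 = (D * b + s) * (D * b - s)" by (simp add: power2_eq_square algebra_simps)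
  then have "\<bar>D^2 * b^2 - s^2\<bar> = \<bar>D * b + s\<bar> * \<bar>D * b - s\<bar>" by (simp add: abs_mult)
  moreover have "D * b \<le> 0" using D b by (simp add: mult_nonneg_nonpos)
  then have "\<bar>D * b + s\<bar> * s \<le> \<bar>D * b + s\<bar> * \<bar>D * b - s\<bar>" using s by (intro mult_left_mono) auto
  ultimately have "\<bar>D * b + s\<bar> * s \<le> (\<kappa> * s) * s" using est by (simp add: power2_eq_square)
  then show ?thesis using s by simp
qed

text \<open>On the graph \<open>w_crit\<close> is quadratic and the corrections are linear in
  \<open>sqrt ((sin a * cos a)^2 + b^2)\<close>, so \<open>energy_estimate\<close> applies with
  \<open>W\<close> equal to \<open>lam^2 * B + C\<close> times this root. The error is then of the
  same order as the planar part of the energy, with the small factor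
  \<open>\<epsilon>\<^sup>2\<close>, up to the equilibria.\<close>

lemma slow_graph_energy:
  fixes lam \<epsilon> B C :: real
  assumes lam: "lam \<ge> 1" and \<epsilon>: "0 < \<epsilon>" "\<epsilon> \<le> 1" and B: "sqrt ((sin a * cos a)^2 + b^2) \<le> B"
    and C: "0 \<le> C" "\<bar>g1\<bar> \<le> C * sqrt ((sin a * cos a)^2 + b^2)" "\<bar>g2\<bar> \<le> C * sqrt ((sin a * cos a)^2 + b^2)"
    and small: "\<epsilon>^2 * ((lam^2 * B + C) * B) \<le> 1/2"
  defines "w1 \<equiv> w_crit lam a b + \<epsilon> * g1" and "w2 \<equiv> \<epsilon> * g2"
  shows "\<bar>w1\<bar> \<le> (lam^2 * B + C) * B" "\<bar>w2\<bar> \<le> (lam^2 * B + C) * B"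
    "\<bar>energy lam \<epsilon> w1 w2 a b - ((mroot lam a)^2 * b^2 - (sin a * cos a)^2)\<bar>
       \<le> 11 * lam^2 * ((lam^2 * B + C) * B + (lam^2 * B + C)^2) * \<epsilon>^2 * ((sin a * cos a)^2 + b^2)"
proof -
  define \<rho> where "\<rho> = sqrt ((sin a * cos a)^2 + b^2)"
  have \<rho>: "0 \<le> \<rho>" "\<rho> \<le> B" "\<rho>^2 = (sin a * cos a)^2 + b^2" using B by (simp_all add: \<rho>_def)
  define C2 where "C2 = lam^2 * B + C"
  have C2: "0 \<le> C2" "C \<le> C2" using \<rho> C(1) by (simp_all add: C2_def)
  have \<epsilon>g: "\<epsilon> * \<bar>g\<bar> \<le> C * \<rho>" if "\<bar>g\<bar> \<le> C * \<rho>" for g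
    using mult_mono[OF \<epsilon>(2) that] \<rho>(1) C(1) by simp
  have "w_crit lam a b \<le> lam^2 * \<rho>^2" "0 \<le> w_crit lam a b"
    using w_crit_bounds[OF lam, of a b] by (simp_all add: \<rho>(3) add.commute)
  moreover have "lam^2 * \<rho>^2 \<le> lam^2 * B * \<rho>"
    using mult_left_mono[OF mult_right_mono[OF \<rho>(2,1)], of "lam^2"] by (simp add: power2_eq_square mult.assoc)
  moreover have "\<bar>\<epsilon> * g1\<bar> \<le> C * \<rho>" using \<epsilon>g[of g1] C(2) \<epsilon>(1) by (simp add: \<rho>_def abs_mult)
  ultimately have w1: "\<bar>w1\<bar> \<le> C2 * \<rho>" unfolding w1_def C2_def distrib_right by linarith
  have "\<bar>w2\<bar> \<le> \<epsilon> * (C * \<rho>)" using C(3) \<epsilon>(1) by (simp add: w2_def abs_mult \<rho>_def)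
  also have "\<dots> \<le> \<epsilon> * (C2 * \<rho>)" using \<epsilon> C2 \<rho> by (intro mult_left_mono mult_right_mono) auto
  finally have w2: "\<bar>w2\<bar> \<le> \<epsilon> * (C2 * \<rho>)" .
  have le: "C2 * \<rho> \<le> C2 * B" by (rule mult_left_mono[OF \<rho>(2) C2(1)])
  show "\<bar>w1\<bar> \<le> (lam^2 * B + C) * B" using w1 le by (simp add: C2_def)
  have "\<epsilon> * (C2 * \<rho>) \<le> 1 * (C2 * \<rho>)" using \<epsilon> C2 \<rho> by (intro mult_right_mono) auto
  then show "\<bar>w2\<bar> \<le> (lam^2 * B + C) * B" using w2 le by (simp add: C2_def)
  have "\<epsilon>^2 * (C2 * \<rho>) \<le> \<epsilon>^2 * (C2 * B)" by (rule mult_left_mono[OF le]) simp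
  then have "\<epsilon>^2 * (C2 * \<rho>) \<le> 1/2" using small by (simp add: C2_def)
  from energy_estimate[OF lam \<epsilon> w1 w2 this, of a b]
  have "\<bar>energy lam \<epsilon> w1 w2 a b - ((mroot lam a)^2 * b^2 - (sin a * cos a)^2)\<bar>
      \<le> 11 * lam^2 * \<epsilon>^2 * (C2 * \<rho> * \<rho>^2 + (C2 * \<rho>)^2)"
    by (simp only: mroot_square[OF lam] \<rho>(3))
  also have "\<dots> \<le> 11 * lam^2 * \<epsilon>^2 * (C2 * B * \<rho>^2 + C2^2 * \<rho>^2)"
  proof (rule mult_left_mono)
    have "C2 * \<rho> * \<rho>^2 \<le> C2 * B * \<rho>^2" by (rule mult_right_mono[OF le]) simp
    then show "C2 * \<rho> * \<rho>^2 + (C2 * \<rho>)^2 \<le> C2 * B * \<rho>^2 + C2^2 * \<rho>^2" by (simp add: power_mult_distrib)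
  qed simp
  also have "\<dots> = 11 * lam^2 * (C2 * B + C2^2) * \<epsilon>^2 * \<rho>^2" by (simp add: algebra_simps)
  finally show "\<bar>energy lam \<epsilon> w1 w2 a b - ((mroot lam a)^2 * b^2 - (sin a * cos a)^2)\<bar>
       \<le> 11 * lam^2 * ((lam^2 * B + C) * B + (lam^2 * B + C)^2) * \<epsilon>^2 * ((sin a * cos a)^2 + b^2)"
    by (simp only: \<rho>(3) C2_def)
qed

lemma sin_cos_pos_in_strip:
  fixes a :: real assumes "- (pi / 4) \<le> a" "a \<le> 3 * pi / 4" "0 < sin a * cos a"
  shows "0 < a" "a < pi / 2"
proof -
  show "0 < a"
  proof (rule ccontr)
    assume "\<not> 0 < a"
    then have "0 \<le> sin (- a)" using assms(1) pi_gt_zero by (intro sin_ge_zero) linarith+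
    moreover have "0 < cos a" using \<open>\<not> 0 < a\<close> assms(1) pi_gt_zero by (intro cos_gt_zero_pi) linarith+
    ultimately have "sin a * cos a \<le> 0" by (intro mult_nonpos_nonneg) auto
    then show False using assms(3) by simp
  qed
  show "a < pi / 2"
  proof (rule ccontr)
    assume "\<not> a < pi / 2"
    then have "0 \<le> sin (a - pi / 2)" using assms(2) pi_gt_zero by (intro sin_ge_zero) linarith+
    moreover have "0 < sin a" using \<open>\<not> a < pi / 2\<close> assms(2) pi_gt_zero by (intro sin_gt_zero) linarith+
    ultimately have "cos a \<le> 0" by (simp add: sin_diff)
    then have "sin a * cos a \<le> 0" using \<open>0 < sin a\<close> by (intro mult_nonneg_nonpos) auto
    then show False using assms(3) by simp
  qed
qed

lemma nonzero_imp_same_sign: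
  fixes f :: "real \<Rightarrow> real"
  assumes f: "continuous_on (closed_segment 0 t) f" and nz: "\<And>s. s \<in> closed_segment 0 t \<Longrightarrow> f s \<noteq> 0"
  shows "0 < f 0 \<longleftrightarrow> 0 < f t"
proof -
  have "connected (f ` closed_segment 0 t)" by (intro connected_continuous_image f) auto
  moreover have "f 0 \<in> f ` closed_segment 0 t" "f t \<in> f ` closed_segment 0 t" by auto
  moreover have "0 \<notin> f ` closed_segment 0 t" using nz by force
  ultimately show ?thesis 
    using connectedD_interval[of "f ` closed_segment 0 t" "f 0" "f t" 0] connectedD_interval[of "f ` closed_segment 0 t" "f t" "f 0" 0]
    by (meson linear not_less)
qed

text \<open>A bootstrap over time. While the orbit is over \<open>D\<close> it cannot leave the
  graph; on the graph zero energy keeps the slope within \<delta> of the limit slope; and the tube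
  of width \<delta> lies in the open set \<open>D\<close>. The bounds by \<open>M\<close> are strict
  on the graph, so the truncation of the vector field never becomes active.\<close>

lemma orbit_on_slow_graph:
  fixes lam \<epsilon> B C \<delta> M :: real and K D :: "(real \<times> real) set" and h1 h2 :: "real \<Rightarrow> real \<Rightarrow> real \<Rightarrow> real"
  defines "C2 \<equiv> lam^2 * B + C"
  defines "C3 \<equiv> 11 * lam^2 * (C2 * B + C2^2)"
  assumes lam: "lam \<ge> 1" and \<epsilon>: "0 < \<epsilon>" "\<epsilon> \<le> 1"
    and D: "open D" "D \<subseteq> K" and K: "closed K"
    and inv: "locally_invariant lam \<epsilon> (slow_graph lam h1 h2 K \<epsilon>) (slow_graph lam h1 h2 (frontier K) \<epsilon>)"
    and B: "B \<ge> 1" "\<And>a b. (a, b) \<in> K \<Longrightarrow> sqrt ((sin a * cos a)^2 + b^2) \<le> B"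
    and C: "C \<ge> 0" "\<And>a b h. (a, b) \<in> K \<Longrightarrow> - (pi / 4) \<le> a \<Longrightarrow> a \<le> 3 * pi / 4 \<Longrightarrow> h \<in> {h1, h2} \<Longrightarrow>
       \<bar>h a b \<epsilon>\<bar> \<le> C * sqrt ((sin a * cos a)^2 + b^2)"
    and hc: "\<And>h. h \<in> {h1, h2} \<Longrightarrow> continuous_on K (\<lambda>p. h (fst p) (snd p) \<epsilon>)"
    and tube: "\<delta> > 0" "\<And>a b. 0 \<le> a \<Longrightarrow> a \<le> pi / 2 \<Longrightarrow> \<bar>b - limit_slope lam a\<bar> < \<delta> \<Longrightarrow> (a, b) \<in> D"
    and M: "M > C2 * B" "M > B" and small: "\<epsilon>^2 * M \<le> 1/2" "C3 * \<epsilon>^2 \<le> 1/3" "3 * C3 * \<epsilon>^2 < \<delta>"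
      "lam * \<delta> \<le> 1/2" "4 * C3 * \<epsilon>^2 * B^2 < \<delta>"
  shows "\<exists>w1 w2 p1 p2. solves_S lam \<epsilon> UNIV w1 w2 p1 p2 \<and> p1 0 = pi / 4 \<and>
    (\<forall>x. (w1 x, w2 x, p1 x, p2 x) \<in> slow_graph lam h1 h2 K \<epsilon> \<and> \<bar>w1 x\<bar> \<le> M \<and> \<bar>w2 x\<bar> \<le> M \<and>
      0 < p1 x \<and> p1 x < pi / 2 \<and> p2 x < 0 \<and> \<bar>p2 x\<bar> \<le> 2 * (sin (p1 x) * cos (p1 x)) \<and>
      energy lam \<epsilon> (w1 x) (w2 x) (p1 x) (p2 x) = 0)"
proof -
  define W1 where "W1 = (\<lambda>a b. w_crit lam a b + \<epsilon> * h1 a b \<epsilon>)"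
  define W2 where "W2 = (\<lambda>a b. \<epsilon> * h2 a b \<epsilon>)"
  have C2: "C2 \<ge> 0" using B C(1) by (simp add: C2_def)
  have C3: "C3 \<ge> 0" using B C2 by (simp add: C3_def)
  have M0: "M > 0" using M B by linarith
  have "\<epsilon>^2 * (C2 * B) \<le> \<epsilon>^2 * M" using M(1) by (intro mult_left_mono) auto
  then have small': "\<epsilon>^2 * ((lam^2 * B + C) * B) \<le> 1/2" using small(1) by (simp add: C2_def)
  have est: "\<bar>W1 a b\<bar> < M" "\<bar>W2 a b\<bar> < M"
    "\<bar>energy lam \<epsilon> (W1 a b) (W2 a b) a b - ((mroot lam a)^2 * b^2 - (sin a * cos a)^2)\<bar> \<le> C3 * \<epsilon>^2 * ((sin a * cos a)^2 + b^2)"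
    if "(a, b) \<in> K" "- (pi / 4) \<le> a" "a \<le> 3 * pi / 4" for a b
    using slow_graph_energy[OF lam \<epsilon> B(2)[OF that(1)] C(1) C(2)[OF that, of h1] C(2)[OF that, of h2] small'] M(1)
    by (simp_all add: W1_def W2_def C3_def C2_def)
  have graph: "(w1, w2, a, b) \<in> slow_graph lam h1 h2 A \<epsilon> \<longleftrightarrow> (a, b) \<in> A \<and> w1 = W1 a b \<and> w2 = W2 a b" for w1 w2 a b A
    by (auto simp: slow_graph_def W1_def W2_def)

  text \<open>On the line \<open>a = pi / 4\<close> the energy changes sign across the limit curve.\<close>
  define r where "r = mroot lam (pi / 4)"
  define d where "d = \<delta> / 2"
  define b0 where "b0 = limit_slope lam (pi / 4)"
  have r: "1 \<le> r" "r \<le> lam" "0 < r" using mroot_ge_1[OF lam] mroot_le[OF lam] mroot_pos[OF lam] by (simp_all add: r_def)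
  have sc: "sin (pi / 4) * cos (pi / 4) = (1/2 :: real)" by (simp add: sin_45 cos_45)
  have rb0: "r * b0 = - 1/2" using r by (simp add: b0_def r_def limit_slope_def[OF lam] sc)
  have d: "0 < d" "d < \<delta>" "r * d \<le> 1/4" "d \<le> r * d"
  proof -
    have "r * \<delta> \<le> lam * \<delta>" "1 * d \<le> r * d" using r tube(1) by (auto intro!: mult_right_mono simp: d_def)
    then show "r * d \<le> 1/4" "d \<le> r * d" using small(4) unfolding d_def by linarith+
  qed (use tube(1) in \<open>simp_all add: d_def\<close>)
  have inD: "(pi / 4, b) \<in> D" if "\<bar>b - b0\<bar> \<le> d" for b
    using tube(2)[of "pi / 4" b] that d(2) by (simp add: b0_def)
  define E where "E = (\<lambda>b. energy lam \<epsilon> (W1 (pi / 4) b) (W2 (pi / 4) b) (pi / 4) b)"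
  \<comment> \<open>The hypothesis \<open>4 * C3 * \<epsilon>^2 * B^2 < \<delta>\<close> puts the
    deviation below \<open>d / 2\<close>, which is a lower bound for
    \<open>\<bar>r^2 * b^2 - 1/4\<bar>\<close> at both ends \<open>b0 - d\<close> and
    \<open>b0 + d\<close>.\<close>
  have E: "\<bar>E b - (r^2 * b^2 - 1/4)\<bar> < d / 2" if "\<bar>b - b0\<bar> \<le> d" for b
  proof -
    have K': "(pi / 4, b) \<in> K" using inD[OF that] D(2) by auto
    have s: "(sin (pi / 4) * cos (pi / 4))^2 = (1/4::real)" by (simp add: sc power2_eq_square)
    have "sqrt (1/4 + b^2) \<le> B" using B(2)[OF K'] by (simp only: s)
    then have "1/4 + b^2 \<le> B^2" by (rule sqrt_le_D)
    then have "C3 * \<epsilon>^2 * (1/4 + b^2) \<le> C3 * \<epsilon>^2 * B^2" using C3 by (intro mult_left_mono) auto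
    moreover have "\<bar>E b - (r^2 * b^2 - 1/4)\<bar> \<le> C3 * \<epsilon>^2 * (1/4 + b^2)"
      using est(3)[OF K'] by (simp only: s E_def r_def) simp
    ultimately show ?thesis using small(5) by (simp add: d_def)
  qed
  have "E (b0 + d) < 0"
  proof -
    have "r * (b0 + d) = - 1/2 + r * d" using rb0 by (simp add: distrib_left)
    then have "r^2 * (b0 + d)^2 - 1/4 = - (r * d) * (1 - r * d)"
      by (simp add: power_mult_distrib[symmetric]) (simp add: power2_eq_square algebra_simps)
    also have "\<dots> \<le> - d * (1/2)"
    proof -
      have "d * (1/2) \<le> (r * d) * (1 - r * d)" using d by (intro mult_mono) auto
      then show ?thesis by simp
    qed
    finally have "r^2 * (b0 + d)^2 - 1/4 \<le> - d * (1/2)" .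
    moreover have "\<bar>E (b0 + d) - (r^2 * (b0 + d)^2 - 1/4)\<bar> < d / 2" by (rule E) (use d(1) in simp)
    ultimately show ?thesis by linarith
  qed
  moreover have "0 < E (b0 - d)"
  proof -
    have "r * (b0 - d) = - 1/2 - r * d" using rb0 by (simp add: right_diff_distrib)
    then have "r^2 * (b0 - d)^2 - 1/4 = (r * d) * (1 + r * d)"
      by (simp add: power_mult_distrib[symmetric]) (simp add: power2_eq_square algebra_simps)
    moreover have "(r * d) * 1 \<le> (r * d) * (1 + r * d)" using d by (intro mult_left_mono) auto
    moreover have "\<bar>E (b0 - d) - (r^2 * (b0 - d)^2 - 1/4)\<bar> < d / 2" by (rule E) (use d(1) in simp)
    ultimately show ?thesis using d(1,4) by linarith
  qed
  moreover have "continuous_on {b0 - d..b0 + d} E"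
  proof -
    have "continuous_on {b0 - d..b0 + d} (\<lambda>b. h (pi / 4) b \<epsilon>)" if "h \<in> {h1, h2}" for h
    proof -
      have "continuous_on {b0 - d..b0 + d} (\<lambda>b. h (fst (pi / 4, b)) (snd (pi / 4, b)) \<epsilon>)"
        by (rule continuous_on_compose2[OF hc[OF that], where f = "\<lambda>b. (pi / 4, b)"])
           (use inD D(2) in \<open>auto intro!: continuous_intros simp: abs_le_iff\<close>)
      then show ?thesis by simp
    qed
    then have "continuous_on {b0 - d..b0 + d} (\<lambda>b. h1 (pi / 4) b \<epsilon>)" "continuous_on {b0 - d..b0 + d} (\<lambda>b. h2 (pi / 4) b \<epsilon>)" by simp_all
    moreover have "0 < weight lam (pi / 4)" using weight_bounds(1)[OF lam, of "pi / 4"] lam by (auto intro: less_le_trans[rotated])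
    ultimately show ?thesis
      unfolding E_def energy_def W1_def W2_def w_crit_def by (intro continuous_intros) auto
  qed
  ultimately obtain b1 where b1: "b0 - d \<le> b1" "b1 \<le> b0 + d" "E b1 = 0"
    using IVT2'[of E "b0 + d" 0 "b0 - d"] d(1) by auto
  have b1D: "(pi / 4, b1) \<in> D" using inD b1 by (simp add: abs_le_iff)
  have "r * b1 \<le> r * (b0 + d)" using b1 r by (intro mult_left_mono) auto
  then have "r * b1 < 0" using rb0 d(3) by (simp add: distrib_left)
  then have b1_neg: "b1 < 0" using r(3) by (simp add: mult_less_0_iff)

  from truncated_solution_exists[OF M0 small(1), of "(W1 (pi / 4) b1, W2 (pi / 4) b1, pi / 4, b1)" lam]
  obtain w1 w2 p1 p2 where X0: "(w1 0, w2 0, p1 0, p2 0) = (W1 (pi / 4) b1, W2 (pi / 4) b1, pi / 4, b1)"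
    and cont: "continuous_on UNIV w1" "continuous_on UNIV w2" "continuous_on UNIV p1" "continuous_on UNIV p2"
    and sol: "\<And>T. (\<forall>t\<in>T. \<bar>w1 t\<bar> \<le> M \<and> \<bar>w2 t\<bar> \<le> M \<and> \<bar>p2 t\<bar> \<le> M) \<Longrightarrow> solves_S lam \<epsilon> T w1 w2 p1 p2"
    by blast
  have init: "w1 0 = W1 (pi / 4) b1" "w2 0 = W2 (pi / 4) b1" "p1 0 = pi / 4" "p2 0 = b1"
    using X0 unfolding prod.inject by blast+
  define X where "X = (\<lambda>t. (w1 t, w2 t, p1 t, p2 t))"
  \<comment> \<open>The open set of the bootstrap. Its strip leaves a margin around
    \<open>[0, pi / 2]\<close> and is the one on which \<open>h1\<close> and \<open>h2\<close> are
    controlled; \<open>G'\<close> is a closed set still carrying the non-strict bounds needed at the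
    final time.\<close>
  define G where "G = {- M<..<M} \<times> {- M<..<M} \<times> (D \<inter> {- (pi / 4)<..<3 * pi / 4} \<times> UNIV)"
  define G' where "G' = {- M..M} \<times> {- M..M} \<times> (K \<inter> {- (pi / 4)..3 * pi / 4} \<times> UNIV)"
  have G: "open G" unfolding G_def by (intro open_Times open_Int D(1)) auto
  have "G \<subseteq> G'" using D(2) by (auto simp: G_def G'_def)
  moreover have "closed G'" unfolding G'_def by (intro closed_Times closed_Int K) auto
  ultimately have clG: "closure G \<subseteq> G'" by (rule closure_minimal)
  have X0M: "X 0 \<in> slow_graph lam h1 h2 K \<epsilon>" unfolding X_def graph init using b1D D(2) by blast
  have X0G: "X 0 \<in> G"
    unfolding X_def G_def init using est(1,2)[OF subsetD[OF D(2) b1D]] b1D by (auto simp: abs_less_iff)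
  have fr: "D \<inter> frontier K = {}"
    using interior_maximal[OF D(2,1)] by (auto simp: frontier_def)
  define ok where "ok t \<longleftrightarrow> X t \<in> slow_graph lam h1 h2 K \<epsilon> \<and> 0 < p1 t \<and> p1 t < pi / 2 \<and> p2 t < 0 \<and>
      \<bar>p2 t\<bar> \<le> 2 * (sin (p1 t) * cos (p1 t)) \<and> energy lam \<epsilon> (w1 t) (w2 t) (p1 t) (p2 t) = 0 \<and> X t \<in> G" for t
  have key: "ok t" if inG: "\<And>s. s \<in> closed_segment 0 t \<Longrightarrow> s \<noteq> t \<Longrightarrow> X s \<in> G" and inG': "X t \<in> closure G" for t
  proof -
    let ?T = "closed_segment 0 t"
    have seg: "X s \<in> G'" if "s \<in> ?T" for s
      using inG[OF that] inG' clG closure_subset[of G] by (cases "s = t") auto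
    have T: "convex ?T" "0 \<in> ?T" "t \<in> ?T" by auto
    have KM: "\<bar>b\<bar> \<le> M" if "(a, b) \<in> K" for a b
      using B(2)[OF that] M(2) real_sqrt_ge_abs2[of b "sin a * cos a"] by linarith
    have S: "solves_S lam \<epsilon> ?T w1 w2 p1 p2"
      by (rule sol) (use seg KM in \<open>fastforce simp: G'_def X_def abs_le_iff\<close>)
    \<comment> \<open>The graph can be left only over \<open>frontier K\<close>, which
      \<open>G\<close> does not meet. Hence such a hit is possible only at the final time
      \<open>t\<close>, and then the whole segment lies on the graph anyway.\<close>
    have onM: "X s \<in> slow_graph lam h1 h2 K \<epsilon>" if s: "s \<in> ?T" for s
    proof -
      have "(\<forall>x\<in>?T. X x \<in> slow_graph lam h1 h2 K \<epsilon>) \<or>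
        (\<exists>r\<in>?T. X r \<in> slow_graph lam h1 h2 (frontier K) \<epsilon> \<and> (\<forall>x\<in>closed_segment 0 r. X x \<in> slow_graph lam h1 h2 K \<epsilon>))"
        using inv[unfolded locally_invariant_def, rule_format, OF S] X0M unfolding X_def by blast
      then show ?thesis
      proof
        assume "\<exists>r\<in>?T. X r \<in> slow_graph lam h1 h2 (frontier K) \<epsilon> \<and> (\<forall>x\<in>closed_segment 0 r. X x \<in> slow_graph lam h1 h2 K \<epsilon>)"
        then obtain r where r: "r \<in> ?T" "X r \<in> slow_graph lam h1 h2 (frontier K) \<epsilon>"
          "\<forall>x\<in>closed_segment 0 r. X x \<in> slow_graph lam h1 h2 K \<epsilon>" by blast
        have "(p1 r, p2 r) \<in> frontier K" using r(2) by (simp add: X_def graph)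
        then have "X r \<notin> G" using fr by (auto simp: X_def G_def)
        then have "r = t" using inG[OF r(1)] by blast
        then show ?thesis using r(3) s by blast
      qed (use s in blast)
    qed
    have K': "(p1 s, p2 s) \<in> K" "- (pi / 4) \<le> p1 s" "p1 s \<le> 3 * pi / 4" "w1 s = W1 (p1 s) (p2 s)" "w2 s = W2 (p1 s) (p2 s)"
      if "s \<in> ?T" for s
      using onM[OF that] seg[OF that] by (auto simp: X_def graph G'_def)
    have en: "energy lam \<epsilon> (w1 s) (w2 s) (p1 s) (p2 s) = 0" if "s \<in> ?T" for s
      using energy_conserved[OF S T(1) that T(2)] \<epsilon>(1) lam b1(3) unfolding init E_def by auto
    define \<sigma> where "\<sigma> = (\<lambda>s. sin (p1 s) * cos (p1 s))"
    have slope: "(p2 s)^2 \<le> 2 * (\<sigma> s)^2" "\<bar>(mroot lam (p1 s))^2 * (p2 s)^2 - (\<sigma> s)^2\<bar> \<le> 3 * (C3 * \<epsilon>^2) * (\<sigma> s)^2"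
      if "s \<in> ?T" for s
    proof -
      have "\<bar>(mroot lam (p1 s))^2 * (p2 s)^2 - (\<sigma> s)^2\<bar> \<le> (C3 * \<epsilon>^2) * ((\<sigma> s)^2 + (p2 s)^2)"
        using est(3)[OF K'(1-3)[OF that]] en[OF that] K'(4,5)[OF that] by (simp add: \<sigma>_def abs_minus_commute)
      from zero_energy_slope[OF _ this] 
      show "(p2 s)^2 \<le> 2 * (\<sigma> s)^2" "\<bar>(mroot lam (p1 s))^2 * (p2 s)^2 - (\<sigma> s)^2\<bar> \<le> 3 * (C3 * \<epsilon>^2) * (\<sigma> s)^2"
        using mroot_square_bounds(1)[OF lam] C3 small(2) by (simp_all add: mroot_square[OF lam])
    qed
    have p2_le: "\<bar>p2 s\<bar> \<le> 2 * \<bar>\<sigma> s\<bar>" if "s \<in> ?T" for s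
    proof -
      have "(2 * \<bar>\<sigma> s\<bar>)^2 = 4 * (\<sigma> s)^2" by (simp add: power_mult_distrib)
      then have "\<bar>p2 s\<bar>^2 \<le> (2 * \<bar>\<sigma> s\<bar>)^2"
        using slope(1)[OF that] zero_le_power2[of "\<sigma> s"] unfolding power2_abs by linarith
      then show ?thesis by (rule power2_le_imp_le) simp
    qed
    have \<sigma>0: "\<sigma> 0 = 1/2" by (simp only: \<sigma>_def init sc)
    \<comment> \<open>Since the slope is at most \<open>2 * \<bar>\<sigma>\<bar>\<close>, \<sigma>
      satisfies a linear differential inequality and keeps its sign. Within the strip this confines
      the angle to the open interval from 0 to \<open>pi / 2\<close>.\<close>
    have \<sigma>_nz: "\<sigma> s \<noteq> 0" if "s \<in> ?T" for s
    proof (rule gronwall_nonzero[OF T(1,2) that, where f = \<sigma> and k = 2])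
      fix y assume y: "y \<in> ?T"
      have "(p1 has_real_derivative p2 y) (at y within ?T)" using S y by (auto simp: solves_S_def)
      then show "(\<sigma> has_real_derivative ((cos (p1 y))^2 - 1 * (sin (p1 y))^2) * p2 y) (at y within ?T)"
        unfolding \<sigma>_def by (auto intro!: derivative_eq_intros simp: power2_eq_square algebra_simps)
      have "\<bar>((cos (p1 y))^2 - 1 * (sin (p1 y))^2) * p2 y\<bar> \<le> 1 * (2 * \<bar>\<sigma> y\<bar>)"
        unfolding abs_mult using abs_cos_sq_minus_sin_sq_le[of 1 "p1 y"] p2_le[OF y] by (intro mult_mono) auto
      then show "\<bar>((cos (p1 y))^2 - 1 * (sin (p1 y))^2) * p2 y\<bar> \<le> 2 * \<bar>\<sigma> y\<bar>" by simp
    qed (use \<sigma>0 in simp)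
    have c1: "continuous_on A p1" "continuous_on A p2" for A
      using cont continuous_on_subset by blast+
    have "0 < \<sigma> 0 \<longleftrightarrow> 0 < \<sigma> t"
      by (rule nonzero_imp_same_sign[OF _ \<sigma>_nz]) (auto simp: \<sigma>_def intro!: continuous_intros c1)
    then have \<sigma>t: "0 < \<sigma> t" using \<sigma>0 by simp
    \<comment> \<open>With \<open>\<sigma> \<noteq> 0\<close> and relative energy error below 1 a
      vanishing slope is impossible; the negative initial sign therefore persists.\<close>
    have p2_nz: "p2 s \<noteq> 0" if "s \<in> ?T" for s
    proof
      assume "p2 s = 0"
      then have "(\<sigma> s)^2 \<le> 3 * (C3 * \<epsilon>^2) * (\<sigma> s)^2" using slope(2)[OF that] by simp
      moreover have "3 * (C3 * \<epsilon>^2) * (\<sigma> s)^2 < 1 * (\<sigma> s)^2"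
      proof (rule mult_strict_right_mono)
        have "1 * \<delta> \<le> lam * \<delta>" using lam tube(1) by (intro mult_right_mono) auto
        then show "3 * (C3 * \<epsilon>^2) < 1" using small(3,4) by linarith
      qed (use \<sigma>_nz[OF that] in simp)
      ultimately show False by simp
    qed
    have "0 < p2 0 \<longleftrightarrow> 0 < p2 t"
      by (rule nonzero_imp_same_sign[OF c1(2) p2_nz])
    then have p2t: "p2 t < 0" using init(4) b1_neg p2_nz[OF T(3)] by auto
    have p1t: "0 < p1 t" "p1 t < pi / 2"
      using sin_cos_pos_in_strip[OF K'(2,3)[OF T(3)]] \<sigma>t by (simp_all add: \<sigma>_def)
    have "\<bar>mroot lam (p1 t) * p2 t + \<sigma> t\<bar> \<le> 3 * (C3 * \<epsilon>^2) * \<sigma> t"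
      by (rule zero_energy_near_slope[OF mroot_ge_1[OF lam] _ \<sigma>t slope(2)[OF T(3)]]) (use p2t in simp)
    also have "\<dots> \<le> 3 * (C3 * \<epsilon>^2) * 1"
    proof (rule mult_left_mono)
      have "\<bar>sin (p1 t)\<bar> * \<bar>cos (p1 t)\<bar> \<le> 1 * 1" by (intro mult_mono) auto
      then show "\<sigma> t \<le> 1" unfolding \<sigma>_def abs_mult[symmetric] by linarith
    qed (use C3 in simp)
    finally have near: "\<bar>mroot lam (p1 t) * p2 t + \<sigma> t\<bar> < \<delta>" using small(3) by simp
    have "\<bar>p2 t - limit_slope lam (p1 t)\<bar> < \<delta>"
    proof -
      let ?D = "mroot lam (p1 t)"
      have "p2 t - limit_slope lam (p1 t) = (?D * p2 t + \<sigma> t) / ?D"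
        using mroot_pos[OF lam, of "p1 t"] by (simp add: limit_slope_def[OF lam] \<sigma>_def field_simps)
      then have "\<bar>p2 t - limit_slope lam (p1 t)\<bar> = \<bar>?D * p2 t + \<sigma> t\<bar> / ?D"
        using mroot_pos[OF lam, of "p1 t"] by simp
      also have "\<dots> \<le> \<bar>?D * p2 t + \<sigma> t\<bar> / 1"
        using mroot_ge_1[OF lam, of "p1 t"] by (intro divide_left_mono) auto
      finally show ?thesis using near by simp
    qed
    then have "(p1 t, p2 t) \<in> D" using tube(2) p1t by simp
    moreover have "\<bar>w1 t\<bar> < M" "\<bar>w2 t\<bar> < M" using est(1,2) K'[OF T(3)] by simp_all
    ultimately have "X t \<in> G" using p1t by (auto simp: X_def G_def abs_less_iff)
    then show ?thesis
      unfolding ok_def using onM[OF T(3)] p1t p2t en[OF T(3)] p2_le[OF T(3)] \<sigma>t by (simp add: \<sigma>_def)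
  qed
  have contX: "continuous_on UNIV X" unfolding X_def by (intro continuous_intros cont)
  have XG: "X t \<in> G" for t
    by (rule never_leaves_open_set[OF contX G X0G]) (use key in \<open>auto simp: ok_def\<close>)
  then have ok: "ok t" for t using key closure_subset[of G] by blast
  have bd: "\<bar>w1 t\<bar> \<le> M \<and> \<bar>w2 t\<bar> \<le> M \<and> \<bar>p2 t\<bar> \<le> M" for t
  proof -
    have "(p1 t, p2 t) \<in> K" using XG[of t] D(2) by (auto simp: X_def G_def)
    then have "\<bar>p2 t\<bar> \<le> M"
      using B(2)[of "p1 t" "p2 t"] M(2) real_sqrt_ge_abs2[of "p2 t" "sin (p1 t) * cos (p1 t)"] by linarith
    then show ?thesis using XG[of t] by (auto simp: X_def G_def)
  qed
  then have "solves_S lam \<epsilon> UNIV w1 w2 p1 p2" by (intro sol) auto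
  then show ?thesis using init(3) ok bd unfolding ok_def X_def by blast
qed

section \<open>Decay rates and convergence\<close>

text \<open>Re-inserting the quadratic bounds for \<open>w1\<close> and \<open>w2\<close> into the energy identity improves the
  relative error of \<open>b\<close> from \<open>O(\<epsilon>\<^sup>2)\<close> to \<open>O(\<epsilon>\<^sup>2 (sin a cos a)\<^sup>2)\<close>. This is integrable along
  the orbit, which is why the decay rates are not perturbed.\<close>

lemma refined_slope:
  fixes lam \<epsilon> K :: real
  defines "W0 \<equiv> K + 5 * lam^2"
  assumes lam: "lam \<ge> 1" and \<epsilon>: "0 < \<epsilon>" "\<epsilon> \<le> 1" and K: "0 \<le> K" and small: "\<epsilon>^2 * W0 \<le> 1/2"
    and s: "0 < sin a * cos a" and b: "b < 0" "\<bar>b\<bar> \<le> 2 * (sin a * cos a)"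
    and w1: "\<bar>w1 - w_crit lam a b\<bar> \<le> K * \<epsilon> * (sin a * cos a)^2" and w2: "\<bar>w2\<bar> \<le> K * \<epsilon> * (sin a * cos a)^2"
    and en: "energy lam \<epsilon> w1 w2 a b = 0"
  shows "\<bar>w1\<bar> \<le> W0 * (sin a * cos a)^2"
    and "\<bar>mroot lam a * b + sin a * cos a\<bar> \<le> 11 * lam^2 * (5 * W0 + W0^2) * \<epsilon>^2 * (sin a * cos a)^3"
proof -
  define \<sigma> where "\<sigma> = sin a * cos a"
  have W0: "0 \<le> W0" using K by (simp add: W0_def)
  have b2: "b^2 \<le> 4 * \<sigma>^2" using power_mono[OF b(2), of 2] by (simp add: power_mult_distrib \<sigma>_def)
  have \<sigma>: "0 < \<sigma>" "\<sigma> \<le> 1" "\<sigma>^2 \<le> 1"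
  proof -
    show p: "0 < \<sigma>" using s by (simp add: \<sigma>_def)
    have "\<bar>sin a\<bar> * \<bar>cos a\<bar> \<le> 1 * 1" by (intro mult_mono) auto
    then show l: "\<sigma> \<le> 1" unfolding \<sigma>_def abs_mult[symmetric] by linarith
    show "\<sigma>^2 \<le> 1" using p l by (simp add: power_le_one)
  qed
  have "w_crit lam a b \<le> lam^2 * (b^2 + \<sigma>^2)" "0 \<le> w_crit lam a b"
    using w_crit_bounds[OF lam] by (simp_all add: \<sigma>_def)
  moreover have "lam^2 * (b^2 + \<sigma>^2) \<le> lam^2 * (5 * \<sigma>^2)" using b2 by (intro mult_left_mono) auto
  moreover have "\<epsilon> * (K * \<sigma>^2) \<le> 1 * (K * \<sigma>^2)" using \<epsilon> K by (intro mult_right_mono) auto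
  moreover have "\<bar>w1 - w_crit lam a b\<bar> \<le> \<epsilon> * (K * \<sigma>^2)" using w1 by (simp add: \<sigma>_def mult_ac)
  ultimately have "\<bar>w1\<bar> \<le> K * \<sigma>^2 + lam^2 * (5 * \<sigma>^2)" by linarith
  also have "\<dots> = W0 * \<sigma>^2" by (simp add: W0_def algebra_simps)
  finally have w1': "\<bar>w1\<bar> \<le> W0 * \<sigma>^2" .
  then show "\<bar>w1\<bar> \<le> W0 * (sin a * cos a)^2" by (simp add: \<sigma>_def)
  have "K * \<sigma>^2 \<le> W0 * \<sigma>^2" by (intro mult_right_mono) (auto simp: W0_def)
  then have "\<epsilon> * (K * \<sigma>^2) \<le> \<epsilon> * (W0 * \<sigma>^2)" using \<epsilon>(1) by (intro mult_left_mono) auto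
  then have w2': "\<bar>w2\<bar> \<le> \<epsilon> * (W0 * \<sigma>^2)" using w2 by (simp add: \<sigma>_def mult_ac)
  have "\<epsilon>^2 * (W0 * \<sigma>^2) \<le> \<epsilon>^2 * (W0 * 1)" using W0 \<sigma>(3) by (intro mult_left_mono) auto
  then have "\<epsilon>^2 * (W0 * \<sigma>^2) \<le> 1/2" using small by simp
  \<comment> \<open>The second use of the estimate, now with \<open>W = W0 * \<sigma>^2\<close>,
    which makes the error quartic in \<sigma>.\<close>
  from energy_estimate[OF lam \<epsilon> w1' w2' this, of a b]
  have "\<bar>(mroot lam a)^2 * b^2 - \<sigma>^2\<bar> \<le> 11 * lam^2 * \<epsilon>^2 * (W0 * \<sigma>^2 * (\<sigma>^2 + b^2) + (W0 * \<sigma>^2)^2)"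
    using en by (simp add: mroot_square[OF lam] \<sigma>_def abs_minus_commute)
  also have "\<dots> \<le> 11 * lam^2 * \<epsilon>^2 * (W0 * \<sigma>^2 * (5 * \<sigma>^2) + (W0 * \<sigma>^2)^2)"
    using b2 W0 by (intro mult_left_mono add_right_mono) auto
  also have "\<dots> = (11 * lam^2 * (5 * W0 + W0^2) * \<epsilon>^2 * \<sigma>^2) * \<sigma>^2" by (simp add: power2_eq_square algebra_simps)
  finally have "\<bar>(mroot lam a)^2 * b^2 - \<sigma>^2\<bar> \<le> (11 * lam^2 * (5 * W0 + W0^2) * \<epsilon>^2 * \<sigma>^2) * \<sigma>^2" .
  from zero_energy_near_slope[OF mroot_ge_1[OF lam] _ \<sigma>(1) this] b(1)
  have "\<bar>mroot lam a * b + \<sigma>\<bar> \<le> (11 * lam^2 * (5 * W0 + W0^2) * \<epsilon>^2 * \<sigma>^2) * \<sigma>" by simp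
  also have "\<dots> = 11 * lam^2 * (5 * W0 + W0^2) * \<epsilon>^2 * \<sigma>^3" by (simp add: power2_eq_square power3_eq_cube)
  finally show "\<bar>mroot lam a * b + sin a * cos a\<bar> \<le> 11 * lam^2 * (5 * W0 + W0^2) * \<epsilon>^2 * (sin a * cos a)^3"
    by (simp add: \<sigma>_def)
qed

lemma tendsto_0_by_bound:
  fixes f g :: "real \<Rightarrow> real"
  assumes "(g \<longlongrightarrow> 0) F" "\<And>x. \<bar>f x\<bar> \<le> g x"
  shows "(f \<longlongrightarrow> 0) F"
  by (rule Lim_null_comparison[OF _ assms(1)]) (use assms(2) in simp)

lemma tendsto_min_exp:
  fixes lam :: real assumes lam: "lam > 0"
  shows "((\<lambda>x. min (exp (x / lam)) (exp (- x))) \<longlongrightarrow> 0) at_top" "((\<lambda>x. min (exp (x / lam)) (exp (- x))) \<longlongrightarrow> 0) at_bot"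
proof -
  have "((\<lambda>x. exp (- x)) \<longlongrightarrow> (0::real)) at_top"
    by (rule filterlim_compose[OF exp_at_bot filterlim_uminus_at_bot_at_top])
  then show "((\<lambda>x. min (exp (x / lam)) (exp (- x))) \<longlongrightarrow> 0) at_top"
    by (rule tendsto_0_by_bound) (auto simp: min_def)
  have "filterlim (\<lambda>x. 1 / lam * x) at_bot at_bot"
    by (rule filterlim_tendsto_pos_mult_at_bot[OF tendsto_const _ filterlim_ident]) (use lam in simp)
  then have "((\<lambda>x. exp (x / lam)) \<longlongrightarrow> 0) at_bot"
    by (intro filterlim_compose[OF exp_at_bot]) simp
  then show "((\<lambda>x. min (exp (x / lam)) (exp (- x))) \<longlongrightarrow> 0) at_bot"
    by (rule tendsto_0_by_bound) (auto simp: min_def)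
qed

theorem theorem4p1:
  fixes lam \<epsilon>0 :: real and \<phi>10 :: "real \<Rightarrow> real" and K :: "(real \<times> real) set" and m :: nat
    and h1 h2 :: "real \<Rightarrow> real \<Rightarrow> real \<Rightarrow> real"
  assumes "lam \<ge> 1" and "m \<ge> 1"
    and "limit_profile lam \<phi>10"
    and "admissible_region \<phi>10 K"
    and "slow_manifold_family lam K m h1 h2 \<epsilon>0"
  shows "\<exists>\<epsilon>1 C. 0 < \<epsilon>1 \<and> \<epsilon>1 \<le> \<epsilon>0 \<and> (\<forall>\<epsilon>\<in>{0<..<\<epsilon>1}. \<exists>w1 w2 \<phi>1 \<phi>2.
    solves_S lam \<epsilon> UNIV w1 w2 \<phi>1 \<phi>2 \<and>
    ((\<lambda>x. (w1 x, w2 x, \<phi>1 x, \<phi>2 x)) \<longlongrightarrow> (0, 0, pi / 2, 0)) at_bot \<and>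
    ((\<lambda>x. (w1 x, w2 x, \<phi>1 x, \<phi>2 x)) \<longlongrightarrow> (0, 0, 0, 0)) at_top \<and>
    (\<forall>x. (w1 x, w2 x, \<phi>1 x, \<phi>2 x) \<in> slow_graph lam h1 h2 K \<epsilon>) \<and>
    (\<forall>x. \<bar>w1 x - w_crit lam (\<phi>1 x) (\<phi>2 x)\<bar> \<le> C * \<epsilon> * min (exp (2 * x / lam)) (exp (- 2 * x)) \<and>
         \<bar>w2 x\<bar> \<le> C * \<epsilon> * min (exp (2 * x / lam)) (exp (- 2 * x)) \<and>
         \<bar>\<phi>1 x - \<phi>10 x\<bar> \<le> C * \<epsilon> * min (exp (x / lam)) (exp (- x)) \<and>
         \<bar>\<phi>2 x - deriv \<phi>10 x\<bar> \<le> C * \<epsilon> * min (exp (x / lam)) (exp (- x)) \<and>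
         \<phi>2 x < 0))"
proof -
  note lam = assms(1)
  have prof: "limit_profile lam \<phi>10" by (rule assms(3))
  obtain D where "smooth_domain D" and KD: "K = closure D"
    and Dp: "\<And>x. (\<phi>10 x, deriv \<phi>10 x) \<in> D" "(pi / 2, 0) \<in> D" "(0, 0) \<in> D" and K: "compact K"
    using assms(4) unfolding admissible_region_def by blast
  then have D: "open D" by (simp add: smooth_domain_def)
  have DK: "D \<subseteq> K" using KD closure_subset by blast
  note fam = assms(5)[unfolded slow_manifold_family_def]
  have \<epsilon>0: "0 < \<epsilon>0" using fam by blast
  have Ck: "Ck_on m {(a, b, e) | a b e. (a, b) \<in> K \<and> 0 \<le> e} (\<lambda>(a, b, e). h a b e)" if "h \<in> {h1, h2}" for h
    using fam that by blast
  \<comment> \<open>The compactness arguments need a closed range of \<open>e\<close>, while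
    \<open>h\<close> is known to vanish at the equilibria only for \<open>e < \<epsilon>0\<close>;
    hence the half.\<close>
  have h0: "h (pi / 2) 0 e = 0 \<and> h 0 0 e = 0" if "h \<in> {h1, h2}" "0 \<le> e" "e \<le> \<epsilon>0 / 2" for h e
    using fam that \<epsilon>0 by auto
  have inv: "locally_invariant lam e (slow_graph lam h1 h2 K e) (slow_graph lam h1 h2 (frontier K) e)"
    if "0 < e" "e < \<epsilon>0" for e
    using fam that by simp
  let ?\<rho> = "\<lambda>a b. sqrt ((sin a * cos a)^2 + b^2)"
  have "\<exists>C\<ge>0. \<forall>a b e. (a, b) \<in> K \<longrightarrow> - (pi / 4) \<le> a \<longrightarrow> a \<le> 3 * pi / 4 \<longrightarrow> 0 \<le> e \<longrightarrow> e \<le> \<epsilon>0 / 2 \<longrightarrow>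
      \<bar>h a b e\<bar> \<le> C * ?\<rho> a b" if "h \<in> {h1, h2}" for h
    using h0[OF that] by (intro slow_graph_function_linear_bound[OF assms(2) K D DK Dp(3,2) Ck[OF that]]) auto
  from this[of h1] this[of h2] obtain Ca Cb where Ca: "Ca \<ge> 0" "Cb \<ge> 0"
    "\<And>a b e. (a, b) \<in> K \<Longrightarrow> - (pi / 4) \<le> a \<Longrightarrow> a \<le> 3 * pi / 4 \<Longrightarrow> 0 \<le> e \<Longrightarrow> e \<le> \<epsilon>0 / 2 \<Longrightarrow> \<bar>h1 a b e\<bar> \<le> Ca * ?\<rho> a b"
    "\<And>a b e. (a, b) \<in> K \<Longrightarrow> - (pi / 4) \<le> a \<Longrightarrow> a \<le> 3 * pi / 4 \<Longrightarrow> 0 \<le> e \<Longrightarrow> e \<le> \<epsilon>0 / 2 \<Longrightarrow> \<bar>h2 a b e\<bar> \<le> Cb * ?\<rho> a b"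
    by auto
  define Ch where "Ch = Ca + Cb"
  have Ch0: "Ch \<ge> 0" using Ca by (simp add: Ch_def)
  have Ch: "\<bar>h a b e\<bar> \<le> Ch * ?\<rho> a b"
    if "(a, b) \<in> K" "- (pi / 4) \<le> a" "a \<le> 3 * pi / 4" "h \<in> {h1, h2}" "0 \<le> e" "e \<le> \<epsilon>0 / 2" for h a b e
  proof -
    have "Ca * ?\<rho> a b \<le> Ch * ?\<rho> a b" "Cb * ?\<rho> a b \<le> Ch * ?\<rho> a b"
      unfolding Ch_def using Ca(1,2) by (intro mult_right_mono; simp)+
    then show ?thesis using that(4) Ca(3)[OF that(1-3,5,6)] Ca(4)[OF that(1-3,5,6)] by auto
  qed
  have hc: "continuous_on K (\<lambda>p. h (fst p) (snd p) e)" if "h \<in> {h1, h2}" "0 \<le> e" for h e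
  proof -
    have "continuous_on K (\<lambda>p. (\<lambda>(a, b, e). h a b e) (fst p, snd p, e))"
      by (rule continuous_on_compose2[OF Ck_on_imp_continuous_on[OF Ck[OF that(1)]]])
         (use that(2) in \<open>auto intro!: continuous_intros\<close>)
    then show ?thesis by simp
  qed
  have "bounded ((\<lambda>p. ?\<rho> (fst p) (snd p)) ` K)"
    by (intro compact_imp_bounded compact_continuous_image K continuous_intros)
  then obtain B0 where B0: "\<And>p. p \<in> K \<Longrightarrow> norm (?\<rho> (fst p) (snd p)) \<le> B0" unfolding bounded_iff by blast
  define B where "B = max B0 1"
  have B: "1 \<le> B" "?\<rho> a b \<le> B" if "(a, b) \<in> K" for a b
    using B0[OF that] by (simp_all add: B_def)
  have B1: "1 \<le> B" by (simp add: B_def)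
  obtain \<delta>0 where \<delta>0: "\<delta>0 > 0" "\<And>a b. 0 \<le> a \<Longrightarrow> a \<le> pi / 2 \<Longrightarrow> \<bar>b - limit_slope lam a\<bar> < \<delta>0 \<Longrightarrow> (a, b) \<in> D"
    using tube_around_limit_curve[OF lam prof D Dp] by blast
  \<comment> \<open>The second entry yields \<open>lam * \<delta> \<le> 1/2\<close>, required for
    the choice of the initial slope, and \<open>\<delta> \<le> 1/2\<close>, so that being below
    \<delta> also settles the absolute smallness conditions.\<close>
  define \<delta> where "\<delta> = min \<delta>0 (1 / (2 * lam))"
  have \<delta>: "0 < \<delta>" "lam * \<delta> \<le> 1/2" "\<delta> \<le> 1/2"
  proof -
    show "0 < \<delta>" using \<delta>0 lam by (simp add: \<delta>_def)
    have "lam * \<delta> \<le> lam * (1 / (2 * lam))" using lam by (intro mult_left_mono) (auto simp: \<delta>_def)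
    then show l: "lam * \<delta> \<le> 1/2" using lam by simp
    have "1 * \<delta> \<le> lam * \<delta>" using lam \<open>0 < \<delta>\<close> by (intro mult_right_mono) auto
    then show "\<delta> \<le> 1/2" using l by simp
  qed
  have tube: "(a, b) \<in> D" if "0 \<le> a" "a \<le> pi / 2" "\<bar>b - limit_slope lam a\<bar> < \<delta>" for a b
    using \<delta>0(2) that by (simp add: \<delta>_def)
  define C2 where "C2 = lam^2 * B + Ch"
  define C3 where "C3 = 11 * lam^2 * (C2 * B + C2^2)"
  define M where "M = C2 * B + B + 1"
  define Cc where "Cc = 50 * lam^4 * (M + 1)"
  define K1 where "K1 = 32 * Cc * lam^4"
  define W0 where "W0 = K1 + 5 * lam^2"
  define C4 where "C4 = 11 * lam^2 * (5 * W0 + W0^2)"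
  define C1 where "C1 = (1 + lam) * exp (travel_time lam (pi/4) + 2 * lam) + 2 * lam * exp (2 - travel_time lam (pi/4) / lam)"
  \<comment> \<open>Every smallness condition is reduced to \<open>\<epsilon> * c < \<delta>\<close>
    or \<open>\<epsilon>^2 * c < \<delta>\<close> for a summand \<open>c\<close> of
    \<open>L\<close>, so \<open>\<epsilon> < \<delta> / L\<close> covers all of them.\<close>
  define L where "L = 1 + 2 * M + 3 * C3 + 4 * C3 * B^2 + 32 * Cc * lam^2 + W0 + 2 * C4"
  have C2: "0 \<le> C2" using B1 Ch0 by (simp add: C2_def)
  have C3: "0 \<le> C3" using B1 C2 by (simp add: C3_def)
  have "0 \<le> C2 * B" using C2 B1 by simp
  then have M: "C2 * B < M" "B < M" "0 \<le> M" using B1 by (simp_all add: M_def)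
  have Cc: "0 \<le> Cc" using M by (simp add: Cc_def)
  have K1: "0 \<le> K1" using Cc by (simp add: K1_def)
  have W0: "0 \<le> W0" using K1 by (simp add: W0_def)
  have C4: "0 \<le> C4" using W0 by (simp add: C4_def)
  have C1: "0 \<le> C1" using lam by (simp add: C1_def)
  have L_ge: "1 \<le> L" "2 * M \<le> L" "3 * C3 \<le> L" "4 * C3 * B^2 \<le> L" "32 * Cc * lam^2 \<le> L" "W0 \<le> L" "2 * C4 \<le> L"
  proof -
    have "0 \<le> 4 * C3 * B^2" "0 \<le> 32 * Cc * lam^2" using C3 Cc by simp_all
    then show "1 \<le> L" "2 * M \<le> L" "3 * C3 \<le> L" "4 * C3 * B^2 \<le> L" "32 * Cc * lam^2 \<le> L" "W0 \<le> L" "2 * C4 \<le> L"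
      using M C3 W0 C4 unfolding L_def by linarith+
  qed
  define \<epsilon>1 where "\<epsilon>1 = min (\<epsilon>0 / 2) (\<delta> / L)"
  define C where "C = K1 * C1^2 + 4 * lam * C1 * C4 + C1 * (1 + (1 + lam^2) * 4 * lam) * C4"
  show ?thesis
  proof (rule exI[of _ \<epsilon>1], rule exI[of _ C], intro conjI ballI)
    show "0 < \<epsilon>1" using \<epsilon>0 \<delta> L_ge(1) by (simp add: \<epsilon>1_def)
    show "\<epsilon>1 \<le> \<epsilon>0" using \<epsilon>0 by (simp add: \<epsilon>1_def)
    fix \<epsilon> assume "\<epsilon> \<in> {0<..<\<epsilon>1}"
    then have \<epsilon>: "0 < \<epsilon>" "\<epsilon> < \<epsilon>0 / 2" "\<epsilon> < \<delta> / L" by (auto simp: \<epsilon>1_def)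
    have \<epsilon>L: "\<epsilon> * L < \<delta>" using \<epsilon>(3) L_ge(1) by (simp add: pos_less_divide_eq)
    have \<epsilon>c: "\<epsilon> * c < \<delta>" if "c \<le> L" for c
      using mult_left_mono[OF that, of \<epsilon>] \<epsilon>(1) \<epsilon>L by linarith
    have \<epsilon>le: "\<epsilon> \<le> 1" using \<epsilon>c[OF L_ge(1)] \<delta>(3) by simp
    have \<epsilon>sq: "\<epsilon>^2 * c < \<delta>" if "c \<le> L" "0 \<le> c" for c
    proof -
      have "\<epsilon>^2 * c \<le> \<epsilon> * c" using \<epsilon>(1) \<epsilon>le that(2) by (intro mult_right_mono) (auto simp: power2_eq_square mult_left_le)
      then show ?thesis using \<epsilon>c[OF that(1)] by linarith
    qed
    have sm: "\<epsilon>^2 * M \<le> 1/2" "C3 * \<epsilon>^2 \<le> 1/3" "3 * C3 * \<epsilon>^2 < \<delta>" "4 * C3 * \<epsilon>^2 * B^2 < \<delta>"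
      using \<epsilon>sq[OF L_ge(2)] \<epsilon>sq[OF L_ge(3)] \<epsilon>sq[OF L_ge(4)] M(3) C3 \<delta>(3) by (simp_all add: mult_ac)
    have "32 * Cc * lam^2 * \<epsilon> \<le> 1" using \<epsilon>c[OF L_ge(5)] \<delta>(3) by (simp add: mult_ac)
    then have small_Cc: "32 * (50 * lam^4 * (M + 1)) * lam^2 * \<epsilon> \<le> 1" by (simp only: Cc_def)
    have small_W0: "\<epsilon>^2 * W0 \<le> 1/2" using \<epsilon>sq[OF L_ge(6) W0] \<delta>(3) by simp
    have C4\<epsilon>: "0 \<le> C4 * \<epsilon>^2" "C4 * \<epsilon>^2 \<le> 1/2" "C4 * \<epsilon>^2 \<le> C4 * \<epsilon>"
    proof -
      show "0 \<le> C4 * \<epsilon>^2" using C4 by simp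
      show "C4 * \<epsilon>^2 \<le> 1/2" using \<epsilon>sq[OF L_ge(7)] C4 \<delta>(3) by (simp add: mult_ac)
      show "C4 * \<epsilon>^2 \<le> C4 * \<epsilon>" using \<epsilon>(1) \<epsilon>le C4 by (intro mult_left_mono) (auto simp: power2_eq_square mult_left_le)
    qed
    have "\<exists>w1 w2 p1 p2. solves_S lam \<epsilon> UNIV w1 w2 p1 p2 \<and> p1 0 = pi / 4 \<and>
      (\<forall>x. (w1 x, w2 x, p1 x, p2 x) \<in> slow_graph lam h1 h2 K \<epsilon> \<and> \<bar>w1 x\<bar> \<le> M \<and> \<bar>w2 x\<bar> \<le> M \<and>
        0 < p1 x \<and> p1 x < pi / 2 \<and> p2 x < 0 \<and> \<bar>p2 x\<bar> \<le> 2 * (sin (p1 x) * cos (p1 x)) \<and>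
        energy lam \<epsilon> (w1 x) (w2 x) (p1 x) (p2 x) = 0)"
    proof (rule orbit_on_slow_graph[where D = D and B = B and C = Ch and \<delta> = \<delta>])
      show "locally_invariant lam \<epsilon> (slow_graph lam h1 h2 K \<epsilon>) (slow_graph lam h1 h2 (frontier K) \<epsilon>)"
        using inv \<epsilon> by simp
      show "closed K" using K by (rule compact_imp_closed)
      show "\<bar>h a b \<epsilon>\<bar> \<le> Ch * ?\<rho> a b" if "(a, b) \<in> K" "- (pi / 4) \<le> a" "a \<le> 3 * pi / 4" "h \<in> {h1, h2}" for a b h
        using Ch[OF that] \<epsilon> by simp
      show "continuous_on K (\<lambda>p. h (fst p) (snd p) \<epsilon>)" if "h \<in> {h1, h2}" for h
        using hc[OF that] \<epsilon> by simp
    qed (use lam \<epsilon> \<epsilon>le D DK B(2) B1 Ch0 \<delta> tube M sm in \<open>simp_all only: C2_def C3_def\<close>)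
    then obtain w1 w2 p1 p2 where S: "solves_S lam \<epsilon> UNIV w1 w2 p1 p2" and p10: "p1 0 = pi / 4"
      and graph: "\<And>x. (w1 x, w2 x, p1 x, p2 x) \<in> slow_graph lam h1 h2 K \<epsilon>"
      and wM: "\<And>x. \<bar>w1 x\<bar> \<le> M" "\<And>x. \<bar>w2 x\<bar> \<le> M"
      and p1: "\<And>x. 0 < p1 x" "\<And>x. p1 x < pi / 2" and p2: "\<And>x. p2 x < 0"
      and p2le: "\<And>x. \<bar>p2 x\<bar> \<le> 2 * (sin (p1 x) * cos (p1 x))"
      and en: "\<And>x. energy lam \<epsilon> (w1 x) (w2 x) (p1 x) (p2 x) = 0"
      by blast
    have sc: "0 < sin (p1 x) * cos (p1 x)" for x
      using p1[of x] by (intro mult_pos_pos sin_gt_zero2 cos_gt_zero)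
    have fast: "\<bar>w1 x - w_crit lam (p1 x) (p2 x)\<bar> \<le> K1 * \<epsilon> * (sin (p1 x) * cos (p1 x))^2"
      "\<bar>w2 x\<bar> \<le> K1 * \<epsilon> * (sin (p1 x) * cos (p1 x))^2" for x
      using solution_near_slow_manifold[OF lam M(3) \<epsilon>(1) small_Cc S wM sc p2le, of x]
      by (simp_all only: K1_def Cc_def)
    note refined = refined_slope[OF lam \<epsilon>(1) \<epsilon>le K1 small_W0[unfolded W0_def] sc p2 p2le fast en, folded W0_def]
    have approx: "\<bar>mroot lam (p1 x) * p2 x + sin (p1 x) * cos (p1 x)\<bar> \<le> (C4 * \<epsilon>^2) * (sin (p1 x) * cos (p1 x))^3" for x
      using refined(2)[of x] by (simp only: C4_def)
    have dp1: "(p1 has_real_derivative p2 x) (at x)" for x using S by (auto simp: solves_S_def)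
    define \<mu> where "\<mu> = (\<lambda>x. min (exp (x / lam)) (exp (- x)))"
    have \<mu>0: "0 \<le> \<mu> x" for x by (simp add: \<mu>_def)
    \<comment> \<open>\<open>profile_comparison\<close> is applied with
      \<open>C4 * \<epsilon>^2\<close> as its \<delta>, so angle and slope are even within
      O(\<epsilon>^2) of the limit profile.\<close>
    have cmp: "sin (p1 x) * cos (p1 x) \<le> C1 * \<mu> x" "\<bar>p1 x - \<phi>10 x\<bar> \<le> 4 * lam * C1 * (C4 * \<epsilon>^2) * \<mu> x"
      "\<bar>p2 x - deriv \<phi>10 x\<bar> \<le> C1 * (1 + (1 + lam^2) * 4 * lam) * (C4 * \<epsilon>^2) * \<mu> x" for x
      using profile_comparison[OF lam prof dp1 p1 p10 C4\<epsilon>(1,2) approx, of x] by (simp_all only: C1_def \<mu>_def)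
    have sc2: "(sin (p1 x) * cos (p1 x))^2 \<le> C1^2 * (\<mu> x)^2" for x
      using power_mono[OF cmp(1)[of x] less_imp_le[OF sc[of x]], of 2] by (simp add: power_mult_distrib)
    have \<mu>2: "(\<mu> x)^2 = min (exp (2 * x / lam)) (exp (- 2 * x))" for x
    proof -
      have "(exp (x / lam))^2 = exp (2 * x / lam)" "(exp (- x))^2 = exp (- 2 * x)"
        by (simp_all add: exp_double[symmetric])
      moreover have "(min a b)^2 = min (a^2) (b^2)" if "0 \<le> a" "0 \<le> b" for a b :: real
        using that power_mono[of a b 2] power_mono[of b a 2] by (auto simp: min_def)
      ultimately show ?thesis by (simp add: \<mu>_def)
    qed
    have nn: "0 \<le> K1 * C1^2" "0 \<le> 4 * lam * C1 * C4" "0 \<le> C1 * (1 + (1 + lam^2) * 4 * lam) * C4"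
      using K1 C1 C4 lam by simp_all
    then have C: "K1 * C1^2 \<le> C" "4 * lam * C1 * C4 \<le> C" "C1 * (1 + (1 + lam^2) * 4 * lam) * C4 \<le> C"
      unfolding C_def by linarith+
    have fastC: "y \<le> C * \<epsilon> * min (exp (2 * x / lam)) (exp (- 2 * x))"
      if "y \<le> K1 * \<epsilon> * (sin (p1 x) * cos (p1 x))^2" for x y
    proof -
      have "y \<le> K1 * \<epsilon> * (C1^2 * (\<mu> x)^2)"
        using that mult_left_mono[OF sc2[of x], of "K1 * \<epsilon>"] K1 \<epsilon>(1) by simp
      also have "\<dots> = (K1 * C1^2) * (\<epsilon> * (\<mu> x)^2)" by simp
      also have "\<dots> \<le> C * (\<epsilon> * (\<mu> x)^2)" using C(1) \<epsilon>(1) by (intro mult_right_mono) auto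
      finally show ?thesis by (simp add: \<mu>2 mult.assoc)
    qed
    \<comment> \<open>Here \<open>\<epsilon>\<^sup>2\<close> is weakened to \<epsilon>, so that one
      constant serves all four estimates.\<close>
    have slowC: "y \<le> C * \<epsilon> * \<mu> x" if "y \<le> c * (C4 * \<epsilon>^2) * \<mu> x" "0 \<le> c" "c * C4 \<le> C" for x y c
    proof -
      have "c * (C4 * \<epsilon>^2) * \<mu> x \<le> c * (C4 * \<epsilon>) * \<mu> x"
        by (rule mult_right_mono[OF mult_left_mono[OF C4\<epsilon>(3) that(2)] \<mu>0])
      also have "\<dots> = (c * C4) * (\<epsilon> * \<mu> x)" by simp
      also have "\<dots> \<le> C * (\<epsilon> * \<mu> x)" using that(3) \<epsilon>(1) \<mu>0 by (intro mult_right_mono) auto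
      finally show ?thesis using that(1) by simp
    qed
    have lam0: "0 < lam" using lam by simp
    have lim: "(\<mu> \<longlongrightarrow> 0) at_top" "(\<mu> \<longlongrightarrow> 0) at_bot" 
      unfolding \<mu>_def by (rule tendsto_min_exp[OF lam0])+
    have decay: "(w1 \<longlongrightarrow> 0) F \<and> (w2 \<longlongrightarrow> 0) F \<and> (p2 \<longlongrightarrow> 0) F \<and> ((\<lambda>x. p1 x - \<phi>10 x) \<longlongrightarrow> 0) F"
      if F: "(\<mu> \<longlongrightarrow> 0) F" for F
    proof (intro conjI)
      have l2: "((\<lambda>x. c * (C1^2 * (\<mu> x)^2)) \<longlongrightarrow> 0) F" for c
        using tendsto_mult[OF tendsto_const[of c] tendsto_mult[OF tendsto_const[of "C1^2"] tendsto_power[OF F, of 2]]] by simp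
      have l1: "((\<lambda>x. c * \<mu> x) \<longlongrightarrow> 0) F" for c
        using tendsto_mult[OF tendsto_const[of c] F] by simp
      show "(w1 \<longlongrightarrow> 0) F"
      proof (rule tendsto_0_by_bound[OF l2[of W0]])
        show "\<bar>w1 x\<bar> \<le> W0 * (C1^2 * (\<mu> x)^2)" for x
          using refined(1)[of x] mult_left_mono[OF sc2[of x] W0] by linarith
      qed
      show "(w2 \<longlongrightarrow> 0) F"
      proof (rule tendsto_0_by_bound[OF l2[of "K1 * \<epsilon>"]])
        show "\<bar>w2 x\<bar> \<le> K1 * \<epsilon> * (C1^2 * (\<mu> x)^2)" for x
          using fast(2)[of x] mult_left_mono[OF sc2[of x], of "K1 * \<epsilon>"] K1 \<epsilon>(1) by simp
      qed
      show "(p2 \<longlongrightarrow> 0) F"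
      proof (rule tendsto_0_by_bound[OF l1[of "2 * C1"]])
        show "\<bar>p2 x\<bar> \<le> 2 * C1 * \<mu> x" for x using p2le[of x] cmp(1)[of x] by simp
      qed
      show "((\<lambda>x. p1 x - \<phi>10 x) \<longlongrightarrow> 0) F"
        by (rule tendsto_0_by_bound[OF l1 cmp(2)])
    qed
    have \<phi>lim: "(\<phi>10 \<longlongrightarrow> pi / 2) at_bot" "(\<phi>10 \<longlongrightarrow> 0) at_top" using prof by (simp_all add: limit_profile_def)
    have p1lim: "(p1 \<longlongrightarrow> pi / 2) at_bot" "(p1 \<longlongrightarrow> 0) at_top"
      using tendsto_add[OF conjunct2[OF conjunct2[OF conjunct2[OF decay[OF lim(2)]]]] \<phi>lim(1)]
        tendsto_add[OF conjunct2[OF conjunct2[OF conjunct2[OF decay[OF lim(1)]]]] \<phi>lim(2)] by simp_all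
    show "\<exists>w1 w2 \<phi>1 \<phi>2.
    solves_S lam \<epsilon> UNIV w1 w2 \<phi>1 \<phi>2 \<and>
    ((\<lambda>x. (w1 x, w2 x, \<phi>1 x, \<phi>2 x)) \<longlongrightarrow> (0, 0, pi / 2, 0)) at_bot \<and>
    ((\<lambda>x. (w1 x, w2 x, \<phi>1 x, \<phi>2 x)) \<longlongrightarrow> (0, 0, 0, 0)) at_top \<and>
    (\<forall>x. (w1 x, w2 x, \<phi>1 x, \<phi>2 x) \<in> slow_graph lam h1 h2 K \<epsilon>) \<and>
    (\<forall>x. \<bar>w1 x - w_crit lam (\<phi>1 x) (\<phi>2 x)\<bar> \<le> C * \<epsilon> * min (exp (2 * x / lam)) (exp (- 2 * x)) \<and>
         \<bar>w2 x\<bar> \<le> C * \<epsilon> * min (exp (2 * x / lam)) (exp (- 2 * x)) \<and>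
         \<bar>\<phi>1 x - \<phi>10 x\<bar> \<le> C * \<epsilon> * min (exp (x / lam)) (exp (- x)) \<and>
         \<bar>\<phi>2 x - deriv \<phi>10 x\<bar> \<le> C * \<epsilon> * min (exp (x / lam)) (exp (- x)) \<and>
         \<phi>2 x < 0)"
    proof (rule exI[of _ w1], rule exI[of _ w2], rule exI[of _ p1], rule exI[of _ p2], intro conjI allI)
      show "solves_S lam \<epsilon> UNIV w1 w2 p1 p2" by (rule S)
      show "((\<lambda>x. (w1 x, w2 x, p1 x, p2 x)) \<longlongrightarrow> (0, 0, pi / 2, 0)) at_bot"
        using decay[OF lim(2)] p1lim(1) by (intro tendsto_Pair) blast+
      show "((\<lambda>x. (w1 x, w2 x, p1 x, p2 x)) \<longlongrightarrow> (0, 0, 0, 0)) at_top"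
        using decay[OF lim(1)] p1lim(2) by (intro tendsto_Pair) blast+
      fix x
      show "(w1 x, w2 x, p1 x, p2 x) \<in> slow_graph lam h1 h2 K \<epsilon>" by (rule graph)
      show "\<bar>w1 x - w_crit lam (p1 x) (p2 x)\<bar> \<le> C * \<epsilon> * min (exp (2 * x / lam)) (exp (- 2 * x))"
        by (rule fastC[OF fast(1)])
      show "\<bar>w2 x\<bar> \<le> C * \<epsilon> * min (exp (2 * x / lam)) (exp (- 2 * x))" by (rule fastC[OF fast(2)])
      show "\<bar>p1 x - \<phi>10 x\<bar> \<le> C * \<epsilon> * min (exp (x / lam)) (exp (- x))"
        using slowC[OF cmp(2) _ C(2)] lam C1 by (simp add: \<mu>_def)
      show "\<bar>p2 x - deriv \<phi>10 x\<bar> \<le> C * \<epsilon> * min (exp (x / lam)) (exp (- x))"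
        using slowC[OF cmp(3) _ C(3)] lam C1 by (simp add: \<mu>_def)
      show "p2 x < 0" by (rule p2)
    qed
  qed
qed

end
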